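(* Let $b,c\in\mathbb{N}$ and let $\theta\in\mathbb{R}$ be fixed with $0<\theta<1$. (i) If $1<c<b$, then as $T\to\infty$ $$M_{1,b,c}^{\theta}(T)=K_{1,b,c}T-C_{1,c,b}T^{1-\theta(1/2-1/(2c))}-C_{1,b,c}T^{1-\theta(1/2-1/(2b))}+O\big(T^{1-\theta/2}(\log T)^2+T^{1/2+\theta/2}\big).$$ (ii) If $b=c>1$, then $$M_{1,b,b}^{\theta}(T)=K_{1,b,b}T-H_b(\log T)\,T^{1-\theta(1/2-1/(2b))}+O\big(T^{1-\theta/2}(\log T)^2+T^{1/2+\theta/2}\big).$$
   Context: For $\theta>0$ and real $\sigma$, $\tau>0$, let $D_\theta(\sigma+i\tau)=\sum_{1\le n\le (\tau/2\pi)^{\theta}} n^{-\sigma-i\tau}$, and $$M_{1,b,c}^{\theta}(T)=\int_0^T D_\theta(1/2+it)\,\zeta(1/2-ibt)\,\zeta(1/2-ict)\,dt.$$ Let $\gamma$ be Euler's constant and $\lambda_\theta=2/\theta-1$. Define $K_{1,b,c}=\zeta((1+b)/2)\zeta((1+c)/2)$ and, for $r,s\in\mathbb{N}$, $r>1$, $$C_{1,r,s}=\frac{4r}{\theta(r-1)(\lambda_\theta r+1)}\,\zeta\Big(\frac{s}{2r}+\frac12\Big)(2\pi)^{\theta(1/2-1/(2r))}.$$ For $r>1$ let $E_{0,r}=\frac{4\gamma}{r-1}+\frac{4}{(r-1)^2}$, $E_{1,r}=\frac{2}{r(r-1)}$, $F_{0,r}=\frac{4\gamma}{\lambda_\theta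 r+1}-\frac{4}{(\lambda_\theta r+1)^2}$, $F_{1,r}=\frac{2}{r(\lambda_\theta r+1)}$, $H_{0,r}=E_{0,r}+F_{0,r}$, $H_{1,r}=E_{1,r}+F_{1,r}$, and define the linear polynomial $$H_r(x)=(2\pi)^{\theta(1/2-1/(2r))}\big(\theta H_{1,r}x+H_{0,r}-\theta H_{1,r}\log 2\pi\big).$$ Implied constants depend on $b,c,\theta$. *)

theory Defs
  imports "HOL-Analysis.Analysis" "HOL-Library.Landau_Symbols"
begin

text \<open>Riemann zeta function, via the Dirichlet eta function. The alternating series
  converges (conditionally) for Re s > 0, and 1 - 2 powr (1 - s) is nonzero there
  except at s = 1 (and other points on Re s = 1). This agrees with the analytically
  continued Riemann zeta function on {s. Re s > 0, 2 powr (1-s) \<noteq> 1}, which contains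
  every argument used below.\<close>
definition dirichlet_eta :: "complex \<Rightarrow> complex" where
  "dirichlet_eta s = (\<Sum>n. (-1) ^ n / (of_nat (Suc n)) powr s)"

definition riemann_zeta :: "complex \<Rightarrow> complex" where
  "riemann_zeta s = dirichlet_eta s / (1 - 2 powr (1 - s))"

definition Dpoly :: "real \<Rightarrow> real \<Rightarrow> real \<Rightarrow> complex" where
  "Dpoly \<theta> \<sigma> \<tau> =
     (\<Sum>n\<in>{n::nat. 1 \<le> n \<and> real n \<le> (\<tau> / (2 * pi)) powr \<theta>}.
        (of_nat n) powr (- (complex_of_real \<sigma> + \<i> * complex_of_real \<tau>)))"

definition M1 :: "real \<Rightarrow> nat \<Rightarrow> nat \<Rightarrow> real \<Rightarrow> complex" where
  "M1 \<theta> b c T = integral {0..T} (\<lambda>t.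
      Dpoly \<theta> (1/2) t * riemann_zeta (1/2 - \<i> * of_real (real b * t))
                      * riemann_zeta (1/2 - \<i> * of_real (real c * t)))"

definition lam :: "real \<Rightarrow> real" where
  "lam \<theta> = 2 / \<theta> - 1"

definition K1 :: "nat \<Rightarrow> nat \<Rightarrow> complex" where
  "K1 b c = riemann_zeta (of_real ((1 + real b) / 2)) * riemann_zeta (of_real ((1 + real c) / 2))"

definition C1 :: "real \<Rightarrow> nat \<Rightarrow> nat \<Rightarrow> complex" where
  "C1 \<theta> r s = of_real (4 * real r / (\<theta> * (real r - 1) * (lam \<theta> * real r + 1))
        * (2 * pi) powr (\<theta> * (1/2 - 1 / (2 * real r))))
      * riemann_zeta (of_real (real s / (2 * real r) + 1/2))"

definition E0 :: "nat \<Rightarrow> real" where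
  "E0 r = 4 * euler_mascheroni / (real r - 1) + 4 / (real r - 1)^2"
definition E1 :: "nat \<Rightarrow> real" where
  "E1 r = 2 / (real r * (real r - 1))"
definition F0 :: "real \<Rightarrow> nat \<Rightarrow> real" where
  "F0 \<theta> r = 4 * euler_mascheroni / (lam \<theta> * real r + 1) - 4 / (lam \<theta> * real r + 1)^2"
definition F1 :: "real \<Rightarrow> nat \<Rightarrow> real" where
  "F1 \<theta> r = 2 / (real r * (lam \<theta> * real r + 1))"
definition H0 :: "real \<Rightarrow> nat \<Rightarrow> real" where
  "H0 \<theta> r = E0 r + F0 \<theta> r"
definition H1 :: "real \<Rightarrow> nat \<Rightarrow> real" where
  "H1 \<theta> r = E1 r + F1 \<theta> r"

definition Hpoly :: "real \<Rightarrow> nat \<Rightarrow> real \<Rightarrow> real" where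
  "Hpoly \<theta> r x = (2 * pi) powr (\<theta> * (1/2 - 1 / (2 * real r)))
      * (\<theta> * H1 \<theta> r * x + H0 \<theta> r - \<theta> * H1 \<theta> r * ln (2 * pi))"

definition err_term :: "real \<Rightarrow> real \<Rightarrow> real" where
  "err_term \<theta> T = T powr (1 - \<theta>/2) * (ln T)^2 + T powr (1/2 + \<theta>/2)"

end

theory Submission
  imports Defs "HOL-Complex_Analysis.Complex_Analysis"
begin

text \<open>
  Write the integral as a sum over \<open>n \<le> (T/2\<pi>)\<^sup>\<theta>\<close> of the integrals of
  \<open>n\<^bsup>-1/2-z\<^esup> \<zeta>(1/2 - bz) \<zeta>(1/2 - cz)\<close> over the part of the imaginary axis between
  \<open>\<i>\<tau>\<^sub>n\<close> and \<open>\<i>T\<close>, where \<open>\<tau>\<^sub>n = 2\<pi>n\<^bsup>1/\<theta>\<^esup>\<close>, and move each of them to the line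
  \<open>Re z = -1/2\<close>, where both zeta factors converge absolutely. On the horizontal segments the
  integrand is \<open>O((T/n)\<^bsup>1/2\<^esup>)\<close>, by a bound of convexity strength for \<open>\<zeta>\<close> that van der Corput's
  method yields without logarithms; these segments contribute \<open>O(T\<^bsup>1/2+\<theta>/2\<^esup>)\<close>. On the new line
  the terms \<open>m\<^sup>b k\<^sup>c \<noteq> n\<close> oscillate and contribute \<open>O(T\<^sup>\<theta> log T)\<close>, while the terms
  \<open>m\<^sup>b k\<^sup>c = n\<close> give the integral over \<open>t\<close> of the sum of \<open>m\<^bsup>-(1+b)/2\<^esup> k\<^bsup>-(1+c)/2\<^esup>\<close> over
  \<open>m\<^sup>b k\<^sup>c \<le> X = (t/2\<pi>)\<^sup>\<theta>\<close>. The hyperbola method, with both variables cut at \<open>X\<^bsup>1/(b+c)\<^esup>\<close>,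
  evaluates this sum up to \<open>O(X\<^bsup>-1/2\<^esup>)\<close>.
\<close>

section \<open>The zeta function in the right half-plane\<close>

text \<open>\<open>riemann_zeta\<close> is a quotient that takes the value 0 at the points of Re s =
  1 with 2^(1-s) = 1, since division by zero gives 0, and the shifted path crosses that line. The
  analysis therefore uses \<open>zeta_cont\<close>; the two functions are identified only for Re s =
  1/2 and at real points. The shift produces no residues: the poles z = -1/(2b) and z = -1/(2c) are
  real, and every path starts at height at least 1.

  The estimates balance exactly. Moving left by u multiplies n^(-1/2) by n^u, while the two zeta
  factors, each O(t^(1/4 - u/2)) because b, c >= 2, together lose t^u. As n <= t, the worst case is
  u = 0. Summing (T/n)^(1/2) over n <= T^theta already gives the full error T^(1/2 + theta/2), so
  the zeta bound has to be uniform in the abscissa, even near 1, where the sum of n^(-sigma) becomes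
  logarithmic. Only the oscillating terms have room for a logarithm, since theta < 1/2 +
  theta/2.\<close>

lemma norm_of_real_powr:
  "0 < x \<Longrightarrow> norm (complex_of_real x powr s) = x powr Re s"
  by (simp add: norm_powr_real_powr)

lemma norm_of_nat_powr:
  "0 < n \<Longrightarrow> norm (of_nat n powr (s::complex)) = real n powr Re s"
  using norm_of_real_powr[of "real n" s] by simp

lemma segment_of_real_cases:
  assumes "z \<in> closed_segment (complex_of_real x) (of_real y)" "x \<le> y"
  obtains u where "z = of_real u" "x \<le> u" "u \<le> y"
  using assms by (auto simp: closed_segment_of_real closed_segment_eq_real_ivl)

text \<open>Mean value bound along a real segment, on which the derivative is largest at
  \<open>x\<close>. Allowing Re s >= -1 makes it applicable to the exponent 1 - s too, with s - 1 in
  place of s.\<close>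

lemma norm_powr_minus_diff_le:
  fixes s :: complex
  assumes "0 < x" "x \<le> y" "Re s \<ge> -1"
  shows "norm (of_real y powr (-s) - of_real x powr (-s)) \<le> norm s * x powr (-Re s - 1) * (y - x)"
proof -
  let ?S = "closed_segment (complex_of_real x) (of_real y)"
  have "norm (of_real y powr (-s) - of_real x powr (-s))
      \<le> (norm s * x powr (-Re s - 1)) * norm (complex_of_real y - of_real x)"
  proof (rule field_differentiable_bound[where S = ?S and f' = "\<lambda>z. (-s) * z powr (-s-1)"])
    fix z assume "z \<in> ?S"
    then obtain u where u: "z = of_real u" "x \<le> u" "u \<le> y"
      using segment_of_real_cases assms by blast
    have "z \<notin> \<real>\<^sub>\<le>\<^sub>0" unfolding u(1) using u(2) assms by simp
    then show "((\<lambda>z. z powr (-s)) has_field_derivative (-s) * z powr (-s-1)) (at z within ?S)"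
      by (rule has_field_derivative_at_within[OF has_field_derivative_powr])
    show "norm ((-s) * z powr (-s-1)) \<le> norm s * x powr (-Re s - 1)"
      using u assms by (auto simp: norm_mult norm_of_real_powr intro!: mult_left_mono powr_mono2')
  qed auto
  also have "norm (complex_of_real y - of_real x) = y - x"
    using assms by (metis abs_of_nonneg diff_ge_0_iff_ge norm_of_real of_real_diff)
  finally show ?thesis .
qed

text \<open>First-order Euler-Maclaurin on one unit interval: the expression is the increment of
  \<open>?h\<close>, whose derivative (s-1)(n^(-s) - z^(-s)) is small by
  \<open>norm_powr_minus_diff_le\<close>. The power of n gained makes these increments summable for
  Re s > 0.\<close>

lemma zeta_step_bound:
  fixes s :: complex
  assumes "0 < n" "Re s \<ge> 0"
  shows "norm ((s-1) * of_nat n powr (-s) + (of_nat (Suc n) powr (1-s) - of_nat n powr (1-s)))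
         \<le> norm (s-1) * norm s * real n powr (-Re s - 1)"
proof -
  let ?S = "closed_segment (complex_of_real n) (of_real (Suc n))"
  let ?h = "\<lambda>z. (s-1) * of_real n powr (-s) * z + z powr (1-s)"
  have "norm (?h (of_real (Suc n)) - ?h (of_real n))
      \<le> (norm (s-1) * (norm s * real n powr (-Re s - 1))) * norm (complex_of_real (Suc n) - of_real n)"
  proof (rule field_differentiable_bound[where S = ?S and f = ?h
            and f' = "\<lambda>z. (s-1) * of_real n powr (-s) + (1 - s) * z powr (1-s-1)"])
    fix z assume "z \<in> ?S"
    then obtain u where u: "z = of_real u" "real n \<le> u" "u \<le> Suc n"
      using segment_of_real_cases[of z "real n" "Suc n"] by auto
    have "z \<notin> \<real>\<^sub>\<le>\<^sub>0" unfolding u(1) using u(2) assms by simp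
    then show "(?h has_field_derivative (s-1) * of_real n powr (-s) + (1 - s) * z powr (1-s-1)) (at z within ?S)"
      by (intro DERIV_add has_field_derivative_at_within[OF has_field_derivative_powr] DERIV_cmult_Id)
    have eq: "(s-1) * of_real n powr (-s) + (1 - s) * z powr (1-s-1)
       = (s-1) * (of_real n powr (-s) - of_real u powr (-s))"
      by (simp add: u algebra_simps)
    have "norm (of_real u powr (-s) - of_real n powr (-s))
         \<le> norm s * real n powr (-Re s - 1) * (u - n)"
      using norm_powr_minus_diff_le[of "real n" u s] u assms by simp
    also have "\<dots> \<le> norm s * real n powr (-Re s - 1) * 1"
      using u by (intro mult_left_mono) auto
    finally show "norm ((s-1) * of_real n powr (-s) + (1 - s) * z powr (1-s-1))
         \<le> norm (s-1) * (norm s * real n powr (-Re s - 1))"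
      unfolding eq by (auto simp: norm_mult norm_minus_commute intro!: mult_left_mono)
  qed auto
  also have "norm (complex_of_real (Suc n) - of_real n) = 1" by simp
  also have "?h (of_real (Suc n)) - ?h (of_real n) = 
     (s-1) * of_nat n powr (-s) + (of_nat (Suc n) powr (1-s) - of_nat n powr (1-s))"
    by (simp add: algebra_simps)
  finally show ?thesis by (simp add: algebra_simps)
qed

text \<open>The mean value theorem writes the difference as sigma * z^(-sigma-1) with n < z < n+1 <=
  2n; replacing z by 2n costs the factor 2^(sigma+1).\<close>

lemma powr_le_telescope:
  fixes \<sigma> :: real
  assumes "0 < \<sigma>" "0 < n"
  shows "real n powr (-\<sigma>-1) \<le> 2 powr (\<sigma>+1) / \<sigma> * (real n powr (-\<sigma>) - real (Suc n) powr (-\<sigma>))"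
proof -
  have "\<exists>z. real n < z \<and> z < real (Suc n) \<and>
     real (Suc n) powr (-\<sigma>) - real n powr (-\<sigma>) = (real (Suc n) - real n) * ((-\<sigma>) * z powr (-\<sigma>-1))"
    by (rule MVT2) (use assms in \<open>auto intro!: derivative_eq_intros\<close>)
  then obtain z where z: "real n < z" "z < real (Suc n)"
     "real (Suc n) powr (-\<sigma>) - real n powr (-\<sigma>) = -\<sigma> * z powr (-\<sigma>-1)" by auto
  have "2 powr (-\<sigma>-1) * real n powr (-\<sigma>-1) = (2 * real n) powr (-\<sigma>-1)"
    by (simp add: powr_mult)
  also have "\<dots> \<le> z powr (-\<sigma>-1)"
    using z assms by (intro powr_mono2') auto
  also have "\<dots> = (real n powr (-\<sigma>) - real (Suc n) powr (-\<sigma>)) / \<sigma>"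
    using z(3) assms by (simp add: field_simps)
  finally have "2 powr (\<sigma>+1) * (2 powr (-\<sigma>-1) * real n powr (-\<sigma>-1))
      \<le> 2 powr (\<sigma>+1) * ((real n powr (-\<sigma>) - real (Suc n) powr (-\<sigma>)) / \<sigma>)"
    by (intro mult_left_mono) auto
  moreover have "2 powr (\<sigma>+1) * (2 powr (-\<sigma>-1) * real n powr (-\<sigma>-1)) = real n powr (-\<sigma>-1)"
    by (simp add: mult.assoc[symmetric] powr_add[symmetric])
  ultimately show ?thesis by simp
qed

lemma sum_powr_tail_le:
  fixes \<sigma> :: real
  assumes "0 < \<sigma>" "0 < N" "N \<le> M"
  shows "(\<Sum>n\<in>{N..<M}. real n powr (-\<sigma>-1)) \<le> 2 powr (\<sigma>+1) / \<sigma> * real N powr (-\<sigma>)"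
proof -
  have "(\<Sum>n\<in>{N..<M}. real n powr (-\<sigma>-1))
     \<le> (\<Sum>n\<in>{N..<M}. 2 powr (\<sigma>+1) / \<sigma> * (real n powr (-\<sigma>) - real (Suc n) powr (-\<sigma>)))"
    using assms by (intro sum_mono powr_le_telescope) auto
  also have "\<dots> = 2 powr (\<sigma>+1) / \<sigma> * (real N powr (-\<sigma>) - real M powr (-\<sigma>))"
    using assms(3) sum_Suc_diff'[of N M "\<lambda>n. - (real n powr (-\<sigma>))"]
    by (simp add: sum_distrib_left[symmetric] sum_divide_distrib[symmetric])
  also have "\<dots> \<le> 2 powr (\<sigma>+1) / \<sigma> * real N powr (-\<sigma>)"
    using assms by (intro mult_left_mono) auto
  finally show ?thesis .
qed

text \<open>The truncated zeta series with its Euler-Maclaurin tail term N^(1-s)/(s-1), multiplied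
  through by s - 1 so that it is entire for N > 0.\<close>

definition zeta_approx :: "nat \<Rightarrow> complex \<Rightarrow> complex" where
  "zeta_approx N s = (s-1) * (\<Sum>n\<in>{1..<N}. of_nat n powr (-s)) + of_nat N powr (1-s)"

text \<open>The limit of \<^const>\<open>zeta_approx\<close> is \<open>(s - 1) \<zeta>(s)\<close>, which has no singularity in
  the right half-plane.\<close>

definition zeta_reg :: "complex \<Rightarrow> complex" where
  "zeta_reg s = lim (\<lambda>N. zeta_approx N s)"

definition zeta_cont :: "complex \<Rightarrow> complex" where
  "zeta_cont s = zeta_reg s / (s-1)"

lemma zeta_approx_Suc:
  "0 < N \<Longrightarrow> zeta_approx (Suc N) s = zeta_approx N s +
     ((s-1) * of_nat N powr (-s) + (of_nat (Suc N) powr (1-s) - of_nat N powr (1-s)))"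
  by (simp add: zeta_approx_def algebra_simps atLeastLessThanSuc)

lemma zeta_approx_diff_le:
  assumes "Re s > 0" "0 < N" "N \<le> M"
  shows "norm (zeta_approx M s - zeta_approx N s)
     \<le> norm (s-1) * norm s * (2 powr (Re s+1) / Re s) * real N powr (-Re s)"
proof -
  have "zeta_approx M s - zeta_approx N s = (\<Sum>n\<in>{N..<M}. zeta_approx (Suc n) s - zeta_approx n s)"
    using sum_Suc_diff'[OF assms(3), of "\<lambda>n. zeta_approx n s"] by simp
  also have "norm \<dots> \<le> (\<Sum>n\<in>{N..<M}. norm (s-1) * norm s * real n powr (-Re s - 1))"
    using assms by (intro sum_norm_le) (use zeta_step_bound in \<open>auto simp: zeta_approx_Suc simp del: of_nat_Suc\<close>)
  also have "\<dots> = norm (s-1) * norm s * (\<Sum>n\<in>{N..<M}. real n powr (-Re s - 1))"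
    by (simp add: sum_distrib_left)
  also have "\<dots> \<le> norm (s-1) * norm s * (2 powr (Re s+1) / Re s * real N powr (-Re s))"
    using assms by (intro mult_left_mono sum_powr_tail_le) auto
  finally show ?thesis by (simp add: algebra_simps)
qed

lemma tendsto_mult_powr_neg: "0 < \<sigma> \<Longrightarrow> (\<lambda>N. C * real N powr (-\<sigma>)) \<longlonglongrightarrow> 0"
  by (intro tendsto_mult_right_zero tendsto_neg_powr filterlim_real_sequentially) simp

lemma zeta_approx_tendsto:
  assumes "Re s > 0"
  shows "(\<lambda>N. zeta_approx N s) \<longlonglongrightarrow> zeta_reg s"
proof -
  let ?C = "norm (s-1) * norm s * (2 powr (Re s+1) / Re s)"
  have "Cauchy (\<lambda>N. zeta_approx N s)"
  proof (rule CauchyI')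
    fix e :: real assume "e > 0"
    have "\<forall>\<^sub>F N in sequentially. ?C * real N powr (-Re s) < e"
      using tendsto_mult_powr_neg[OF assms, of ?C] \<open>e > 0\<close> by (rule order_tendstoD)
    then obtain N0 where N0: "\<And>N. N \<ge> N0 \<Longrightarrow> ?C * real N powr (-Re s) < e"
      by (auto simp: eventually_sequentially)
    show "\<exists>M. \<forall>m\<ge>M. \<forall>n>m. dist (zeta_approx m s) (zeta_approx n s) < e"
    proof (intro exI[of _ "max 1 N0"] allI impI)
      fix m n assume "m \<ge> max 1 N0" "n > m"
      then have "norm (zeta_approx n s - zeta_approx m s) \<le> ?C * real m powr (-Re s)"
        using zeta_approx_diff_le[OF assms, of m n] by simp
      also have "\<dots> < e" using N0 \<open>m \<ge> max 1 N0\<close> by simp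
      finally show "dist (zeta_approx m s) (zeta_approx n s) < e"
        by (simp add: dist_norm norm_minus_commute)
    qed
  qed
  then show ?thesis
    unfolding zeta_reg_def by (simp add: Cauchy_convergent_iff convergent_LIMSEQ_iff)
qed

lemma zeta_reg_diff_le:
  assumes "Re s > 0" "0 < N"
  shows "norm (zeta_reg s - zeta_approx N s)
     \<le> norm (s-1) * norm s * (2 powr (Re s+1) / Re s) * real N powr (-Re s)"
proof (rule tendsto_upperbound)
  show "(\<lambda>M. norm (zeta_approx M s - zeta_approx N s)) \<longlonglongrightarrow> norm (zeta_reg s - zeta_approx N s)"
    by (intro tendsto_intros zeta_approx_tendsto assms)
  show "\<forall>\<^sub>F M in sequentially. norm (zeta_approx M s - zeta_approx N s)
     \<le> norm (s-1) * norm s * (2 powr (Re s+1) / Re s) * real N powr (-Re s)"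
    using eventually_ge_at_top[of N] by eventually_elim (intro zeta_approx_diff_le assms)
qed auto

text \<open>The truncation formula behind all later estimates of zeta: N is about t^2 for the bounds
  in the strip, tends to infinity for Re s >= 3/2, and is the integer after the floor of x in the
  hyperbola method.\<close>

lemma zeta_cont_diff_le:
  assumes "Re s > 0" "0 < N" "s \<noteq> 1"
  shows "norm (zeta_cont s - ((\<Sum>n\<in>{1..<N}. of_nat n powr (-s)) + of_nat N powr (1-s) / (s-1)))
     \<le> norm s * (2 powr (Re s+1) / Re s) * real N powr (-Re s)"
proof -
  have "zeta_cont s - ((\<Sum>n\<in>{1..<N}. of_nat n powr (-s)) + of_nat N powr (1-s) / (s-1))
     = (zeta_reg s - zeta_approx N s) / (s-1)"
    using assms(3) by (simp add: zeta_cont_def zeta_approx_def diff_divide_distrib add_divide_distrib)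
  also have "norm \<dots> \<le> norm (s-1) * norm s * (2 powr (Re s+1) / Re s) * real N powr (-Re s) / norm (s-1)"
    unfolding norm_divide by (intro divide_right_mono zeta_reg_diff_le assms) auto
  also have "\<dots> = norm s * (2 powr (Re s+1) / Re s) * real N powr (-Re s)"
    using assms(3) by simp
  finally show ?thesis .
qed

lemma zeta_reg_holomorphic: "zeta_reg holomorphic_on {s. Re s > 0}"
proof (rule holomorphic_uniform_sequence[where f = "\<lambda>N. zeta_approx (Suc N)"])
  show "open {s. Re s > 0}" by (rule open_halfspace_Re_gt)
  show "zeta_approx (Suc N) holomorphic_on {s. Re s > 0}" for N
    unfolding zeta_approx_def
    by (intro holomorphic_on_add holomorphic_on_mult holomorphic_on_sum holomorphic_on_diff
        holomorphic_on_minus holomorphic_on_powr_right holomorphic_on_ident holomorphic_on_const)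
next
  fix x assume x: "x \<in> {s. Re s > 0}"
  \<comment> \<open>Half the distance to the boundary: on the closed disc Re y >= d > 0, so the
    truncation error is uniform there.\<close>
  define d where "d = Re x / 2"
  have d: "d > 0" using x by (simp add: d_def)
  have b: "Re y \<ge> d" "Re y \<le> norm x + d" "norm y \<le> norm x + d" if "y \<in> cball x d" for y
  proof -
    have "norm (x - y) \<le> d" using that by (simp add: dist_norm)
    then have "Re x - Re y \<le> d" "norm y \<le> norm x + d"
      using complex_Re_le_cmod[of "x - y"] norm_triangle_ineq2[of y x] norm_minus_commute[of y x]
      by simp_all
    then show "Re y \<ge> d" "norm y \<le> norm x + d" by (auto simp: d_def)
    then show "Re y \<le> norm x + d" using complex_Re_le_cmod[of y] by linarith
  qed
  define C where "C = (norm x + d + 1) * (norm x + d) * (2 powr (norm x + d + 1) / d)"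
  have "uniform_limit (cball x d) (\<lambda>N. zeta_approx (Suc N)) zeta_reg sequentially"
  proof (rule uniform_limitI)
    fix e :: real assume "e > 0"
    have "(\<lambda>N. C * real (Suc N) powr (-d)) \<longlonglongrightarrow> 0"
      using tendsto_mult_powr_neg[OF d, of C] by (rule LIMSEQ_Suc)
    then have "\<forall>\<^sub>F N in sequentially. C * real (Suc N) powr (-d) < e"
      using \<open>e > 0\<close> by (rule order_tendstoD)
    then show "\<forall>\<^sub>F N in sequentially. \<forall>y\<in>cball x d. dist (zeta_approx (Suc N) y) (zeta_reg y) < e"
    proof eventually_elim
      case (elim N)
      show ?case
      proof
        fix y assume y: "y \<in> cball x d"
        have "norm (zeta_reg y - zeta_approx (Suc N) y)
          \<le> norm (y-1) * norm y * (2 powr (Re y+1) / Re y) * real (Suc N) powr (-Re y)"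
          using b[OF y] d by (intro zeta_reg_diff_le) auto
        also have "\<dots> \<le> (norm x + d + 1) * (norm x + d) * (2 powr (norm x + d + 1) / d) * real (Suc N) powr (-d)"
          using b[OF y] d norm_triangle_ineq4[of y 1]
          by (intro mult_mono frac_le powr_mono mult_nonneg_nonneg divide_nonneg_nonneg) simp_all
        also have "\<dots> < e" using elim by (simp add: C_def)
        finally show "dist (zeta_approx (Suc N) y) (zeta_reg y) < e"
          by (simp add: dist_norm norm_minus_commute)
      qed
    qed
  qed
  moreover have "cball x d \<subseteq> {s. Re s > 0}" 
  proof
    fix y assume "y \<in> cball x d"
    from b(1)[OF this] d show "y \<in> {s. Re s > 0}" by simp
  qed
  ultimately show "\<exists>d>0. cball x d \<subseteq> {s. Re s > 0} \<and>
      uniform_limit (cball x d) (\<lambda>N. zeta_approx (Suc N)) zeta_reg sequentially"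
    using d by (intro exI[of _ d] conjI)
qed

lemma zeta_cont_holomorphic: "zeta_cont holomorphic_on {s. Re s > 0} - {1}"
proof -
  have "zeta_reg holomorphic_on {s. Re s > 0} - {1}"
    by (rule holomorphic_on_subset[OF zeta_reg_holomorphic]) auto
  then show ?thesis unfolding zeta_cont_def [abs_def]
    by (intro holomorphic_on_divide holomorphic_on_diff holomorphic_on_ident holomorphic_on_const) simp_all
qed

section \<open>Identification with the alternating series\<close>

lemma sum_alternating_split:
  fixes f :: "nat \<Rightarrow> 'a::comm_ring_1"
  shows "(\<Sum>n<2*N. (-1)^n * f (Suc n)) = (\<Sum>n\<in>{1..<2*N+1}. f n) - 2 * (\<Sum>n\<in>{1..<N+1}. f (2*n))"
proof (induction N)
  case (Suc N)
  have "{1..<2 * Suc N + 1} = insert (2*N+2) (insert (2*N+1) {1..<2*N+1})"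
    "{1..<Suc N + 1} = insert (N+1) {1..<N+1}" by auto
  with Suc show ?case by (simp add: ring_distribs)
qed simp

text \<open>The alternating sum is the sum up to 2N minus 2^(1-s) times the sum up to N. When both
  are completed by their tail terms, the difference \<open>D\<close> of two consecutive values of
  n^(1-s) is left over. For Re s < 1 these values diverge separately, but their difference is
  O(n^(-Re s)).\<close>

lemma dirichlet_eta_partial_limit:
  assumes "Re s > 0" "s \<noteq> 1"
  shows "(\<lambda>N. \<Sum>n<2*N. (-1)^n * of_nat (Suc n) powr (-s)) \<longlonglongrightarrow> zeta_cont s * (1 - 2 powr (1-s))"
proof -
  define E where "E = (\<lambda>N. (\<Sum>n\<in>{1..<N}. of_nat n powr (-s)) + of_nat N powr (1-s) / (s-1))"
  have E: "E \<longlonglongrightarrow> zeta_cont s"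
  proof -
    have "E = (\<lambda>N. zeta_approx N s / (s-1))"
      using assms by (auto simp: E_def zeta_approx_def add_divide_distrib)
    then show ?thesis
      unfolding zeta_cont_def using assms by (auto intro!: tendsto_intros zeta_approx_tendsto)
  qed
  have E1: "(\<lambda>N. E (2*N+1)) \<longlonglongrightarrow> zeta_cont s" "(\<lambda>N. E (N+1)) \<longlonglongrightarrow> zeta_cont s"
    by (rule filterlim_compose[OF E], rule filterlim_subseq, force intro: strict_monoI)+
  have D: "(\<lambda>N. (of_nat (2*N+2) powr (1-s) - of_nat (2*N+1) powr (1-s)) / (s-1)) \<longlonglongrightarrow> 0"
  proof (rule Lim_null_comparison)
    show "\<forall>\<^sub>F N in sequentially. norm ((of_nat (2*N+2) powr (1-s) - of_nat (2*N+1) powr (1-s)) / (s-1))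
        \<le> 1 * real (2*N+1) powr (-Re s)"
    proof (intro always_eventually allI)
      fix N
      have "norm (of_nat (2*N+2) powr (1-s) - of_nat (2*N+1) powr (1-s)) \<le> norm (s-1) * real (2*N+1) powr (-Re s)"
        using norm_powr_minus_diff_le[of "real (2*N+1)" "real (2*N+2)" "s-1"] assms by simp
      then show "norm ((of_nat (2*N+2) powr (1-s) - of_nat (2*N+1) powr (1-s)) / (s-1))
        \<le> 1 * real (2*N+1) powr (-Re s)"
        using assms by (simp add: norm_divide field_simps)
    qed
    show "(\<lambda>N. 1 * real (2*N+1) powr (-Re s)) \<longlonglongrightarrow> 0"
      by (rule filterlim_compose[OF tendsto_mult_powr_neg[OF assms(1)]])
        (rule filterlim_subseq, force intro: strict_monoI)
  qed
  have eq: "(\<Sum>n<2*N. (-1)^n * of_nat (Suc n) powr (-s)) =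
      E (2*N+1) - 2 powr (1-s) * E (N+1) +
       (of_nat (2*N+2) powr (1-s) - of_nat (2*N+1) powr (1-s)) / (s-1)" for N
  proof -
    have m: "of_nat (2*n) powr z = 2 powr z * of_nat n powr z" for n and z :: complex
      using powr_times_real[of 2 "of_nat n" z] by simp
    have 1: "(\<Sum>n<2*N. (-1)^n * of_nat (Suc n) powr (-s)) =
       (\<Sum>n\<in>{1..<2*N+1}. of_nat n powr (-s)) - 2 * (\<Sum>n\<in>{1..<N+1}. of_nat (2*n) powr (-s))"
      by (rule sum_alternating_split)
    have "2 * (2::complex) powr (-s) = 2 powr (1-s)"
      by (simp add: powr_diff powr_minus divide_inverse)
    then have 2: "2 * (\<Sum>n\<in>{1..<N+1}. of_nat (2*n) powr (-s)) = 
        2 powr (1-s) * (\<Sum>n\<in>{1..<N+1}. of_nat n powr (-s))"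
      unfolding m sum_distrib_left[symmetric] by (simp add: mult.assoc[symmetric])
    have 3: "(2::complex) powr (1-s) * of_nat (N+1) powr (1-s) = of_nat (2*N+2) powr (1-s)"
      using m[of "N+1" "1-s"] by simp
    have "E (2*N+1) - 2 powr (1-s) * E (N+1) = 
        (\<Sum>n\<in>{1..<2*N+1}. of_nat n powr (-s)) - 2 powr (1-s) * (\<Sum>n\<in>{1..<N+1}. of_nat n powr (-s))
        + of_nat (2*N+1) powr (1-s) / (s-1) - (2 powr (1-s) * of_nat (N+1) powr (1-s)) / (s-1)"
      unfolding E_def by (simp only: ring_distribs times_divide_eq_right diff_diff_eq add_diff_eq) simp
    then show ?thesis
      unfolding 1 2 3 by (simp only: diff_divide_distrib) simp
  qed
  have "(\<lambda>N. E (2*N+1) - 2 powr (1-s) * E (N+1) +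
       (of_nat (2*N+2) powr (1-s) - of_nat (2*N+1) powr (1-s)) / (s-1)) \<longlonglongrightarrow>
       zeta_cont s - 2 powr (1-s) * zeta_cont s + 0"
    by (intro tendsto_intros E1 D)
  then show ?thesis unfolding eq by (simp add: algebra_simps)
qed

lemma dirichlet_eta_eq:
  assumes "Re s > 0" "s \<noteq> 1"
  shows "dirichlet_eta s = zeta_cont s * (1 - 2 powr (1-s))"
proof -
  let ?f = "\<lambda>n. (-1) ^ n / (of_nat (Suc n)) powr s"
  let ?L = "zeta_cont s * (1 - 2 powr (1-s))"
  have f: "?f = (\<lambda>n. (-1)^n * of_nat (Suc n) powr (-s))"
    by (auto simp: powr_minus field_simps)
  have ev: "(\<lambda>N. sum ?f {..<2*N}) \<longlonglongrightarrow> ?L"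
    unfolding f by (rule dirichlet_eta_partial_limit[OF assms])
  \<comment> \<open>The terms tend to 0, so the odd partial sums inherit the limit of the even
    ones.\<close>
  have "(\<lambda>N. ?f (2*N)) \<longlonglongrightarrow> 0"
  proof (rule Lim_null_comparison)
    show "\<forall>\<^sub>F N in sequentially. norm (?f (2*N)) \<le> 1 * real (2*N+1) powr (-Re s)"
      by (intro always_eventually allI)
         (simp add: norm_divide norm_inverse norm_of_nat_powr powr_minus divide_inverse del: of_nat_Suc)
    show "(\<lambda>N. 1 * real (2*N+1) powr (-Re s)) \<longlonglongrightarrow> 0"
      by (rule filterlim_compose[OF tendsto_mult_powr_neg[OF assms(1)]])
        (rule filterlim_subseq, force intro: strict_monoI)
  qed
  with ev have "(\<lambda>N. sum ?f {..<2*N} + ?f (2*N)) \<longlonglongrightarrow> ?L + 0" by (rule tendsto_add)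
  then have od: "(\<lambda>N. sum ?f {..<Suc (2*N)}) \<longlonglongrightarrow> ?L" by simp
  have "(\<lambda>N. sum ?f {..<N}) \<longlonglongrightarrow> ?L"
  proof (rule LIMSEQ_I)
    fix e :: real assume "e > 0"
    obtain N1 where N1: "\<And>N. N \<ge> N1 \<Longrightarrow> norm (sum ?f {..<2*N} - ?L) < e"
      using LIMSEQ_D[OF ev \<open>e > 0\<close>] by blast
    obtain N2 where N2: "\<And>N. N \<ge> N2 \<Longrightarrow> norm (sum ?f {..<Suc (2*N)} - ?L) < e"
      using LIMSEQ_D[OF od \<open>e > 0\<close>] by blast
    show "\<exists>no. \<forall>n\<ge>no. norm (sum ?f {..<n} - ?L) < e"
    proof (intro exI[of _ "2 * max N1 N2 + 1"] allI impI)
      fix n assume n: "2 * max N1 N2 + 1 \<le> n"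
      show "norm (sum ?f {..<n} - ?L) < e"
      proof (cases "even n")
        case True
        then obtain k where "n = 2*k" by blast
        with n N1[of k] show ?thesis by auto
      next
        case False
        then obtain k where "n = Suc (2*k)" by (metis oddE Suc_eq_plus1)
        with n N2[of k] show ?thesis by auto
      qed
    qed
  qed
  then have "?f sums ?L" by (simp add: sums_def)
  then show ?thesis unfolding dirichlet_eta_def by (rule sums_unique[symmetric])
qed

text \<open>The modulus of 2^(1-s) is 2^(1 - Re s), so the denominator can vanish only for Re s = 1,
  and a real s there is 1. The hypothesis covers the two kinds of arguments that occur in the
  theorem: points with Re s = 1/2 and real points.\<close>

lemma riemann_zeta_eq:
  assumes "Re s > 0" "Re s \<noteq> 1 \<or> s \<in> \<real>" "s \<noteq> 1"
  shows "riemann_zeta s = zeta_cont s"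
proof -
  have "(2::complex) powr (1-s) \<noteq> 1"
  proof
    assume *: "(2::complex) powr (1-s) = 1"
    have "norm ((2::complex) powr (1-s)) = 2 powr (1 - Re s)"
      using norm_of_real_powr[of 2 "1-s"] by simp
    with * have "2 powr (1 - Re s) = (1::real)" by simp
    then have "Re s = 1" by (simp add: powr_eq_one_iff_gen)
    with assms have "s \<in> \<real>" by auto
    then obtain r where "s = of_real r" by (rule Reals_cases)
    with \<open>Re s = 1\<close> assms(3) show False by simp
  qed
  then show ?thesis
    using dirichlet_eta_eq[OF assms(1,3)] by (simp add: riemann_zeta_def)
qed

section \<open>Van der Corput's method\<close>

lemma mult_cos_le_sin:
  fixes x :: real
  assumes "0 \<le> x" "x \<le> pi"
  shows "x * cos x \<le> sin x"
proof -
  have "sin 0 - 0 * cos 0 \<le> sin x - x * cos x"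
  proof (rule DERIV_nonneg_imp_nondecreasing[OF assms(1)])
    fix y assume y: "0 \<le> y" "y \<le> x"
    have "((\<lambda>x. sin x - x * cos x) has_real_derivative y * sin y) (at y)"
      by (auto intro!: derivative_eq_intros)
    then show "\<exists>z. ((\<lambda>x. sin x - x * cos x) has_real_derivative z) (at y) \<and> 0 \<le> z"
      using y assms by (intro exI[of _ "y * sin y"] conjI mult_nonneg_nonneg sin_ge_zero) auto
  qed
  then show ?thesis by simp
qed

lemma cot_antimono:
  fixes x y :: real
  assumes "0 < x" "x \<le> y" "y < pi"
  shows "cot y \<le> cot x"
proof -
  have s: "sin x > 0" "sin y > 0" "sin (y - x) \<ge> 0"
    using assms by (auto intro!: sin_gt_zero sin_ge_zero)
  have "cot x - cot y = sin (y - x) / (sin x * sin y)"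
    using s by (simp add: cot_def sin_diff field_simps)
  then show ?thesis using s by (metis diff_ge_0_iff_ge divide_nonneg_pos mult_pos_pos)
qed

text \<open>From x cos x <= sin x follows cot x <= 1/x; the reflection x -> pi - x supplies the
  lower bound.\<close>

lemma abs_cot_le:
  fixes x :: real
  assumes "0 < \<Delta>" "\<Delta> \<le> x" "x \<le> pi - \<Delta>"
  shows "\<bar>cot x\<bar> \<le> 1 / \<Delta>"
proof -
  have *: "cot z \<le> 1 / \<Delta>" if "\<Delta> \<le> z" "z \<le> pi - \<Delta>" for z
  proof -
    have "sin z > 0" using that assms by (intro sin_gt_zero) auto
    moreover have "z * cos z \<le> sin z" using that assms by (intro mult_cos_le_sin) auto
    ultimately have "cot z \<le> 1 / z" using that assms by (simp add: cot_def field_simps)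
    also have "\<dots> \<le> 1 / \<Delta>" using that assms by (intro divide_left_mono) auto
    finally show ?thesis .
  qed
  have "cot (pi - x) = - cot x" by (simp add: cot_def)
  with *[of x] *[of "pi - x"] assms show ?thesis by (auto simp: abs_le_iff)
qed

text \<open>With y - x = 2h + 2 pi k this is 1 / (1 - cis (2h)) = 1/2 + (i/2) cot h. A single term
  becomes a difference of consecutive terms times a factor that depends on the increment alone, the
  form needed for summation by parts.\<close>

lemma cis_eq_cot_diff:
  assumes "sin ((y - x) / 2 - pi * of_int k) \<noteq> 0"
  shows "cis x = (cis x - cis y) * (1/2 + \<i> * of_real (cot ((y - x) / 2 - pi * of_int k)) / 2)"
proof -
  define h where "h = (y - x) / 2 - pi * of_int k"
  have "y = x + (2 * h) + 2 * pi * of_int k" by (simp add: h_def field_simps)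
  then have "cis y = cis (x + (2 * h) + 2 * pi * of_int k)" by simp
  also have "\<dots> = cis x * cis (2*h)"
    by (simp add: cis_mult[symmetric] cis_multiple_2pi)
  finally have y: "cis y = cis x * cis (2*h)" .
  have "(1 - cis (2*h)) * (1/2 + \<i> * of_real (cot h) / 2) = 1"
  proof -
    have sc: "sin h * sin h + cos h * cos h = 1"
      using sin_cos_squared_add[of h] by (simp add: power2_eq_square)
    have c: "1 - cos (2*h) = 2 * sin h * sin h" "sin (2*h) = 2 * sin h * cos h"
      using cos_double_sin[of h] sin_double[of h] by (auto simp: power2_eq_square)
    show ?thesis
    proof (rule complex_eqI)
      have "Re ((1 - cis (2*h)) * (1/2 + \<i> * of_real (cot h) / 2))
          = (1 - cos (2*h)) / 2 + sin (2*h) * cot h / 2" by simp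
      also have "\<dots> = 1" using assms sc unfolding c h_def[symmetric] by (simp add: cot_def)
      finally show "Re ((1 - cis (2*h)) * (1/2 + \<i> * of_real (cot h) / 2)) = Re 1" by simp
      have "Im ((1 - cis (2*h)) * (1/2 + \<i> * of_real (cot h) / 2))
          = (1 - cos (2*h)) * cot h / 2 - sin (2*h) / 2" by simp
      also have "\<dots> = 0" using assms unfolding c h_def[symmetric] by (simp add: cot_def)
      finally show "Im ((1 - cis (2*h)) * (1/2 + \<i> * of_real (cot h) / 2)) = Im 1" by simp
    qed
  qed
  then have "cis x * 1 = cis x * ((1 - cis (2*h)) * (1/2 + \<i> * of_real (cot h) / 2))" by simp
  also have "\<dots> = (cis x - cis x * cis (2*h)) * (1/2 + \<i> * of_real (cot h) / 2)"
    by (simp only: right_diff_distrib left_diff_distrib mult_1_right mult.assoc mult_1_left)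
  finally show ?thesis unfolding y h_def[symmetric] by simp
qed

lemma decreasing_steps:
  fixes d :: "nat \<Rightarrow> real"
  assumes "\<And>n. a \<le> n \<Longrightarrow> Suc n < b \<Longrightarrow> d (Suc n) + l \<le> d n"
  shows "a \<le> m \<Longrightarrow> m \<le> n \<Longrightarrow> n < b \<Longrightarrow> d n + l * real (n - m) \<le> d m"
proof (induction n)
  case (Suc n)
  show ?case
  proof (cases "m = Suc n")
    case False
    then have "m \<le> n" using Suc.prems by simp
    with Suc.IH Suc.prems assms[of n] show ?thesis
      by (simp add: Suc_diff_le algebra_simps)
  qed simp
qed simp

text \<open>By \<open>cis_eq_cot_diff\<close> the sum is half a telescoping sum plus i/2 times
  \<open>S\<close>, the same differences weighted by cotangents \<open>c\<close>. The increments
  decrease, so \<open>c\<close> increases, and it is bounded by 2/Delta; summation by parts bounds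
  \<open>S\<close> by end values and total variation, at most 8/Delta. The result is 1 + 4/Delta,
  where 1 <= 4/Delta because Delta <= pi < 4.\<close>

theorem kusmin_landau:
  fixes \<phi> :: "nat \<Rightarrow> real"
  defines "d \<equiv> \<lambda>n. \<phi> (Suc n) - \<phi> n"
  assumes D: "0 < \<Delta>" "\<Delta> \<le> pi"
    and anti: "\<And>n. a \<le> n \<Longrightarrow> Suc n < b \<Longrightarrow> d (Suc n) \<le> d n"
    and range: "\<And>n. a \<le> n \<Longrightarrow> n < b \<Longrightarrow> \<Delta> \<le> d n - 2 * pi * of_int k \<and> d n - 2 * pi * of_int k \<le> 2 * pi - \<Delta>"
  shows "norm (\<Sum>n\<in>{a..<b}. cis (\<phi> n)) \<le> 8 / \<Delta>"
proof (cases "a < b")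
  case True
  define c where "c = (\<lambda>n. cot (d n / 2 - pi * of_int k))"
  have c_le: "\<bar>c n\<bar> \<le> 2 / \<Delta>" if "a \<le> n" "n < b" for n
    using range[OF that] D abs_cot_le[of "\<Delta>/2" "d n / 2 - pi * of_int k"] by (simp add: c_def)
  have c_mono: "c n \<le> c (Suc n)" if "a \<le> n" "Suc n < b" for n
    unfolding c_def using range[of n] range[of "Suc n"] anti[of n] D that
    by (intro cot_antimono) auto
  have eq: "cis (\<phi> n) = 1/2 * (cis (\<phi> n) - cis (\<phi> (Suc n)))
      + \<i> / 2 * (of_real (c n) * (cis (\<phi> n) - cis (\<phi> (Suc n))))" if "a \<le> n" "n < b" for n
  proof -
    have "sin ((\<phi> (Suc n) - \<phi> n) / 2 - pi * of_int k) > 0"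
      using range[OF that] D by (intro sin_gt_zero) (auto simp: d_def field_simps)
    then show ?thesis
      using cis_eq_cot_diff[of "\<phi> (Suc n)" "\<phi> n" k]
      by (simp only: c_def d_def ring_distribs) (simp add: mult.commute mult.left_commute)
  qed
  obtain m where m: "b = Suc m" "a \<le> m" using True by (cases b) auto
  define S where "S = (\<Sum>n\<in>{a..<b}. of_real (c n) * (cis (\<phi> n) - cis (\<phi> (Suc n))))"
  have abel: "(\<Sum>n\<in>{a..<Suc j}. of_real (c n) * (cis (\<phi> n) - cis (\<phi> (Suc n))))
     = of_real (c a) * cis (\<phi> a) - of_real (c j) * cis (\<phi> (Suc j)) 
       + (\<Sum>n\<in>{a..<j}. of_real (c (Suc n) - c n) * cis (\<phi> (Suc n)))" if "a \<le> j" for j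
    using that by (induction rule: nat_induct_at_least) (auto simp: algebra_simps)
  have "norm S \<le> \<bar>c a\<bar> + \<bar>c m\<bar> + (\<Sum>n\<in>{a..<m}. c (Suc n) - c n)"
  proof -
    have "norm (\<Sum>n\<in>{a..<m}. of_real (c (Suc n) - c n) * cis (\<phi> (Suc n))) \<le> (\<Sum>n\<in>{a..<m}. c (Suc n) - c n)"
    proof (rule sum_norm_le)
      fix n assume "n \<in> {a..<m}"
      with c_mono[of n] m show "norm (of_real (c (Suc n) - c n) * cis (\<phi> (Suc n))) \<le> c (Suc n) - c n"
        by (simp add: norm_mult del: of_real_diff)
    qed
    moreover have "norm (of_real (c a) * cis (\<phi> a) - of_real (c m) * cis (\<phi> (Suc m))) \<le> \<bar>c a\<bar> + \<bar>c m\<bar>"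
      by (rule order_trans[OF norm_triangle_ineq4]) (simp add: norm_mult)
    ultimately show ?thesis
      unfolding S_def m(1) abel[OF m(2)] by (intro order_trans[OF norm_triangle_ineq] add_mono)
  qed
  also have "\<dots> = \<bar>c a\<bar> + \<bar>c m\<bar> + (c m - c a)"
    using m by (simp add: sum_Suc_diff')
  also have "\<dots> \<le> 4 * (2 / \<Delta>)"
    using c_le[of a] c_le[of m] m by linarith
  also have "\<dots> = 8 / \<Delta>" by simp
  finally have S: "norm S \<le> 8 / \<Delta>" .
  have tel: "(\<Sum>n\<in>{a..<b}. cis (\<phi> n) - cis (\<phi> (Suc n))) = cis (\<phi> a) - cis (\<phi> b)"
    using True sum_Suc_diff'[of a b "\<lambda>n. - cis (\<phi> n)"] by simp
  have "(\<Sum>n\<in>{a..<b}. cis (\<phi> n)) = (\<Sum>n\<in>{a..<b}. 1/2 * (cis (\<phi> n) - cis (\<phi> (Suc n)))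
      + \<i> / 2 * (of_real (c n) * (cis (\<phi> n) - cis (\<phi> (Suc n)))))"
    by (intro sum.cong refl eq) auto
  also have "\<dots> = 1/2 * (\<Sum>n\<in>{a..<b}. cis (\<phi> n) - cis (\<phi> (Suc n))) + \<i> / 2 * S"
    unfolding S_def sum.distrib sum_distrib_left ..
  finally have "(\<Sum>n\<in>{a..<b}. cis (\<phi> n)) = 1/2 * (cis (\<phi> a) - cis (\<phi> b)) + \<i> / 2 * S"
    unfolding tel .
  also have "norm \<dots> \<le> norm (1/2 * (cis (\<phi> a) - cis (\<phi> b))) + norm (\<i> / 2 * S)"
    by (rule norm_triangle_ineq)
  also have "\<dots> \<le> 1 + 4 / \<Delta>"
    using S norm_triangle_ineq4[of "cis (\<phi> a)" "cis (\<phi> b)"] 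
    by (simp add: norm_mult norm_divide)
  also have "1 \<le> 4 / \<Delta>" using D pi_less_4 by (simp add: field_simps)
  finally show ?thesis by simp
qed (use D in auto)

lemma antimono_split:
  fixes d :: "nat \<Rightarrow> real"
  assumes "a \<le> b" and anti: "\<And>m n. a \<le> m \<Longrightarrow> m \<le> n \<Longrightarrow> n < b \<Longrightarrow> d n \<le> d m"
  obtains p where "a \<le> p" "p \<le> b" "\<And>n. a \<le> n \<Longrightarrow> n < p \<Longrightarrow> y \<le> d n" "\<And>n. p \<le> n \<Longrightarrow> n < b \<Longrightarrow> d n < y"
proof -
  let ?P = "\<lambda>n. a \<le> n \<and> (n < b \<longrightarrow> d n < y)"
  define p where "p = (LEAST n. ?P n)"
  have "?P b" using assms by simp
  then have 1: "?P p" "p \<le> b" unfolding p_def by (rule LeastI, rule Least_le)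
  have "y \<le> d n" if "a \<le> n" "n < p" for n
    using not_less_Least[of n ?P] that unfolding p_def by auto
  moreover have "d n < y" if "p \<le> n" "n < b" for n
    using anti[of p n] 1 that by auto
  ultimately show ?thesis using that[of p] 1 by auto
qed

text \<open>The increments fall by at least l per step, so at most 2 Delta / l + 1 of them lie
  within Delta of 2 pi k; to the others \<open>kusmin_landau\<close> applies. Delta = sqrt l
  balances the two: 8/Delta on either side and at most 3/Delta terms in the middle, which are
  estimated trivially.\<close>

lemma van_der_corput_block:
  fixes \<phi> :: "nat \<Rightarrow> real"
  defines "d \<equiv> \<lambda>n. \<phi> (Suc n) - \<phi> n"
  assumes l: "0 < l" "l \<le> 1"
    and step: "\<And>n. a \<le> n \<Longrightarrow> Suc n < b \<Longrightarrow> d (Suc n) + l \<le> d n"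
    and range: "\<And>n. a \<le> n \<Longrightarrow> n < b \<Longrightarrow> \<bar>d n - 2 * pi * of_int k\<bar> \<le> pi"
    and "a \<le> b"
  shows "norm (\<Sum>n\<in>{a..<b}. cis (\<phi> n)) \<le> 19 / sqrt l"
proof -
  define \<Delta> where "\<Delta> = sqrt l"
  have D: "0 < \<Delta>" "\<Delta> \<le> 1" "l = \<Delta> * \<Delta>" using l by (auto simp: \<Delta>_def)
  have p3: "pi > 3" using pi_gt3 .
  have step': "d n + l * real (n - m) \<le> d m" if "a \<le> m" "m \<le> n" "n < b" for m n
    using decreasing_steps[of a b d l m n] step that by blast
  have anti: "d n \<le> d m" if "a \<le> m" "m \<le> n" "n < b" for m n
  proof -
    have "0 \<le> l * real (n - m)" using l by simp
    then show ?thesis using step'[OF that] by linarith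
  qed
  obtain p where p: "a \<le> p" "p \<le> b" "\<And>n. a \<le> n \<Longrightarrow> n < p \<Longrightarrow> 2 * pi * of_int k + \<Delta> \<le> d n"
      "\<And>n. p \<le> n \<Longrightarrow> n < b \<Longrightarrow> d n < 2 * pi * of_int k + \<Delta>"
    using antimono_split[where d = d, OF \<open>a \<le> b\<close> anti, where y = "2 * pi * of_int k + \<Delta>"] by blast
  have anti2: "d n \<le> d m" if "p \<le> m" "m \<le> n" "n < b" for m n
    using anti[of m n] that p by simp
  obtain q where q: "p \<le> q" "q \<le> b" "\<And>n. p \<le> n \<Longrightarrow> n < q \<Longrightarrow> 2 * pi * of_int k - \<Delta> \<le> d n"
      "\<And>n. q \<le> n \<Longrightarrow> n < b \<Longrightarrow> d n < 2 * pi * of_int k - \<Delta>"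
    using antimono_split[where d = d, OF \<open>p \<le> b\<close> anti2, where y = "2 * pi * of_int k - \<Delta>"] by blast
  have 1: "norm (\<Sum>n\<in>{a..<p}. cis (\<phi> n)) \<le> 8 / \<Delta>"
  proof (rule kusmin_landau[where k = k])
    fix n assume n: "a \<le> n" "n < p"
    show "\<Delta> \<le> \<phi> (Suc n) - \<phi> n - 2 * pi * of_int k \<and>
         \<phi> (Suc n) - \<phi> n - 2 * pi * of_int k \<le> 2 * pi - \<Delta>"
    proof -
      have "\<bar>d n - 2 * pi * of_int k\<bar> \<le> pi" using range[of n] n p(2) by simp
      then show ?thesis using p(3)[OF n] D p3 unfolding d_def by (intro conjI; linarith)
    qed
  qed (use D p3 p anti d_def in auto)
  \<comment> \<open>These increments lie between 2 pi k - pi and 2 pi k - Delta, hence inside the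
    period that starts at 2 pi (k-1).\<close>
  have 3: "norm (\<Sum>n\<in>{q..<b}. cis (\<phi> n)) \<le> 8 / \<Delta>"
  proof (rule kusmin_landau[where k = "k-1"])
    fix n assume n: "q \<le> n" "n < b"
    show "\<Delta> \<le> \<phi> (Suc n) - \<phi> n - 2 * pi * of_int (k-1) \<and>
         \<phi> (Suc n) - \<phi> n - 2 * pi * of_int (k-1) \<le> 2 * pi - \<Delta>"
    proof -
      have "\<bar>d n - 2 * pi * of_int k\<bar> \<le> pi" using range[of n] n p(1) q(1) by simp
      moreover have "2 * pi * of_int (k-1) = 2 * pi * of_int k - 2 * pi" by (simp add: right_diff_distrib)
      ultimately show ?thesis using q(4)[OF n] D p3 unfolding d_def by (intro conjI; linarith)
    qed
  qed (use D p3 p q anti d_def in auto)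
  have 2: "norm (\<Sum>n\<in>{p..<q}. cis (\<phi> n)) \<le> 3 / \<Delta>"
  proof (cases "p < q")
    case True
    have "d (q-1) + l * real (q - 1 - p) \<le> d p"
      using True p q by (intro step') auto
    moreover have "d p < 2 * pi * of_int k + \<Delta>" "2 * pi * of_int k - \<Delta> \<le> d (q-1)"
      using p(4)[of p] q(3)[of "q-1"] True q p by auto
    ultimately have "\<Delta> * (\<Delta> * real (q - 1 - p)) \<le> \<Delta> * 2"
      unfolding D(3) mult.assoc by linarith
    then have "\<Delta> * real (q - 1 - p) \<le> 2" using D by simp
    then have "\<Delta> * real (q - p) \<le> 3" using True D by (simp add: of_nat_diff algebra_simps)
    then have "real (q - p) \<le> 3 / \<Delta>" using D by (simp add: field_simps)
    moreover have "norm (\<Sum>n\<in>{p..<q}. cis (\<phi> n)) \<le> (\<Sum>n\<in>{p..<q}. 1)"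
      by (rule sum_norm_le) simp
    ultimately show ?thesis by simp
  qed (use D in auto)
  have "(\<Sum>n\<in>{a..<b}. cis (\<phi> n)) = (\<Sum>n\<in>{a..<p}. cis (\<phi> n)) + (\<Sum>n\<in>{p..<q}. cis (\<phi> n)) + (\<Sum>n\<in>{q..<b}. cis (\<phi> n))"
    using p q by (simp add: sum.atLeastLessThan_concat)
  also have "norm \<dots> \<le> 8 / \<Delta> + 3 / \<Delta> + 8 / \<Delta>"
    using 1 2 3 by (intro order_trans[OF norm_triangle_ineq] add_mono)
  finally show ?thesis by (simp add: \<Delta>_def add_divide_distrib[symmetric])
qed

text \<open>Summation by parts replaces the partial sums of z by their bounds B; the reverse
  summation by parts in \<open>2\<close> turns the outcome into what terms of size B(n+1) - B(n)
  would give.\<close>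

lemma abel_inequality:
  fixes w B :: "nat \<Rightarrow> real" and z :: "nat \<Rightarrow> complex"
  assumes "a \<le> b" and w: "\<And>n. a \<le> n \<Longrightarrow> n \<le> b \<Longrightarrow> 0 \<le> w n" "\<And>n. a \<le> n \<Longrightarrow> n < b \<Longrightarrow> w (Suc n) \<le> w n"
    and B: "\<And>n. a \<le> n \<Longrightarrow> n \<le> b \<Longrightarrow> norm (\<Sum>j\<in>{a..<n}. z j) \<le> B n"
  shows "norm (\<Sum>n\<in>{a..<b}. of_real (w n) * z n) \<le> w a * B a + (\<Sum>n\<in>{a..<b}. w n * (B (Suc n) - B n))"
proof -
  let ?A = "\<lambda>n. \<Sum>j\<in>{a..<n}. z j"
  have 1: "(\<Sum>n\<in>{a..<b}. of_real (w n) * z n) =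
      of_real (w b) * ?A b + (\<Sum>n\<in>{a..<b}. of_real (w n - w (Suc n)) * ?A (Suc n))"
    using \<open>a \<le> b\<close> by (induction rule: nat_induct_at_least) (auto simp: algebra_simps)
  have 2: "w b * B b + (\<Sum>n\<in>{a..<b}. (w n - w (Suc n)) * B (Suc n)) =
      w a * B a + (\<Sum>n\<in>{a..<b}. w n * (B (Suc n) - B n))"
    using \<open>a \<le> b\<close> by (induction rule: nat_induct_at_least) (auto simp: algebra_simps)
  have "norm (of_real (w b) * ?A b) \<le> w b * B b"
    using w(1)[of b] B[of b] \<open>a \<le> b\<close> by (auto simp: norm_mult intro!: mult_left_mono)
  moreover have "norm (\<Sum>n\<in>{a..<b}. of_real (w n - w (Suc n)) * ?A (Suc n)) \<le>
       (\<Sum>n\<in>{a..<b}. (w n - w (Suc n)) * B (Suc n))"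
  proof (rule sum_norm_le)
    fix n assume n: "n \<in> {a..<b}"
    then have "norm (of_real (w n - w (Suc n)) * ?A (Suc n)) = (w n - w (Suc n)) * norm (?A (Suc n))"
      using w(2)[of n] by (simp only: norm_mult norm_of_real) simp
    also have "\<dots> \<le> (w n - w (Suc n)) * B (Suc n)"
      using w(2)[of n] B[of "Suc n"] n by (intro mult_left_mono) auto
    finally show "norm (of_real (w n - w (Suc n)) * ?A (Suc n)) \<le> (w n - w (Suc n)) * B (Suc n)" .
  qed
  ultimately show ?thesis
    unfolding 1 2[symmetric] by (intro order_trans[OF norm_triangle_ineq] add_mono)
qed

lemma abel_inequality_const:
  fixes w :: "nat \<Rightarrow> real" and z :: "nat \<Rightarrow> complex"
  assumes "a \<le> b" and w: "\<And>n. a \<le> n \<Longrightarrow> n \<le> b \<Longrightarrow> 0 \<le> w n" "\<And>n. a \<le> n \<Longrightarrow> n < b \<Longrightarrow> w (Suc n) \<le> w n"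
    and B: "\<And>n. a \<le> n \<Longrightarrow> n \<le> b \<Longrightarrow> norm (\<Sum>j\<in>{a..<n}. z j) \<le> B"
  shows "norm (\<Sum>n\<in>{a..<b}. of_real (w n) * z n) \<le> w a * B"
  using abel_inequality[of a b w z "\<lambda>_. B"] assms by simp

text \<open>Divided by t, these are the increments of the phase t ln n and their rate of decrease.
  All parts come from ln x <= x - 1; the third uses n(n+2) = (n+1)^2 - 1.\<close>

lemma ln_Suc_diff_bounds:
  assumes "0 < n"
  shows "ln (real (Suc n)) - ln (real n) \<le> 1 / real n"
    and "1 / real (Suc n) \<le> ln (real (Suc n)) - ln (real n)"
    and "ln (real (Suc (Suc n))) - ln (real (Suc n)) + 1 / (real (Suc n))^2 \<le> ln (real (Suc n)) - ln (real n)"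
proof -
  have 1: "ln x \<le> x - 1" if "0 < x" for x :: real using that by (rule ln_le_minus_one)
  have "ln (real (Suc n)) - ln (real n) = ln (real (Suc n) / real n)"
    using assms by (simp add: ln_div)
  also have "\<dots> \<le> real (Suc n) / real n - 1" using assms by (intro 1) simp
  also have "\<dots> = 1 / real n" using assms by (simp add: field_simps)
  finally show "ln (real (Suc n)) - ln (real n) \<le> 1 / real n" .
  have "ln (real n) - ln (real (Suc n)) = ln (real n / real (Suc n))"
    using assms by (simp add: ln_div)
  also have "\<dots> \<le> real n / real (Suc n) - 1" using assms by (intro 1) simp
  also have "\<dots> = - (1 / real (Suc n))" by (simp add: field_simps)
  finally show "1 / real (Suc n) \<le> ln (real (Suc n)) - ln (real n)" by simp
  have "ln (real n) + ln (real (Suc (Suc n))) - 2 * ln (real (Suc n))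
      = ln (real n * real (Suc (Suc n)) / (real (Suc n))^2)"
    using assms by (simp add: ln_div ln_mult ln_realpow del: of_nat_Suc)
  also have "\<dots> \<le> real n * real (Suc (Suc n)) / (real (Suc n))^2 - 1"
    using assms by (intro 1) (simp del: of_nat_Suc)
  also have "\<dots> = - (1 / (real (Suc n))^2)"
    by (simp add: divide_simps) (simp add: power2_eq_square algebra_simps)
  finally show "ln (real (Suc (Suc n))) - ln (real (Suc n)) + 1 / (real (Suc n))^2 \<le> ln (real (Suc n)) - ln (real n)"
    by simp
qed

lemma inverse_sqrt_le_diff: "1 / sqrt (real (Suc n)) \<le> 2 * (sqrt (real (Suc n)) - sqrt (real n))"
proof -
  define x where "x = sqrt (real (Suc n))"
  have x: "x > 0" "x^2 = real n + 1" by (auto simp: x_def)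
  have "sqrt (real n) \<le> x - 1 / (2 * x)"
  proof (rule real_le_lsqrt)
    have "x \<ge> 1" by (simp add: x_def)
    then have "x * x \<ge> 1" using mult_mono[of 1 x 1 x] by simp
    then show "0 \<le> x - 1 / (2 * x)" using x by (simp add: field_simps)
    have "(x - 1 / (2 * x))^2 = x^2 - 1 + (1 / (2*x))^2"
      using x by (simp add: power2_diff)
    then show "real n \<le> (x - 1 / (2 * x))^2" using x by simp
  qed
  then have "1 / x \<le> 2 * (x - sqrt (real n))" using x by (simp add: field_simps)
  then show ?thesis by (simp add: x_def)
qed

lemma sum_inverse_sqrt_le: "(\<Sum>n=1..N. 1 / sqrt (real n)) \<le> 2 * sqrt (real N)"
proof (induction N)
  case (Suc N)
  then show ?case using inverse_sqrt_le_diff[of N] by simp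
qed simp

section \<open>Bounds for the zeta function\<close>

lemma sum_inverse_sqrt_ivl_le:
  assumes "0 < a"
  shows "(\<Sum>n\<in>{a..<b}. 1 / sqrt (real n)) \<le> 2 * sqrt (real b)"
proof -
  have "(\<Sum>n\<in>{a..<b}. 1 / sqrt (real n)) \<le> (\<Sum>n=1..b. 1 / sqrt (real n))"
    using assms by (intro sum_mono2) auto
  also have "\<dots> \<le> 2 * sqrt (real b)" by (rule sum_inverse_sqrt_le)
  finally show ?thesis .
qed

text \<open>In the sum up to n all increments lie between t/n and pi, away from the multiples of 2
  pi, so \<open>kusmin_landau\<close> gives 8n/t. This bound grows with n, which is why
  \<open>abel_inequality\<close> carries a function B. With weights 1/sqrt n the total is of order
  sqrt b / t, bounded for b <= 2 t^2.\<close>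

lemma zeta_sum_block_zero:
  fixes t :: real
  assumes t: "t \<ge> 1" and ab: "0 < a" "a \<le> b" "real b \<le> 2 * t^2"
    and range: "\<And>n. a \<le> n \<Longrightarrow> n < b \<Longrightarrow> t * ln (real (Suc n)) - t * ln (real n) \<le> pi"
  shows "norm (\<Sum>n\<in>{a..<b}. of_real (1 / sqrt (real n)) * cis (t * ln (real n))) \<le> 48"
proof -
  have KL: "norm (\<Sum>j\<in>{a..<n}. cis (t * ln (real j))) \<le> 8 / t * real n" if n: "a \<le> n" "n \<le> b" for n
  proof (cases "a < n")
    case True
    have lo: "t / real n \<le> t * ln (real (Suc j)) - t * ln (real j)" if "a \<le> j" "j < n" for j
    proof -
      have "t / real n \<le> t / real (Suc j)" using that t ab by (intro divide_left_mono) auto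
      also have "\<dots> = t * (1 / real (Suc j))" by simp
      also have "\<dots> \<le> t * (ln (real (Suc j)) - ln (real j))"
        using t ab that by (intro mult_left_mono ln_Suc_diff_bounds) auto
      finally show ?thesis by (simp add: algebra_simps)
    qed
    have "norm (\<Sum>j\<in>{a..<n}. cis (t * ln (real j))) \<le> 8 / (t / real n)"
    proof (rule kusmin_landau[where k = 0])
      show "0 < t / real n" using t True by simp
      show le: "t / real n \<le> pi" using lo[of a] range[of a] True n by simp
      fix j assume j: "a \<le> j"
      { assume "Suc j < n"
        have "0 \<le> t * (1 / (real (Suc j))^2)" using t by simp
        also have "\<dots> \<le> t * ((ln (real (Suc j)) - ln (real j)) - (ln (real (Suc (Suc j))) - ln (real (Suc j))))"
          using ln_Suc_diff_bounds(3)[of j] t ab j by (intro mult_left_mono) auto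
        finally show "t * ln (real (Suc (Suc j))) - t * ln (real (Suc j)) \<le> t * ln (real (Suc j)) - t * ln (real j)"
          by (simp add: algebra_simps) }
      { assume "j < n"
        with j lo[of j] range[of j] n le show "t / real n \<le> t * ln (real (Suc j)) - t * ln (real j) - 2 * pi * of_int 0 \<and>
           t * ln (real (Suc j)) - t * ln (real j) - 2 * pi * of_int 0 \<le> 2 * pi - t / real n" by auto }
    qed
    then show ?thesis by simp
  qed (use t n in auto)
  have "norm (\<Sum>n\<in>{a..<b}. of_real (1 / sqrt (real n)) * cis (t * ln (real n)))
     \<le> 1 / sqrt (real a) * (8 / t * real a) +
       (\<Sum>n\<in>{a..<b}. 1 / sqrt (real n) * (8 / t * real (Suc n) - 8 / t * real n))"
    using ab KL by (intro abel_inequality) (auto intro!: divide_left_mono)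
  also have "\<dots> = 8 / t * sqrt (real a) + 8 / t * (\<Sum>n\<in>{a..<b}. 1 / sqrt (real n))"
  proof -
    have "1 / sqrt (real n) * (8 / t * real (Suc n) - 8 / t * real n) = 8 / t * (1 / sqrt (real n))" for n
      using t by (simp add: field_simps)
    moreover have "1 / sqrt (real a) * (8 / t * real a) = 8 / t * (real a / sqrt (real a))" by simp
    ultimately show ?thesis using ab by (simp only: sum_distrib_left real_div_sqrt of_nat_0_le_iff)
  qed
  also have "\<dots> \<le> 8 / t * sqrt (real b) + 8 / t * (2 * sqrt (real b))"
    using ab t by (intro add_mono mult_left_mono sum_inverse_sqrt_ivl_le) auto
  also have "\<dots> = 24 / t * sqrt (real b)" by simp
  also have "sqrt (real b) \<le> 2 * t"
    using ab t by (intro real_le_lsqrt) (auto simp: power_mult_distrib)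
  then have "24 / t * sqrt (real b) \<le> 24 / t * (2 * t)" using t by (intro mult_left_mono) auto
  also have "\<dots> = 48" using t by simp
  finally show ?thesis .
qed

text \<open>The increments lie within pi of 2 pi k, so n is of order t/k: their lower bound gives n
  <= t/(pi k), their upper bound a >= t/(6 pi k). They fall by about t/n^2, at least of order k^2/t,
  so van der Corput gives O(sqrt t / k), and the weight 1/sqrt a, of order sqrt(k/t), turns this
  into O(1/sqrt k).\<close>

lemma zeta_sum_block:
  fixes t :: real
  assumes t: "t \<ge> 1" and ab: "sqrt t \<le> real a" "a \<le> b" and k: "1 \<le> k"
    and lo: "\<And>n. a \<le> n \<Longrightarrow> n < b \<Longrightarrow> 2 * pi * real k - pi \<le> t * ln (real (Suc n)) - t * ln (real n)"
    and hi: "\<And>n. a \<le> n \<Longrightarrow> n < b \<Longrightarrow> t * ln (real (Suc n)) - t * ln (real n) \<le> 2 * pi * real k + pi"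
  shows "norm (\<Sum>n\<in>{a..<b}. of_real (1 / sqrt (real n)) * cis (t * ln (real n))) \<le> 100 / sqrt (real k)"
proof (cases "a < b")
  case True
  have "sqrt t \<ge> 1" using t by simp
  then have a: "0 < a" using ab(1) by (cases a) auto
  have pi: "pi > 3" "pi < 4" using pi_gt3 pi_less_4 by auto
  have n_le: "pi * real k * real n \<le> t" if n: "a \<le> n" "n < b" for n
  proof -
    have "pi * real k \<le> 2 * pi * real k - pi" using k pi by simp
    also have "\<dots> \<le> t * (ln (real (Suc n)) - ln (real n))" using lo[OF n] by (simp add: algebra_simps)
    also have "\<dots> \<le> t * (1 / real n)" using t a n by (intro mult_left_mono ln_Suc_diff_bounds) auto
    finally show ?thesis using a n by (simp add: field_simps)
  qed
  \<comment> \<open>\<open>n_le\<close> makes t/n^2 at least (pi k)^2 / t, and \<open>l\<close> is a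
    quarter of that. For l <= 1 the hypothesis a >= sqrt t enters: together with \<open>n_le\<close>
    it forces pi k <= sqrt t.\<close>
  define l where "l = (pi * real k)^2 / (4 * t)"
  have l: "0 < l" using k t pi by (simp add: l_def)
  have sl: "sqrt l = pi * real k / (2 * sqrt t)"
    using pi k t by (simp add: l_def real_sqrt_divide real_sqrt_mult)
  have l1: "l \<le> 1"
  proof -
    have "pi * real k * sqrt t \<le> pi * real k * real a" using ab pi k by (intro mult_left_mono) auto
    also have "\<dots> \<le> sqrt t * sqrt t" using n_le[of a] True t by simp
    finally have "pi * real k \<le> sqrt t" by (rule mult_right_le_imp_le) (use t in simp)
    also have "sqrt t \<le> 2 * sqrt t" using t by simp
    finally have "sqrt l \<le> 1" unfolding sl using t by (simp add: divide_le_eq_1)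
    then show ?thesis by simp
  qed
  have V: "norm (\<Sum>j\<in>{a..<n}. cis (t * ln (real j))) \<le> 19 / sqrt l" if n: "a \<le> n" "n \<le> b" for n
  proof (rule van_der_corput_block[where k = "int k", OF l l1])
    fix j assume j: "a \<le> j" 
    { assume jn: "Suc j < n"
      have "(real (Suc j))^2 * (pi * real k)^2 = (pi * real k * real (Suc j))^2"
        by (simp add: power_mult_distrib)
      also have "\<dots> \<le> t^2"
        using n_le[of "Suc j"] j jn n pi by (intro power_mono) auto
      also have "\<dots> \<le> 4 * t^2" by simp
      finally have "(real (Suc j))^2 * (pi * real k)^2 \<le> 4 * t^2" .
      then have "l \<le> t * (1 / (real (Suc j))^2)"
        using t by (simp add: l_def divide_simps power2_eq_square del: of_nat_Suc)
           (simp add: algebra_simps)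
      also have "\<dots> \<le> t * ((ln (real (Suc j)) - ln (real j)) - (ln (real (Suc (Suc j))) - ln (real (Suc j))))"
        using ln_Suc_diff_bounds(3)[of j] t a j by (intro mult_left_mono) auto
      finally show "t * ln (real (Suc (Suc j))) - t * ln (real (Suc j)) + l \<le> t * ln (real (Suc j)) - t * ln (real j)"
        by (simp add: algebra_simps) }
    { assume jn: "j < n"
      show "\<bar>t * ln (real (Suc j)) - t * ln (real j) - 2 * pi * of_int (int k)\<bar> \<le> pi"
        using lo[of j] hi[of j] j jn n by (auto simp: abs_le_iff) }
  qed (use n in auto)
  have "norm (\<Sum>n\<in>{a..<b}. of_real (1 / sqrt (real n)) * cis (t * ln (real n)))
     \<le> 1 / sqrt (real a) * (19 / sqrt l)"
    using a ab(2) V by (intro abel_inequality_const) (auto intro!: divide_left_mono)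
  also have "\<dots> \<le> 100 / sqrt (real k)"
  proof -
    have "t \<le> 6 * pi * real k * real a"
    proof -
      have "t * (1 / real (Suc a)) \<le> t * (ln (real (Suc a)) - ln (real a))"
        using t a by (intro mult_left_mono ln_Suc_diff_bounds) auto
      also have "\<dots> \<le> 2 * pi * real k + pi * 1" using hi[of a] True by (simp add: algebra_simps)
      also have "\<dots> \<le> 2 * pi * real k + pi * real k" using k by (intro add_left_mono mult_left_mono) auto
      also have "\<dots> = 3 * pi * real k" by simp
      finally have "t \<le> 3 * pi * real k * real (Suc a)" by (simp add: field_simps)
      also have "\<dots> \<le> 3 * pi * real k * (2 * real a)"
        using a pi by (intro mult_left_mono) auto
      finally show ?thesis by simp
    qed
    then have "sqrt t \<le> sqrt (6 * pi * real k * real a)" by (rule real_sqrt_le_mono)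
    also have "\<dots> = sqrt (6 * pi) * sqrt (real k) * sqrt (real a)" by (simp add: real_sqrt_mult)
    also have "\<dots> \<le> 5 * sqrt (real k) * sqrt (real a)"
      using pi by (intro mult_right_mono real_le_lsqrt) auto
    finally have st: "sqrt t \<le> 5 * sqrt (real k) * sqrt (real a)" .
    have "1 / sqrt (real a) * (19 / sqrt l) = 38 * sqrt t / (pi * real k * sqrt (real a))"
      unfolding sl using t by simp
    also have "\<dots> \<le> 38 * (5 * sqrt (real k) * sqrt (real a)) / (pi * real k * sqrt (real a))"
      using st k pi a by (intro divide_right_mono mult_left_mono) auto
    also have "\<dots> = 190 / pi / sqrt (real k)"
      using a k pi by (simp add: field_simps)
    also have "\<dots> \<le> 100 / sqrt (real k)"
      using pi k by (intro divide_right_mono) (auto simp: field_simps)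
    finally show ?thesis .
  qed
  finally show ?thesis .
qed (use k in auto)

text \<open>Since the increments decrease with n, the block around the largest multiple of 2 pi is
  an initial segment. It is split off, and the induction hypothesis applies to the rest, whose
  starting point is still at least sqrt t.\<close>

lemma zeta_sum_blocks:
  fixes t :: real
  assumes t: "t \<ge> 1" and ab: "sqrt t \<le> real a" "a \<le> b" "real b \<le> 2 * t^2"
    and hi: "\<And>n. a \<le> n \<Longrightarrow> n < b \<Longrightarrow> t * ln (real (Suc n)) - t * ln (real n) \<le> 2 * pi * real K + pi"
  shows "norm (\<Sum>n\<in>{a..<b}. of_real (1 / sqrt (real n)) * cis (t * ln (real n)))
     \<le> 48 + 100 * (\<Sum>k=1..K. 1 / sqrt (real k))"
  using ab hi
proof (induction K arbitrary: a)
  case 0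
  have "sqrt t \<ge> 1" using t by simp
  then have a: "0 < a" using 0(1) by (cases a) auto
  show ?case using zeta_sum_block_zero[OF t a 0(2,3)] 0(4) by simp
next
  case (Suc K)
  have "sqrt t \<ge> 1" using t by simp
  then have a: "0 < a" using Suc.prems(1) by (cases a) auto
  let ?d = "\<lambda>n. t * ln (real (Suc n)) - t * ln (real n)"
  let ?f = "\<lambda>n. complex_of_real (1 / sqrt (real n)) * cis (t * ln (real n))"
  have "?d n + 0 * real (n - m) \<le> ?d m" if "a \<le> m" "m \<le> n" "n < b" for m n
  proof (rule decreasing_steps[OF _ that])
    fix j assume "a \<le> j"
    have "0 \<le> t * (1 / (real (Suc j))^2)" using t by simp
    also have "\<dots> \<le> t * ((ln (real (Suc j)) - ln (real j)) - (ln (real (Suc (Suc j))) - ln (real (Suc j))))"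
      using ln_Suc_diff_bounds(3)[of j] t a \<open>a \<le> j\<close> by (intro mult_left_mono) auto
    finally show "?d (Suc j) + 0 \<le> ?d j" by (simp add: algebra_simps)
  qed
  then have anti: "?d n \<le> ?d m" if "a \<le> m" "m \<le> n" "n < b" for m n using that by fastforce
  obtain p where p: "a \<le> p" "p \<le> b" "\<And>n. a \<le> n \<Longrightarrow> n < p \<Longrightarrow> 2 * pi * real (Suc K) - pi \<le> ?d n"
      "\<And>n. p \<le> n \<Longrightarrow> n < b \<Longrightarrow> ?d n < 2 * pi * real (Suc K) - pi"
    using antimono_split[where d = ?d, OF \<open>a \<le> b\<close> anti, where y = "2 * pi * real (Suc K) - pi"] by blast
  have "norm (\<Sum>n\<in>{a..<p}. ?f n) \<le> 100 / sqrt (real (Suc K))"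
    using Suc.prems p by (intro zeta_sum_block t) auto
  moreover have "norm (\<Sum>n\<in>{p..<b}. ?f n) \<le> 48 + 100 * (\<Sum>k=1..K. 1 / sqrt (real k))"
  proof (rule Suc.IH)
    show "sqrt t \<le> real p" using p(1) Suc.prems(1) by linarith
    fix n assume "p \<le> n" "n < b"
    from p(4)[OF this] show "?d n \<le> 2 * pi * real K + pi" by (simp add: algebra_simps)
  qed (use p Suc.prems in auto)
  ultimately have "norm ((\<Sum>n\<in>{a..<p}. ?f n) + (\<Sum>n\<in>{p..<b}. ?f n)) \<le>
     100 / sqrt (real (Suc K)) + (48 + 100 * (\<Sum>k=1..K. 1 / sqrt (real k)))"
    by (intro order_trans[OF norm_triangle_ineq] add_mono)
  then show ?case using p by (simp add: sum.atLeastLessThan_concat algebra_simps)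
qed

text \<open>For n >= sqrt t the increments are at most t/n <= sqrt t, so about sqrt t blocks
  suffice, and the sum of 1/sqrt k over them is of order t^(1/4). The constant is 48 + 100 * 2 *
  2.\<close>

lemma zeta_sum_upper_range:
  fixes t :: real
  assumes t: "t \<ge> 1" and ab: "sqrt t \<le> real a" "a \<le> b" "real b \<le> 2 * t^2"
  shows "norm (\<Sum>n\<in>{a..<b}. of_real (1 / sqrt (real n)) * cis (t * ln (real n))) \<le> 448 * t powr (1/4)"
proof -
  define K where "K = nat \<lceil>sqrt t\<rceil>"
  have st: "sqrt t \<ge> 1" using t by simp
  have K: "sqrt t \<le> real K" "real K \<le> 2 * sqrt t"
    unfolding K_def using st ceiling_correct[of "sqrt t"] by linarith+
  have pi: "pi > 3" using pi_gt3 .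
  have "norm (\<Sum>n\<in>{a..<b}. of_real (1 / sqrt (real n)) * cis (t * ln (real n)))
     \<le> 48 + 100 * (\<Sum>k=1..K. 1 / sqrt (real k))"
  proof (rule zeta_sum_blocks[OF t ab])
    fix n assume n: "a \<le> n" "n < b"
    then have n0: "sqrt t \<le> real n" "0 < n" using ab(1) st by (auto intro: gr0I)
    have "t * ln (real (Suc n)) - t * ln (real n) = t * (ln (real (Suc n)) - ln (real n))"
      by (simp add: algebra_simps)
    also have "\<dots> \<le> t * (1 / real n)" using t n0 by (intro mult_left_mono ln_Suc_diff_bounds) auto
    also have "\<dots> \<le> t * (1 / sqrt t)" using t n0 by (intro mult_left_mono divide_left_mono) auto
    also have "\<dots> = sqrt t" using t by (simp add: real_div_sqrt)
    also have "\<dots> \<le> 1 * real K" using K by simp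
    also have "\<dots> \<le> 2 * pi * real K" using pi by (intro mult_right_mono) auto
    finally show "t * ln (real (Suc n)) - t * ln (real n) \<le> 2 * pi * real K + pi"
      using pi by linarith
  qed
  also have "\<dots> \<le> 48 + 100 * (2 * sqrt (real K))"
    using sum_inverse_sqrt_le[of K] by simp
  also have "sqrt (real K) \<le> sqrt (4 * sqrt t)"
    using K st by (intro real_sqrt_le_mono) auto
  also have "sqrt (4 * sqrt t) = 2 * t powr (1/4)"
    using t by (simp add: real_sqrt_mult powr_half_sqrt[symmetric] powr_powr)
  also have "48 + 100 * (2 * (2 * t powr (1/4))) \<le> 448 * t powr (1/4)"
    using ge_one_powr_ge_zero[of t "1/4"] t by simp
  finally show ?thesis by simp
qed

section \<open>Bounds uniform in the strip 1/2 <= Re s <= 3/2 and to its right\<close>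

lemma powr_le_one_plus_sqrt:
  assumes "0 < (y::real)" "0 \<le> v" "v \<le> 1/2"
  shows "y powr v \<le> 1 + sqrt y"
proof (cases "y \<le> 1")
  case True
  then have "y powr v \<le> 1" using assms by (simp add: powr_le1)
  moreover have "0 \<le> sqrt y" using assms by simp
  ultimately show ?thesis by linarith
next
  case False
  then have "y powr v \<le> y powr (1/2)" using assms by (intro powr_mono) auto
  then show ?thesis using assms by (simp add: powr_half_sqrt)
qed

lemma sum_powr_three_halves_le: "(\<Sum>n\<in>{1..<N}. real n powr (-3/2)) \<le> 12"
proof (cases "N = 0")
  case False
  then have "(\<Sum>n\<in>{1..<N}. real n powr (-1/2-1)) \<le> 2 powr (1/2+1) / (1/2) * real 1 powr (-1/2)"
    using sum_powr_tail_le[of "1/2" 1 N] by simp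
  also have "2 powr (1/2+1) = 2 * sqrt (2::real)" 
    unfolding powr_add by (simp add: powr_half_sqrt)
  also have "2 * sqrt 2 / (1/2) * real 1 powr (-1/2) = 4 * sqrt 2" by simp
  also have "\<dots> \<le> 4 * 2" by (intro mult_left_mono real_le_lsqrt) auto
  finally show ?thesis by simp
qed simp

text \<open>Summing n^(-sigma) directly would produce a logarithm at sigma = 1. Interpolation avoids
  it: n^(-sigma) is at most t^((3/2-sigma)/4) times n^(-3/2) + t^(-1/4) n^(-1/2), and for m of order
  sqrt t both parts sum to O(1), uniformly in sigma.\<close>

lemma sum_small_powr_le:
  fixes t \<sigma> :: real
  assumes t: "t \<ge> 1" and \<sigma>: "1/2 \<le> \<sigma>" "\<sigma> \<le> 3/2" and m: "real m \<le> 2 * sqrt t"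
  shows "(\<Sum>n\<in>{1..<m}. real n powr (-\<sigma>)) \<le> 16 * t powr ((3/2-\<sigma>)/4)"
proof -
  define v where "v = 3/4 - \<sigma>/2"
  have v: "0 \<le> v" "v \<le> 1/2" using \<sigma> by (auto simp: v_def)
  have le: "real n powr (-\<sigma>) \<le> t powr (v/2) * (real n powr (-3/2) + t powr (-1/4) * (1 / sqrt (real n)))"
    if "n \<in> {1..<m}" for n
  proof -
    \<comment> \<open>\<open>y\<close> compares n with t^(1/4), the point where n^(-3/2) and
      t^(-1/4) n^(-1/2) agree.\<close>
    define y where "y = (real n)^2 / sqrt t"
    have y: "y > 0" using that t by (simp add: y_def)
    have yv: "y powr v = real n powr (2 * v) / t powr (v/2)"
      using that t by (simp add: y_def powr_divide powr_half_sqrt[symmetric] powr_powr powr_numeral[symmetric] del: powr_numeral)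
    have sy: "sqrt y = real n * t powr (-1/4)"
      using t by (simp add: y_def real_sqrt_divide powr_half_sqrt[symmetric] powr_powr powr_minus_divide)
    have "real n powr (-\<sigma>) = real n powr (-3/2) * real n powr (2 * v)"
      by (simp add: powr_add[symmetric] v_def)
    also have "\<dots> = t powr (v/2) * (real n powr (-3/2) * y powr v)"
      using t by (simp add: yv)
    also have "\<dots> \<le> t powr (v/2) * (real n powr (-3/2) * (1 + real n * t powr (-1/4)))"
      using powr_le_one_plus_sqrt[OF y v] by (intro mult_left_mono) (auto simp: sy)
    also have "real n powr (-3/2) * (1 + real n * t powr (-1/4))
       = real n powr (-3/2) + t powr (-1/4) * (real n powr (-3/2) * real n powr 1)"
      using that by (simp add: algebra_simps)
    also have "real n powr (-3/2) * real n powr 1 = 1 / sqrt (real n)"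
      using that by (simp only: powr_add[symmetric]) (simp add: powr_half_sqrt[symmetric] powr_minus_divide)
    finally show ?thesis .
  qed
  have "(\<Sum>n\<in>{1..<m}. real n powr (-\<sigma>)) \<le>
     (\<Sum>n\<in>{1..<m}. t powr (v/2) * (real n powr (-3/2) + t powr (-1/4) * (1 / sqrt (real n))))"
    by (intro sum_mono le)
  also have "\<dots> = t powr (v/2) * ((\<Sum>n\<in>{1..<m}. real n powr (-3/2)) + t powr (-1/4) * (\<Sum>n\<in>{1..<m}. 1 / sqrt (real n)))"
    by (simp only: sum_distrib_left[symmetric] sum.distrib)
  also have "\<dots> \<le> t powr (v/2) * (12 + t powr (-1/4) * (2 * sqrt (real m)))"
    by (intro mult_left_mono add_mono sum_powr_three_halves_le sum_inverse_sqrt_ivl_le) auto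
  also have "\<dots> \<le> t powr (v/2) * (12 + t powr (-1/4) * (2 * (2 * t powr (1/4))))"
  proof (intro mult_left_mono add_left_mono)
    have "sqrt (real m) \<le> sqrt (4 * sqrt t)" using m t by (intro real_sqrt_le_mono) auto
    also have "sqrt (4 * sqrt t) = 2 * t powr (1/4)"
      using t by (simp add: real_sqrt_mult powr_half_sqrt[symmetric] powr_powr)
    finally show "sqrt (real m) \<le> 2 * t powr (1/4)" .
  qed auto
  also have "t powr (-1/4) * (2 * (2 * t powr (1/4))) = 4"
    using t by (simp add: powr_minus_divide)
  finally show ?thesis by (simp add: v_def diff_divide_distrib mult.commute)
qed

text \<open>The imaginary part is -t as in the arguments 1/2 - ibt of the theorem; the phase t ln n
  then increases with n in decreasing steps, as \<open>kusmin_landau\<close> requires.\<close>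

lemma of_nat_powr_Complex:
  assumes "0 < n"
  shows "of_nat n powr (- Complex \<sigma> (-t)) = of_real (real n powr (-\<sigma>)) * cis (t * ln (real n))"
proof -
  have "of_nat n powr (- Complex \<sigma> (-t)) = exp ((- Complex \<sigma> (-t)) * of_real (ln (real n)))"
    using assms by (simp add: powr_def Ln_of_nat)
  also have "(- Complex \<sigma> (-t)) * of_real (ln (real n)) = of_real (-\<sigma> * ln (real n)) + \<i> * of_real (t * ln (real n))"
    by (simp add: complex_eq_iff)
  also have "exp \<dots> = of_real (exp (-\<sigma> * ln (real n))) * cis (t * ln (real n))"
    unfolding exp_add cis_conv_exp exp_of_real ..
  also have "exp (-\<sigma> * ln (real n)) = real n powr (-\<sigma>)" using assms by (simp add: powr_def)
  finally show ?thesis .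
qed

text \<open>Below sqrt t absolute values suffice. Above it, partial summation with the weight
  n^(1/2-sigma) reduces to Re s = 1/2 and yields t^(1/2 - sigma/2), which is at most
  t^((3/2-sigma)/4) for sigma >= 1/2.\<close>

lemma norm_zeta_sum_le:
  fixes t \<sigma> :: real
  assumes t: "t \<ge> 1" and \<sigma>: "1/2 \<le> \<sigma>" "\<sigma> \<le> 3/2" and N: "real N \<le> 2 * t^2"
  shows "norm (\<Sum>n\<in>{1..<N}. of_nat n powr (- Complex \<sigma> (-t))) \<le> 464 * t powr ((3/2-\<sigma>)/4)"
proof -
  let ?f = "\<lambda>n. of_nat n powr (- Complex \<sigma> (-t))"
  define m where "m = nat \<lceil>sqrt t\<rceil>"
  have st: "sqrt t \<ge> 1" using t by simp
  have m: "sqrt t \<le> real m" "real m \<le> 2 * sqrt t"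
    unfolding m_def using st ceiling_correct[of "sqrt t"] by linarith+
  have m0: "0 < m" using m st by (intro gr0I) auto
  have small: "norm (\<Sum>n\<in>{1..<k}. ?f n) \<le> 16 * t powr ((3/2-\<sigma>)/4)" if "k \<le> m" for k
  proof -
    have "norm (\<Sum>n\<in>{1..<k}. ?f n) \<le> (\<Sum>n\<in>{1..<k}. real n powr (-\<sigma>))"
      by (rule sum_norm_le) (simp add: norm_of_nat_powr)
    also have "\<dots> \<le> 16 * t powr ((3/2-\<sigma>)/4)" using that m by (intro sum_small_powr_le t \<sigma>) auto
    finally show ?thesis .
  qed
  show ?thesis
  proof (cases "N \<le> m")
    case True
    have "0 \<le> 448 * t powr ((3/2-\<sigma>)/4)" by simp
    with small[OF True] show ?thesis by linarith
  next
    case False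
    have "(\<Sum>n\<in>{m..<N}. ?f n) = (\<Sum>n\<in>{m..<N}. of_real (real n powr (1/2-\<sigma>)) * 
          (of_real (1 / sqrt (real n)) * cis (t * ln (real n))))"
    proof (intro sum.cong refl)
      fix n assume "n \<in> {m..<N}"
      then have n: "0 < n" using m0 by auto
      have "real n powr (-\<sigma>) = real n powr (1/2-\<sigma>) * real n powr (-1/2)"
        by (simp add: powr_add[symmetric])
      also have "real n powr (-1/2) = 1 / sqrt (real n)"
        by (simp add: powr_half_sqrt[symmetric] powr_minus_divide)
      finally show "?f n = of_real (real n powr (1/2-\<sigma>)) * (of_real (1 / sqrt (real n)) * cis (t * ln (real n)))"
        unfolding of_nat_powr_Complex[OF n] by simp
    qed
    also have "norm \<dots> \<le> real m powr (1/2-\<sigma>) * (448 * t powr (1/4))"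
    proof (rule abel_inequality_const)
      fix n assume "m \<le> n"
      then show "real (Suc n) powr (1/2-\<sigma>) \<le> real n powr (1/2-\<sigma>)"
        using m0 \<sigma> by (intro powr_mono2') auto
      assume "n \<le> N"
      with \<open>m \<le> n\<close> N show "norm (\<Sum>j\<in>{m..<n}. of_real (1 / sqrt (real j)) * cis (t * ln (real j))) \<le> 448 * t powr (1/4)"
        by (intro zeta_sum_upper_range t m) auto
    qed (use False in auto)
    also have "\<dots> \<le> (sqrt t) powr (1/2-\<sigma>) * (448 * t powr (1/4))"
      using m st \<sigma> by (intro mult_right_mono powr_mono2') auto
    also have "(sqrt t) powr (1/2-\<sigma>) = t powr (1/4 - \<sigma>/2)"
      using t by (simp add: powr_half_sqrt[symmetric] powr_powr diff_divide_distrib)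
    also have "t powr (1/4 - \<sigma>/2) * (448 * t powr (1/4)) = 448 * t powr (1/2 - \<sigma>/2)"
      by (simp add: powr_add[symmetric])
    also have "\<dots> \<le> 448 * t powr ((3/2-\<sigma>)/4)"
      using t \<sigma> by (intro mult_left_mono powr_mono) auto
    finally have "norm (\<Sum>n\<in>{m..<N}. ?f n) \<le> 448 * t powr ((3/2-\<sigma>)/4)" .
    moreover have "(\<Sum>n\<in>{1..<N}. ?f n) = (\<Sum>n\<in>{1..<m}. ?f n) + (\<Sum>n\<in>{m..<N}. ?f n)"
      using m0 False by (simp add: sum.atLeastLessThan_concat)
    ultimately show ?thesis
      using small[of m] norm_triangle_ineq[of "\<Sum>n\<in>{1..<m}. ?f n" "\<Sum>n\<in>{m..<N}. ?f n"] by simp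
  qed
qed

text \<open>A logarithm in this bound would already exceed the error term \<open>T\<^bsup>1/2+\<theta>/2\<^esup>\<close>.\<close>

theorem norm_zeta_cont_le:
  fixes t \<sigma> :: real
  assumes t: "t \<ge> 1" and \<sigma>: "1/2 \<le> \<sigma>" "\<sigma> \<le> 3/2"
  shows "norm (zeta_cont (Complex \<sigma> (-t))) \<le> 514 * t powr ((3/2-\<sigma>)/4)"
proof -
  define s where "s = Complex \<sigma> (-t)"
  \<comment> \<open>With N about t^2 the tail term, of size N^(1-sigma)/t, and the truncation error,
    of size t N^(-sigma), are both bounded for every sigma >= 1/2.\<close>
  define N where "N = nat \<lceil>t^2\<rceil>"
  have t2: "t^2 \<ge> 1" using t by simp
  have N: "t^2 \<le> real N" "real N \<le> 2 * t^2" 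
    unfolding N_def using t2 ceiling_correct[of "t^2"] by linarith+
  have N0: "0 < N" using N t2 by (intro gr0I) auto
  have [simp]: "Re s = \<sigma>" "Im s = -t" "s \<noteq> 1" using t by (auto simp: s_def complex_eq_iff)
  have one: "1 \<le> t powr ((3/2-\<sigma>)/4)" using t \<sigma> by (intro ge_one_powr_ge_zero) auto
  have sN: "t \<le> sqrt (real N)" "sqrt (real N) \<le> 2 * t"
    using N t by (auto intro!: real_le_rsqrt real_le_lsqrt simp: power_mult_distrib)
  have sqN: "real N powr (-1/2) = 1 / sqrt (real N)"
    by (simp add: powr_half_sqrt[symmetric] powr_minus_divide)
  have A: "norm (of_nat N powr (1-s) / (s-1)) \<le> 2"
  proof -
    have "t \<le> norm (s-1)" using abs_Im_le_cmod[of "s-1"] t by simp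
    moreover have "norm (of_nat N powr (1-s)) \<le> 2 * t"
    proof -
      have "norm (of_nat N powr (1-s)) = real N powr (1-\<sigma>)" using N0 by (simp add: norm_of_nat_powr)
      also have "\<dots> \<le> real N powr (1/2)" using N0 \<sigma> by (intro powr_mono) auto
      also have "\<dots> \<le> 2 * t" using sN by (simp add: powr_half_sqrt)
      finally show ?thesis .
    qed
    ultimately show ?thesis using t by (simp add: norm_divide field_simps)
  qed
  have B: "norm s * (2 powr (\<sigma>+1) / \<sigma>) * real N powr (-\<sigma>) \<le> 48"
  proof -
    have "norm s \<le> 3 * t" using cmod_le[of s] t \<sigma> by simp
    moreover have "2 powr (\<sigma>+1) / \<sigma> \<le> 16"
    proof -
      have "2 powr (\<sigma>+1) \<le> 2 powr (3::real)" using \<sigma> by (intro powr_mono) auto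
      then have "2 powr (\<sigma>+1) \<le> 8" by simp
      then show ?thesis using \<sigma> by (simp add: field_simps)
    qed
    moreover have "real N powr (-\<sigma>) \<le> 1 / t"
    proof -
      have "real N powr (-\<sigma>) \<le> real N powr (-1/2)" using N0 \<sigma> by (intro powr_mono) auto
      also have "\<dots> \<le> 1 / t" unfolding sqN using sN t N0 by (intro divide_left_mono) auto
      finally show ?thesis .
    qed
    ultimately have "norm s * (2 powr (\<sigma>+1) / \<sigma>) * real N powr (-\<sigma>) \<le> 3 * t * 16 * (1/t)"
      using t \<sigma> by (intro mult_mono) auto
    then show ?thesis using t by simp
  qed
  let ?S = "\<Sum>n\<in>{1..<N}. of_nat n powr (-s)"
  have "norm (zeta_cont s) \<le> norm (zeta_cont s - (?S + of_nat N powr (1-s) / (s-1)))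
        + (norm ?S + norm (of_nat N powr (1-s) / (s-1)))"
    using norm_triangle_sub[of "zeta_cont s" "?S + of_nat N powr (1-s) / (s-1)"]
      norm_triangle_ineq[of ?S "of_nat N powr (1-s) / (s-1)"] by linarith
  also have "\<dots> \<le> 48 + (464 * t powr ((3/2-\<sigma>)/4) + 2)"
    using zeta_cont_diff_le[of s N] N0 \<sigma> B A norm_zeta_sum_le[OF t \<sigma> N(2)]
    by (intro add_mono) (auto simp: s_def[symmetric])
  also have "\<dots> \<le> 514 * t powr ((3/2-\<sigma>)/4)" using one by simp
  finally show ?thesis by (simp add: s_def)
qed

text \<open>The constant may grow with T, because wherever this is used N tends to infinity while T
  stays fixed.\<close>

lemma zeta_cont_partial_sum_error:
  fixes t \<sigma> :: real
  assumes "t \<ge> 1" "t \<le> T" "\<sigma> \<ge> 3/2" "0 < N"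
  shows "norm (zeta_cont (Complex \<sigma> (-t)) - (\<Sum>n\<in>{1..<N}. of_nat n powr (- Complex \<sigma> (-t))))
     \<le> (1 + (\<sigma> + T) * 2 powr (\<sigma>+1)) * real N powr (-1/2)"
proof -
  define s where "s = Complex \<sigma> (-t)"
  have [simp]: "Re s = \<sigma>" "Im s = -t" "s \<noteq> 1" using assms by (auto simp: s_def complex_eq_iff)
  let ?S = "\<Sum>n\<in>{1..<N}. of_nat n powr (-s)"
  have "norm (zeta_cont s - ?S) \<le> norm (zeta_cont s - (?S + of_nat N powr (1-s) / (s-1)))
        + norm (of_nat N powr (1-s) / (s-1))"
    using norm_triangle_ineq[of "zeta_cont s - (?S + of_nat N powr (1-s) / (s-1))"
      "of_nat N powr (1-s) / (s-1)"] by simp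
  also have "norm (zeta_cont s - (?S + of_nat N powr (1-s) / (s-1))) \<le>
      norm s * (2 powr (\<sigma>+1) / \<sigma>) * real N powr (-\<sigma>)"
    using zeta_cont_diff_le[of s N] assms by simp
  also have "\<dots> \<le> (\<sigma> + T) * (2 powr (\<sigma>+1) / 1) * real N powr (-1/2)"
    using assms cmod_le[of s] by (intro mult_mono frac_le powr_mono) auto
  also have "norm (of_nat N powr (1-s) / (s-1)) \<le> real N powr (-1/2)"
  proof -
    have "1 \<le> norm (s-1)" using abs_Im_le_cmod[of "s-1"] assms by simp
    moreover have "norm (of_nat N powr (1-s)) \<le> real N powr (-1/2)"
      using assms by (auto simp: norm_of_nat_powr intro!: powr_mono)
    ultimately show ?thesis 
      using frac_le[of "real N powr (-1/2)" "norm (of_nat N powr (1-s))" 1 "norm (s-1)"]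
      by (simp add: norm_divide)
  qed
  finally show ?thesis by (simp add: s_def algebra_simps)
qed

lemma norm_zeta_cont_le_right:
  fixes t \<sigma> :: real
  assumes "t \<ge> 1" "\<sigma> \<ge> 3/2"
  shows "norm (zeta_cont (Complex \<sigma> (-t))) \<le> 12"
proof (rule tendsto_lowerbound)
  let ?C = "1 + (\<sigma> + t) * 2 powr (\<sigma>+1)"
  have "(\<lambda>N. 12 + ?C * real N powr (-(1/2))) \<longlonglongrightarrow> 12 + 0"
    by (intro tendsto_add tendsto_const tendsto_mult_powr_neg) simp
  then show "(\<lambda>N. 12 + ?C * real N powr (-1/2)) \<longlonglongrightarrow> 12" by simp
  show "\<forall>\<^sub>F N in sequentially. norm (zeta_cont (Complex \<sigma> (-t))) \<le> 12 + ?C * real N powr (-1/2)"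
    using eventually_gt_at_top[of 0]
  proof eventually_elim
    case (elim N)
    let ?S = "\<Sum>n\<in>{1..<N}. of_nat n powr (- Complex \<sigma> (-t))"
    have "norm ?S \<le> (\<Sum>n\<in>{1..<N}. real n powr (-3/2))"
      using assms by (intro sum_norm_le) (auto simp: norm_of_nat_powr intro!: powr_mono)
    also have "\<dots> \<le> 12" by (rule sum_powr_three_halves_le)
    finally have "norm ?S \<le> 12" .
    then show ?case
      using zeta_cont_partial_sum_error[OF assms(1) order.refl assms(2) elim]
        norm_triangle_sub[of "zeta_cont (Complex \<sigma> (-t))" ?S] by linarith
  qed
qed simp

text \<open>Moving z left by u moves 1/2 - bz right by bu >= 2u, so the exponent (3/2 - Re s)/4
  drops from 1/4 to at most 1/4 - u/2; once the abscissa exceeds 3/2, zeta is bounded. The factors b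
  and c absorb the replacement of bt and ct by t.\<close>

lemma norm_zeta_pair_le:
  fixes b c :: nat and u t :: real
  assumes "b \<ge> 2" "c \<ge> 2" "0 \<le> u" "u \<le> 1/2" "t \<ge> 1"
  shows "norm (zeta_cont (Complex (1/2 + b*u) (-(b*t))) * zeta_cont (Complex (1/2 + c*u) (-(c*t))))
     \<le> (514 * real b) * (514 * real c) * t powr (1/2 - u)"
proof -
  have *: "norm (zeta_cont (Complex (1/2 + b*u) (-(b*t)))) \<le> 514 * real b * t powr (1/4 - u/2)"
    if "b \<ge> 2" for b :: nat
  proof -
    have bt: "real b * t \<ge> 1" using that assms mult_mono[of 1 "real b" 1 t] by simp
    have bu: "2 * u \<le> real b * u" using that assms by (intro mult_right_mono) auto
    have one: "1 \<le> t powr (1/4 - u/2)" using assms by (intro ge_one_powr_ge_zero) auto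
    show ?thesis
    proof (cases "1/2 + real b * u \<le> 3/2")
      case True
      have "norm (zeta_cont (Complex (1/2 + b*u) (-(b*t)))) \<le> 514 * (b * t) powr ((3/2 - (1/2 + b*u))/4)"
        using True assms bt by (intro norm_zeta_cont_le) auto
      also have "\<dots> \<le> 514 * (b * t) powr (1/4 - u/2)"
        using bt bu by (intro mult_left_mono powr_mono) auto
      also have "(b * t) powr (1/4 - u/2) = real b powr (1/4 - u/2) * t powr (1/4 - u/2)"
        using assms by (simp add: powr_mult)
      also have "real b powr (1/4 - u/2) \<le> real b powr 1"
        using that assms by (intro powr_mono) auto
      finally show ?thesis using that by (simp add: mult_right_mono)
    next
      case False
      then have "norm (zeta_cont (Complex (1/2 + b*u) (-(b*t)))) \<le> 12"
        using bt by (intro norm_zeta_cont_le_right) auto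
      also have "\<dots> \<le> 514 * real b * 1" using that by simp
      also have "\<dots> \<le> 514 * real b * t powr (1/4 - u/2)" using one by (intro mult_left_mono) auto
      finally show ?thesis .
    qed
  qed
  have "norm (zeta_cont (Complex (1/2 + b*u) (-(b*t))) * zeta_cont (Complex (1/2 + c*u) (-(c*t))))
     \<le> (514 * real b * t powr (1/4 - u/2)) * (514 * real c * t powr (1/4 - u/2))"
    unfolding norm_mult by (intro mult_mono * assms) auto
  also have "\<dots> = (514 * real b) * (514 * real c) * (t powr (1/4 - u/2) * t powr (1/4 - u/2))" by simp
  also have "t powr (1/4 - u/2) * t powr (1/4 - u/2) = t powr (1/2 - u)"
    by (simp add: powr_add[symmetric])
  finally show ?thesis .
qed

section \<open>Shifting the line of integration\<close>

definition shift_integrand :: "nat \<Rightarrow> nat \<Rightarrow> nat \<Rightarrow> complex \<Rightarrow> complex" where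
  "shift_integrand b c n z =
     of_nat n powr (-1/2 - z) * (zeta_cont (1/2 - of_nat b * z) * zeta_cont (1/2 - of_nat c * z))"

text \<open>Convex, so that a primitive exists. The bound on Re z keeps the real parts of 1/2 - bz
  and 1/2 - cz positive with one expression symmetric in b and c, and it leaves the imaginary axis
  inside; Im z > 0 excludes the poles, which are real.\<close>

definition shift_domain :: "nat \<Rightarrow> nat \<Rightarrow> complex set" where
  "shift_domain b c = {z. Re z < 1 / (2 * (real b + real c)) \<and> Im z > 0}"

lemma shift_domain_convex_open: "convex (shift_domain b c)" "open (shift_domain b c)"
proof -
  have eq: "shift_domain b c = {z. Re z < 1 / (2 * (real b + real c))} \<inter> {z. Im z > 0}"
    by (auto simp: shift_domain_def)
  show "convex (shift_domain b c)"
    unfolding eq by (intro convex_Int convex_halfspace_Re_lt convex_halfspace_Im_gt)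
  show "open (shift_domain b c)"
    unfolding eq by (intro open_Int open_halfspace_Re_lt open_halfspace_Im_gt)
qed

lemma zeta_cont_shift_holomorphic:
  assumes "0 < b"
  shows "(\<lambda>z. zeta_cont (1/2 - of_nat b * z)) holomorphic_on shift_domain b c"
proof -
  have "(zeta_cont \<circ> (\<lambda>z. 1/2 - of_nat b * z)) holomorphic_on shift_domain b c"
  proof (rule holomorphic_on_compose_gen)
    show "(\<lambda>z. 1/2 - of_nat b * z) holomorphic_on shift_domain b c"
      by (intro holomorphic_intros)
    show "zeta_cont holomorphic_on {s. Re s > 0} - {1}" by (rule zeta_cont_holomorphic)
    show "(\<lambda>z. 1/2 - of_nat b * z) ` shift_domain b c \<subseteq> {s. Re s > 0} - {1}"
    proof (intro image_subsetI)
      fix z assume z: "z \<in> shift_domain b c"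
      have "real b * Re z < 1/2"
      proof (cases "Re z \<le> 0")
        case True
        then have "real b * Re z \<le> 0" by (simp add: mult_nonneg_nonpos)
        then show ?thesis by simp
      next
        case False
        have "real b * Re z \<le> (real b + real c) * Re z" using False by (intro mult_right_mono) auto
        also have "\<dots> < 1/2" using z assms by (simp add: shift_domain_def field_simps)
        finally show ?thesis .
      qed
      moreover have "Im (1/2 - of_nat b * z) \<noteq> 0" using z assms by (simp add: shift_domain_def)
      then have "1/2 - of_nat b * z \<noteq> 1" by (metis Im_complex_of_real of_real_1)
      ultimately show "1/2 - of_nat b * z \<in> {s. Re s > 0} - {1}" by simp
    qed
  qed
  then show ?thesis by (simp add: o_def)
qed

lemma shift_integrand_holomorphic:
  assumes "0 < b" "0 < c"
  shows "shift_integrand b c n holomorphic_on shift_domain b c"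
proof -
  have "shift_domain c b = shift_domain b c" by (simp add: shift_domain_def add.commute)
  then have "(\<lambda>z. zeta_cont (1/2 - of_nat c * z)) holomorphic_on shift_domain b c"
    using zeta_cont_shift_holomorphic[of c b] assms by simp
  moreover have "(\<lambda>z. of_nat n powr (-1/2 - z)) holomorphic_on shift_domain b c"
    by (intro holomorphic_on_powr_right holomorphic_on_diff holomorphic_on_const holomorphic_on_ident)
  ultimately show ?thesis
    unfolding shift_integrand_def [abs_def]
    by (intro holomorphic_on_mult zeta_cont_shift_holomorphic assms)
qed

lemma primitive_vertical_integral:
  assumes "\<And>t. \<tau> \<le> t \<Longrightarrow> t \<le> T \<Longrightarrow> (F has_field_derivative f (Complex x t)) (at (Complex x t))"
    and "\<tau> \<le> T"
  shows "((\<lambda>t. f (Complex x t)) has_integral (F (Complex x T) - F (Complex x \<tau>)) / \<i>) {\<tau>..T}"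
proof -
  let ?G = "\<lambda>w. F (of_real x + \<i> * w) / \<i>"
  have C: "Complex x t = of_real x + \<i> * of_real t" for t by (simp add: complex_eq_iff)
  have "((\<lambda>t. ?G (of_real t)) has_vector_derivative f (Complex x t)) (at t within {\<tau>..T})"
    if "t \<in> {\<tau>..T}" for t
  proof (rule has_vector_derivative_real_field)
    have "((\<lambda>w. of_real x + \<i> * w) has_field_derivative \<i>) (at (of_real t))"
      by (auto intro!: derivative_eq_intros)
    then have "((\<lambda>w. F (of_real x + \<i> * w)) has_field_derivative f (Complex x t) * \<i>) (at (of_real t))"
      using assms(1)[of t] that unfolding C by (intro DERIV_chain2) auto
    from DERIV_cdivide[OF this, of \<i>] show "(?G has_field_derivative f (Complex x t)) (at (of_real t))"
      by (simp only: nonzero_mult_div_cancel_right[OF complex_i_not_zero])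
  qed
  then have "((\<lambda>t. f (Complex x t)) has_integral ?G (of_real T) - ?G (of_real \<tau>)) {\<tau>..T}"
    by (intro fundamental_theorem_of_calculus assms(2))
  then show ?thesis unfolding C by (simp only: diff_divide_distrib)
qed

lemma norm_shift_integrand_le:
  assumes bc: "b \<ge> 2" "c \<ge> 2" and y: "1 \<le> y" "real n \<le> y" and n: "0 < n"
    and u: "0 \<le> u" "u \<le> 1/2"
  shows "norm (shift_integrand b c n (Complex (-u) y)) \<le> (514 * real b) * (514 * real c) * sqrt (y / real n)"
proof -
  have eq: "1/2 - of_nat b * Complex (-u) y = Complex (1/2 + b*u) (-(b*y))" for b
    by (simp add: complex_eq_iff)
  have "norm (shift_integrand b c n (Complex (-u) y))
     = real n powr (u - 1/2) * norm (zeta_cont (Complex (1/2 + b*u) (-(b*y))) * zeta_cont (Complex (1/2 + c*u) (-(c*y))))"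
    unfolding shift_integrand_def eq using n by (simp add: norm_mult norm_of_nat_powr algebra_simps)
  also have "\<dots> \<le> real n powr (u - 1/2) * ((514 * real b) * (514 * real c) * y powr (1/2 - u))"
    by (intro mult_left_mono norm_zeta_pair_le bc u y) auto
  also have "\<dots> = (514 * real b) * (514 * real c) * (y / real n) powr (1/2 - u)"
  proof -
    have e: "real n powr (u - 1/2) = inverse (real n powr (1/2 - u))"
      using powr_minus[of "real n" "1/2 - u"] by simp
    have d: "(y / real n) powr (1/2 - u) = y powr (1/2 - u) / real n powr (1/2 - u)"
      using n y by (simp add: powr_divide)
    show ?thesis unfolding e d by (simp only: divide_inverse mult_ac)
  qed
  also have "(y / real n) powr (1/2 - u) \<le> (y / real n) powr (1/2)"
    using n y u by (intro powr_mono) (auto simp: field_simps)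
  also have "\<dots> = sqrt (y / real n)" using n y by (simp add: powr_half_sqrt)
  finally show ?thesis by (simp add: mult_left_mono)
qed

lemma shift_integrand_primitive:
  assumes "0 < b" "0 < c"
  shows "\<exists>F. \<forall>z\<in>shift_domain b c. (F has_field_derivative shift_integrand b c n z) (at z)"
proof (rule holomorphic_convex_primitive')
  show "convex (shift_domain b c)" "open (shift_domain b c)"
    by (rule shift_domain_convex_open)+
  show "shift_integrand b c n holomorphic_on shift_domain b c"
    by (rule shift_integrand_holomorphic[OF assms])
  fix F assume F: "\<And>z. z \<in> shift_domain b c \<Longrightarrow>
      (F has_field_derivative shift_integrand b c n z) (at z within shift_domain b c)"
  have "(F has_field_derivative shift_integrand b c n z) (at z)" if "z \<in> shift_domain b c" for z
    using F[OF that] at_within_open[OF that shift_domain_convex_open(2)] by simp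
  then show "\<exists>F. \<forall>z\<in>shift_domain b c. (F has_field_derivative shift_integrand b c n z) (at z)"
    by blast
qed

text \<open>Cauchy's theorem for a rectangle, phrased with a primitive F: the difference of the
  vertical integrals regroups into the increments of F along the two horizontal edges. Each edge has
  length 1/2, and there the integrand is at most \<open>?B\<close>.\<close>

lemma shift_integral_bound:
  assumes bc: "b \<ge> 2" "c \<ge> 2" and \<tau>: "1 \<le> \<tau>" "real n \<le> \<tau>" "\<tau> \<le> T" and n: "0 < n"
  shows "(\<lambda>t. shift_integrand b c n (Complex 0 t)) integrable_on {\<tau>..T}"
    and "(\<lambda>t. shift_integrand b c n (Complex (-1/2) t)) integrable_on {\<tau>..T}"
    and "norm (integral {\<tau>..T} (\<lambda>t. shift_integrand b c n (Complex 0 t))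
       - integral {\<tau>..T} (\<lambda>t. shift_integrand b c n (Complex (-1/2) t)))
       \<le> (514 * real b) * (514 * real c) * sqrt (T / real n)"
proof -
  let ?f = "shift_integrand b c n" and ?S = "shift_domain b c"
  let ?B = "(514 * real b) * (514 * real c) * sqrt (T / real n)"
  have bc0: "0 < b" "0 < c" using bc by auto
  obtain F where F': "\<And>z. z \<in> ?S \<Longrightarrow> (F has_field_derivative ?f z) (at z)"
    using shift_integrand_primitive[OF bc0] by metis
  have inS: "Complex (-u) y \<in> ?S" if "0 \<le> u" "1 \<le> y" for u y
  proof -
    have "0 < 1 / (2 * (real b + real c))" using bc by simp
    then show ?thesis
      unfolding shift_domain_def mem_Collect_eq complex.sel using that by (intro conjI; linarith)
  qed
  have I: "((\<lambda>t. ?f (Complex (-u) t)) has_integral (F (Complex (-u) T) - F (Complex (-u) \<tau>)) / \<i>) {\<tau>..T}"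
    if "0 \<le> u" for u
    using \<tau> that by (intro primitive_vertical_integral F' inS) auto
  show "(\<lambda>t. ?f (Complex 0 t)) integrable_on {\<tau>..T}" "(\<lambda>t. ?f (Complex (-1/2) t)) integrable_on {\<tau>..T}"
    using I[of 0] I[of "1/2"] by (auto simp: integrable_on_def)
  have Hor: "norm (F (Complex 0 y) - F (Complex (-1/2) y)) \<le> ?B / 2" if y: "\<tau> \<le> y" "y \<le> T" for y
  proof -
    let ?L = "closed_segment (Complex (-1/2) y) (Complex 0 y)"
    have L: "\<exists>u. z = Complex (-u) y \<and> 0 \<le> u \<and> u \<le> 1/2" if zL: "z \<in> ?L" for z
    proof -
      obtain v where v: "0 \<le> v" "v \<le> 1" "z = (1 - v) *\<^sub>R Complex (-1/2) y + v *\<^sub>R Complex 0 y"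
        using zL unfolding in_segment by metis
      then have "z = Complex (-((1-v)/2)) y" by (simp add: complex_eq_iff field_simps)
      then show ?thesis using v by (intro exI[of _ "(1-v)/2"]) auto
    qed
    have "norm (F (Complex 0 y) - F (Complex (-1/2) y)) \<le> ?B * norm (Complex 0 y - Complex (-1/2) y)"
    proof (rule field_differentiable_bound[where S = ?L and f' = ?f])
      fix z assume "z \<in> ?L"
      then obtain u where u: "z = Complex (-u) y" "0 \<le> u" "u \<le> 1/2" using L by blast
      show "(F has_field_derivative ?f z) (at z within ?L)"
        unfolding u(1) using u y \<tau> by (intro has_field_derivative_at_within[OF F'] inS) auto
      have "norm (?f z) \<le> (514 * real b) * (514 * real c) * sqrt (y / real n)"
        unfolding u(1) using y \<tau> n u by (intro norm_shift_integrand_le bc) auto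
      also have "\<dots> \<le> ?B"
        using y n by (intro mult_left_mono real_sqrt_le_mono divide_right_mono) auto
      finally show "norm (?f z) \<le> ?B" .
    qed auto
    also have "Complex 0 y - Complex (-1/2) y = of_real (1/2)" by (simp add: complex_eq_iff)
    also have "norm (complex_of_real (1/2)) = 1/2" by (simp only: norm_of_real)
    finally show ?thesis by simp
  qed
  have "integral {\<tau>..T} (\<lambda>t. ?f (Complex 0 t)) - integral {\<tau>..T} (\<lambda>t. ?f (Complex (-1/2) t))
     = ((F (Complex 0 T) - F (Complex (-1/2) T)) - (F (Complex 0 \<tau>) - F (Complex (-1/2) \<tau>))) / \<i>"
    using integral_unique[OF I[of 0]] integral_unique[OF I[of "1/2"]] 
    by (simp add: algebra_simps)
  also have "norm \<dots> \<le> ?B / 2 + ?B / 2"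
  proof -
    have "norm ((F (Complex 0 T) - F (Complex (-1/2) T)) - (F (Complex 0 \<tau>) - F (Complex (-1/2) \<tau>))) \<le> ?B / 2 + ?B / 2"
      by (intro order_trans[OF norm_triangle_ineq4] add_mono Hor) (use \<tau> in auto)
    then show ?thesis by (simp only: norm_divide norm_ii div_by_1)
  qed
  finally show "norm (integral {\<tau>..T} (\<lambda>t. ?f (Complex 0 t)) - integral {\<tau>..T} (\<lambda>t. ?f (Complex (-1/2) t))) \<le> ?B"
    by simp
qed

section \<open>Oscillatory integrals and gaps between logarithms\<close>

lemma has_integral_cis_zero:
  assumes "\<omega> = 0" "\<tau> \<le> T"
  shows "((\<lambda>t. cis (t * \<omega>)) has_integral of_real (T - \<tau>)) {\<tau>..T}"
  using has_integral_const_real[of "1::complex" \<tau> T] assms by (simp add: scaleR_conv_of_real)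

lemma has_integral_cis_nonzero:
  assumes "\<omega> \<noteq> 0" "\<tau> \<le> T"
  obtains I where "((\<lambda>t. cis (t * \<omega>)) has_integral I) {\<tau>..T}" "norm I \<le> 2 / \<bar>\<omega>\<bar>"
proof -
  let ?G = "\<lambda>w. exp (\<i> * w * of_real \<omega>) / (\<i> * of_real \<omega>)"
  have "((\<lambda>t. cis (t * \<omega>)) has_integral ?G (of_real T) - ?G (of_real \<tau>)) {\<tau>..T}"
  proof (rule fundamental_theorem_of_calculus[OF assms(2)])
    fix t assume "t \<in> {\<tau>..T}"
    have "(?G has_field_derivative exp (\<i> * of_real t * of_real \<omega>)) (at (of_real t))"
      using assms by (auto intro!: derivative_eq_intros)
    then have "((\<lambda>t. ?G (of_real t)) has_vector_derivative exp (\<i> * of_real t * of_real \<omega>)) (at t within {\<tau>..T})"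
      by (rule has_vector_derivative_real_field)
    then show "((\<lambda>t. ?G (of_real t)) has_vector_derivative cis (t * \<omega>)) (at t within {\<tau>..T})"
      by (simp add: cis_conv_exp mult.assoc)
  qed
  moreover have "norm (?G (of_real T) - ?G (of_real \<tau>)) \<le> 2 / \<bar>\<omega>\<bar>"
  proof -
    have n: "norm (?G (of_real x)) = 1 / \<bar>\<omega>\<bar>" for x
    proof -
      have "exp (\<i> * of_real x * of_real \<omega>) = cis (x * \<omega>)" by (simp add: cis_conv_exp mult.assoc)
      then show ?thesis by (simp add: norm_divide norm_mult)
    qed
    show ?thesis using norm_triangle_ineq4[of "?G (of_real T)" "?G (of_real \<tau>)"] unfolding n by simp
  qed
  ultimately show ?thesis using that by blast
qed

lemma inverse_ln_diff_le:
  assumes "0 < p" "p < q"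
  shows "1 / \<bar>ln (real q) - ln (real p)\<bar> \<le> real q / (real q - real p)"
proof -
  have "ln (real p / real q) \<le> real p / real q - 1" using assms by (intro ln_le_minus_one) auto
  then have "(real q - real p) / real q \<le> ln (real q) - ln (real p)"
    using assms by (simp add: ln_div field_simps)
  moreover have "0 < (real q - real p) / real q" using assms by simp
  ultimately have "1 / \<bar>ln (real q) - ln (real p)\<bar> \<le> 1 / ((real q - real p) / real q)"
    by (intro frac_le) auto
  then show ?thesis by simp
qed

text \<open>By \<open>inverse_ln_diff_le\<close> each term is at most max(q,n)/|q-n|. For q <= 2N
  this leaves two harmonic sums, one on each side of q; for q > 2N every term is at most 2.
  Independence of q is the point: q = m^b k^c is unbounded as the truncation of the zeta series
  grows.\<close>

lemma sum_inverse_ln_diff_le: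
  assumes "0 < q" "0 < N"
  shows "(\<Sum>n\<in>{1..N} - {q}. 1 / \<bar>ln (real q) - ln (real n)\<bar>) \<le> 4 * real N * (1 + ln (2 * real N))"
proof (cases "q \<le> 2 * N")
  case True
  have harm: "(\<Sum>d=1..2*N. 1 / real d) \<le> 1 + ln (2 * real N)"
    using euler_mascheroni_sequence_decreasing[of 1 "2*N"] assms
    by (simp add: harm_def inverse_eq_divide)
  have le: "1 / \<bar>ln (real q) - ln (real n)\<bar> \<le> 2 * real N * (1 / \<bar>real q - real n\<bar>)"
    if "n \<in> {1..N} - {q}" for n
  proof -
    have m: "real (max q n) \<le> 2 * real N" using that True by auto
    have "1 / \<bar>ln (real q) - ln (real n)\<bar> \<le> real (max q n) * (1 / \<bar>real q - real n\<bar>)"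
      using inverse_ln_diff_le[of q n] inverse_ln_diff_le[of n q] that assms
      by (cases "q < n") (auto simp: abs_minus_commute max_def)
    also have "\<dots> \<le> 2 * real N * (1 / \<bar>real q - real n\<bar>)" by (intro mult_right_mono m) auto
    finally show ?thesis .
  qed
  have lt: "(\<Sum>n\<in>{n\<in>{1..N}. n < q}. 1 / \<bar>real q - real n\<bar>) \<le> (\<Sum>d=1..2*N. 1 / real d)"
  proof (rule sum_le_included[where i = "\<lambda>d. q - d"])
    show "\<forall>n\<in>{n \<in> {1..N}. n < q}. \<exists>d\<in>{1..2*N}. q - d = n \<and> 1 / \<bar>real q - real n\<bar> \<le> 1 / real d"
    proof
      fix n assume "n \<in> {n \<in> {1..N}. n < q}"
      then show "\<exists>d\<in>{1..2*N}. q - d = n \<and> 1 / \<bar>real q - real n\<bar> \<le> 1 / real d"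
        using True by (intro bexI[of _ "q - n"]) (auto simp: of_nat_diff)
    qed
  qed auto
  have gt: "(\<Sum>n\<in>{n\<in>{1..N}. q < n}. 1 / \<bar>real q - real n\<bar>) \<le> (\<Sum>d=1..2*N. 1 / real d)"
  proof (rule sum_le_included[where i = "\<lambda>d. q + d"])
    show "\<forall>n\<in>{n \<in> {1..N}. q < n}. \<exists>d\<in>{1..2*N}. q + d = n \<and> 1 / \<bar>real q - real n\<bar> \<le> 1 / real d"
    proof
      fix n assume "n \<in> {n \<in> {1..N}. q < n}"
      then show "\<exists>d\<in>{1..2*N}. q + d = n \<and> 1 / \<bar>real q - real n\<bar> \<le> 1 / real d"
        by (intro bexI[of _ "n - q"]) (auto simp: of_nat_diff)
    qed
  qed auto
  have split: "{1..N} - {q} = {n\<in>{1..N}. n < q} \<union> {n\<in>{1..N}. q < n}" by auto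
  have "(\<Sum>n\<in>{1..N} - {q}. 1 / \<bar>ln (real q) - ln (real n)\<bar>) \<le>
      (\<Sum>n\<in>{1..N} - {q}. 2 * real N * (1 / \<bar>real q - real n\<bar>))"
    by (intro sum_mono le)
  also have "\<dots> = 2 * real N * (\<Sum>n\<in>{1..N} - {q}. 1 / \<bar>real q - real n\<bar>)"
    by (simp only: sum_distrib_left)
  also have "(\<Sum>n\<in>{1..N} - {q}. 1 / \<bar>real q - real n\<bar>) = 
     (\<Sum>n\<in>{n\<in>{1..N}. n < q}. 1 / \<bar>real q - real n\<bar>) + (\<Sum>n\<in>{n\<in>{1..N}. q < n}. 1 / \<bar>real q - real n\<bar>)"
    unfolding split by (rule sum.union_disjoint) auto
  also have "2 * real N * \<dots> \<le> 2 * real N * ((1 + ln (2 * real N)) + (1 + ln (2 * real N)))"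
    using lt gt harm by (intro mult_left_mono add_mono) auto
  finally show ?thesis by (simp add: algebra_simps)
next
  case False
  have "(\<Sum>n\<in>{1..N} - {q}. 1 / \<bar>ln (real q) - ln (real n)\<bar>) \<le> (\<Sum>n\<in>{1..N} - {q}. 2)"
  proof (rule sum_mono)
    fix n assume n: "n \<in> {1..N} - {q}"
    have "1 / \<bar>ln (real q) - ln (real n)\<bar> \<le> real q / (real q - real n)"
      using n False by (intro inverse_ln_diff_le) auto
    also have "\<dots> \<le> 2" using n False by (auto simp: field_simps)
    finally show "1 / \<bar>ln (real q) - ln (real n)\<bar> \<le> 2" .
  qed
  also have "\<dots> \<le> 2 * real N" using False by simp
  also have "\<dots> \<le> 4 * real N * (1 + ln (2 * real N))"
  proof -
    have "0 \<le> ln (2 * real N)" using assms by (intro ln_ge_zero) auto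
    then have "4 * real N * 1 \<le> 4 * real N * (1 + ln (2 * real N))" by (intro mult_left_mono) auto
    then show ?thesis by linarith
  qed
  finally show ?thesis .
qed

section \<open>The shifted line\<close>

definition diag_weight :: "nat \<Rightarrow> nat \<Rightarrow> real" where
  "diag_weight b m = real m powr (-((1 + real b) / 2))"

definition diag_coeff :: "nat \<Rightarrow> nat \<Rightarrow> nat \<Rightarrow> real" where
  "diag_coeff b c n = (\<Sum>(m,k)\<in>{(m,k). m \<in> {1..n} \<and> k \<in> {1..n} \<and> m^b * k^c = n}.
      diag_weight b m * diag_weight c k)"

lemma diag_weight_nonneg: "0 \<le> diag_weight b m"
  by (simp add: diag_weight_def)

lemma power_mult_eq_bounds:
  fixes m k n b c :: nat
  assumes "0 < b" "0 < c" "0 < m" "0 < k" "m^b * k^c = n"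
  shows "m \<le> n" "k \<le> n"
proof -
  have "m \<le> m^b" "k \<le> k^c" using assms by (auto intro!: self_le_power)
  moreover have "m^b * 1 \<le> m^b * k^c" "1 * k^c \<le> m^b * k^c"
    using assms by (intro mult_le_mono; simp)+
  ultimately show "m \<le> n" "k \<le> n" using assms by auto
qed

text \<open>Places the pairs for all n < M in one common square, the index set of the truncated zeta
  product. No pair is lost, because m^b k^c = n forces m, k <= n.\<close>

lemma diag_coeff_eq:
  assumes "0 < b" "0 < c" "n < M"
  shows "diag_coeff b c n = (\<Sum>(m,k)\<in>{(m,k). m \<in> {1..<M} \<and> k \<in> {1..<M} \<and> m^b * k^c = n}.
      diag_weight b m * diag_weight c k)"
proof -
  have "{(m,k). m \<in> {1..n} \<and> k \<in> {1..n} \<and> m^b * k^c = n}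
      = {(m,k). m \<in> {1..<M} \<and> k \<in> {1..<M} \<and> m^b * k^c = n}"
    using assms power_mult_eq_bounds[of b c] by fastforce
  then show ?thesis by (simp add: diag_coeff_def)
qed

lemma sum_diag_weight_le:
  assumes "b \<ge> 2"
  shows "(\<Sum>m\<in>{1..<M}. diag_weight b m) \<le> 12"
proof -
  have "(\<Sum>m\<in>{1..<M}. diag_weight b m) \<le> (\<Sum>m\<in>{1..<M}. real m powr (-3/2))"
    unfolding diag_weight_def using assms by (intro sum_mono powr_mono) auto
  also have "\<dots> \<le> 12" by (rule sum_powr_three_halves_le)
  finally show ?thesis .
qed

definition zeta_trunc :: "nat \<Rightarrow> nat \<Rightarrow> real \<Rightarrow> complex" where
  "zeta_trunc b M t = (\<Sum>m\<in>{1..<M}. of_nat m powr (- Complex ((1 + real b) / 2) (-(real b * t))))"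

lemma shift_integrand_left_edge:
  assumes "0 < n"
  shows "shift_integrand b c n (Complex (-1/2) t) = cis (- t * ln (real n)) *
     (zeta_cont (Complex ((1 + real b) / 2) (-(real b * t))) *
      zeta_cont (Complex ((1 + real c) / 2) (-(real c * t))))"
proof -
  have eq: "1/2 - of_nat b * Complex (-1/2) t = Complex ((1 + real b) / 2) (-(real b * t))" for b
    by (simp add: complex_eq_iff add_divide_distrib)
  have "-1/2 - Complex (-1/2) t = - Complex 0 (-(-t))" by (simp add: complex_eq_iff)
  then have "of_nat n powr (-1/2 - Complex (-1/2) t) = cis (- t * ln (real n))"
    using of_nat_powr_Complex[OF assms, of 0 "-t"] assms by simp
  then show ?thesis unfolding shift_integrand_def eq by simp
qed

lemma norm_zeta_trunc_le:
  assumes "b \<ge> 2"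
  shows "norm (zeta_trunc b M t) \<le> 12"
proof -
  have "norm (zeta_trunc b M t) \<le> (\<Sum>m\<in>{1..<M}. diag_weight b m)"
    unfolding zeta_trunc_def diag_weight_def by (rule sum_norm_le) (simp add: norm_of_nat_powr)
  also have "\<dots> \<le> 12" using assms by (rule sum_diag_weight_le)
  finally show ?thesis .
qed

text \<open>The constant of \<open>zeta_cont_partial_sum_error\<close> at abscissa (1+b)/2 and
  height bT.\<close>

definition trunc_error :: "nat \<Rightarrow> real \<Rightarrow> real" where
  "trunc_error b T = 1 + ((1 + real b) / 2 + real b * T) * 2 powr ((1 + real b) / 2 + 1)"

lemma zeta_trunc_error:
  assumes "b \<ge> 2" "1 \<le> t" "t \<le> T" "0 < M"
  shows "norm (zeta_cont (Complex ((1 + real b) / 2) (-(real b * t))) - zeta_trunc b M t)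
       \<le> trunc_error b T * real M powr (-1/2)"
  unfolding zeta_trunc_def trunc_error_def
proof (rule zeta_cont_partial_sum_error)
  show "1 \<le> real b * t" using mult_mono[of 1 "real b" 1 t] assms by simp
qed (use assms in auto)

lemma shift_integrand_trunc_error:
  assumes bc: "b \<ge> 2" "c \<ge> 2" and t: "1 \<le> t" "t \<le> T" and M: "0 < M" and n: "0 < n"
  shows "norm (shift_integrand b c n (Complex (-1/2) t)
      - cis (- t * ln (real n)) * (zeta_trunc b M t * zeta_trunc c M t))
      \<le> 12 * (trunc_error b T + trunc_error c T) * real M powr (-1/2)"
proof -
  let ?Zb = "zeta_cont (Complex ((1 + real b) / 2) (-(real b * t)))"
  let ?Zc = "zeta_cont (Complex ((1 + real c) / 2) (-(real c * t)))"
  have Zb: "norm ?Zb \<le> 12"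
    using bc mult_mono[of 1 "real b" 1 t] t by (intro norm_zeta_cont_le_right) auto
  have "shift_integrand b c n (Complex (-1/2) t)
      - cis (- t * ln (real n)) * (zeta_trunc b M t * zeta_trunc c M t)
      = cis (- t * ln (real n)) * (?Zb * (?Zc - zeta_trunc c M t) + (?Zb - zeta_trunc b M t) * zeta_trunc c M t)"
    unfolding shift_integrand_left_edge[OF n] by (simp add: algebra_simps)
  also have "norm \<dots> = norm (?Zb * (?Zc - zeta_trunc c M t) + (?Zb - zeta_trunc b M t) * zeta_trunc c M t)"
    by (simp add: norm_mult)
  also have "\<dots> \<le> norm ?Zb * norm (?Zc - zeta_trunc c M t) + norm (?Zb - zeta_trunc b M t) * norm (zeta_trunc c M t)"
    by (rule order_trans[OF norm_triangle_ineq]) (simp add: norm_mult)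
  also have "\<dots> \<le> 12 * (trunc_error c T * real M powr (-1/2)) + trunc_error b T * real M powr (-1/2) * 12"
    using Zb norm_zeta_trunc_le[OF bc(2)] zeta_trunc_error[OF bc(1) t M] zeta_trunc_error[OF bc(2) t M]
    by (intro add_mono mult_mono) (auto intro: order_trans[OF norm_ge_zero])
  finally show ?thesis by (simp add: algebra_simps)
qed

lemma zeta_trunc_product:
  assumes n: "0 < n"
  shows "cis (- t * ln (real n)) * (zeta_trunc b M t * zeta_trunc c M t) =
     (\<Sum>(m,k)\<in>{1..<M}\<times>{1..<M}. of_real (diag_weight b m * diag_weight c k) *
         cis (t * (ln (real (m^b * k^c)) - ln (real n))))"
proof -
  have tr: "zeta_trunc b M t = (\<Sum>m\<in>{1..<M}. of_real (diag_weight b m) * cis (t * ln (real (m^b))))" for b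
    unfolding zeta_trunc_def diag_weight_def
    by (intro sum.cong refl) (simp add: of_nat_powr_Complex ln_realpow mult_ac)
  have "zeta_trunc b M t * zeta_trunc c M t =
     (\<Sum>(m,k)\<in>{1..<M}\<times>{1..<M}. (of_real (diag_weight b m) * cis (t * ln (real (m^b))))
        * (of_real (diag_weight c k) * cis (t * ln (real (k^c)))))"
    unfolding tr sum_product sum.cartesian_product ..
  then have "cis (- t * ln (real n)) * (zeta_trunc b M t * zeta_trunc c M t) =
     (\<Sum>(m,k)\<in>{1..<M}\<times>{1..<M}. cis (- t * ln (real n)) * ((of_real (diag_weight b m) * cis (t * ln (real (m^b))))
        * (of_real (diag_weight c k) * cis (t * ln (real (k^c))))))"
    by (simp only: sum_distrib_left case_prod_unfold)
  also have "\<dots> = (\<Sum>(m,k)\<in>{1..<M}\<times>{1..<M}. of_real (diag_weight b m * diag_weight c k) *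
         cis (t * (ln (real (m^b * k^c)) - ln (real n))))"
  proof (intro sum.cong refl, clarify)
    fix m k assume "m \<in> {1..<M}" "k \<in> {1..<M}"
    then have "ln (real (m^b * k^c)) = ln (real (m^b)) + ln (real (k^c))"
      by (simp add: ln_mult)
    then have "cis (t * (ln (real (m^b * k^c)) - ln (real n))) = 
       cis (- t * ln (real n)) * cis (t * ln (real (m^b))) * cis (t * ln (real (k^c)))"
      by (simp add: cis_mult algebra_simps)
    then show "cis (- t * ln (real n)) * ((of_real (diag_weight b m) * cis (t * ln (real (m^b))))
        * (of_real (diag_weight c k) * cis (t * ln (real (k^c))))) =
        of_real (diag_weight b m * diag_weight c k) * cis (t * (ln (real (m^b * k^c)) - ln (real n)))"
      by (simp add: mult_ac)
  qed
  finally show ?thesis .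
qed

text \<open>Integration of a finite double sum term by term: pairs with m^b k^c = n have frequency 0
  and contribute the length T - tau, the others at most 2 divided by the frequency. Since n < M, the
  square contains all pairs of the first kind.\<close>

lemma trunc_integral:
  assumes n: "0 < n" "n < M" and bc: "0 < b" "0 < c" and \<tau>: "\<tau> \<le> T"
  shows "\<exists>I. ((\<lambda>t. cis (- t * ln (real n)) * (zeta_trunc b M t * zeta_trunc c M t)) has_integral I) {\<tau>..T} \<and>
     norm (I - of_real ((T - \<tau>) * diag_coeff b c n)) \<le>
     (\<Sum>(m,k)\<in>{1..<M}\<times>{1..<M}. if m^b * k^c = n then 0 else
         diag_weight b m * diag_weight c k * (2 / \<bar>ln (real (m^b * k^c)) - ln (real n)\<bar>))"
proof -
  define A where "A = {1..<M} \<times> {1..<M}"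
  define q :: "nat \<times> nat \<Rightarrow> nat" where "q = (\<lambda>(m,k). m^b * k^c)"
  define w where "w = (\<lambda>(m,k). diag_weight b m * diag_weight c k)"
  have w0: "0 \<le> w p" for p by (cases p) (simp add: w_def diag_weight_nonneg)
  have "\<exists>J. ((\<lambda>t. cis (t * (ln (real (q p)) - ln (real n)))) has_integral J) {\<tau>..T} \<and>
     (q p = n \<longrightarrow> J = of_real (T - \<tau>)) \<and> (q p \<noteq> n \<longrightarrow> norm J \<le> 2 / \<bar>ln (real (q p)) - ln (real n)\<bar>)"
    if "p \<in> A" for p
  proof (cases "q p = n")
    case True
    then show ?thesis using has_integral_cis_zero[of "ln (real (q p)) - ln (real n)" \<tau> T] \<tau> by auto
  next
    case False
    have "0 < q p" using that by (auto simp: A_def q_def)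
    with False n have "ln (real (q p)) - ln (real n) \<noteq> 0" by simp
    then show ?thesis using has_integral_cis_nonzero[OF _ \<tau>] False by metis
  qed
  then obtain J where J: "\<And>p. p \<in> A \<Longrightarrow> ((\<lambda>t. cis (t * (ln (real (q p)) - ln (real n)))) has_integral J p) {\<tau>..T}"
     "\<And>p. p \<in> A \<Longrightarrow> q p = n \<Longrightarrow> J p = of_real (T - \<tau>)"
     "\<And>p. p \<in> A \<Longrightarrow> q p \<noteq> n \<Longrightarrow> norm (J p) \<le> 2 / \<bar>ln (real (q p)) - ln (real n)\<bar>"
    by metis
  have fin: "finite A" by (simp add: A_def)
  have int: "((\<lambda>t. \<Sum>p\<in>A. of_real (w p) * cis (t * (ln (real (q p)) - ln (real n)))) has_integral
      (\<Sum>p\<in>A. of_real (w p) * J p)) {\<tau>..T}"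
    using J(1) by (intro has_integral_sum fin has_integral_mult_right) auto
  have "diag_coeff b c n = (\<Sum>p\<in>{p\<in>A. q p = n}. w p)"
    unfolding diag_coeff_eq[OF bc n(2)] 
    by (intro sum.cong) (auto simp: A_def q_def w_def)
  also have "\<dots> = (\<Sum>p\<in>A. if q p = n then w p else 0)"
    using fin by (simp add: sum.inter_filter)
  finally have dc: "diag_coeff b c n = (\<Sum>p\<in>A. if q p = n then w p else 0)" .
  have "(\<Sum>p\<in>A. of_real (w p) * J p) - of_real ((T - \<tau>) * diag_coeff b c n) =
      (\<Sum>p\<in>A. of_real (w p) * J p - of_real ((T - \<tau>) * (if q p = n then w p else 0)))"
    unfolding dc by (simp add: sum_subtractf sum_distrib_left)
  also have "norm \<dots> \<le> (\<Sum>p\<in>A. if q p = n then 0 else w p * (2 / \<bar>ln (real (q p)) - ln (real n)\<bar>))"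
  proof (rule sum_norm_le)
    fix p assume "p \<in> A"
    then show "norm (of_real (w p) * J p - of_real ((T - \<tau>) * (if q p = n then w p else 0)))
       \<le> (if q p = n then 0 else w p * (2 / \<bar>ln (real (q p)) - ln (real n)\<bar>))"
      using J(2,3)[of p] w0[of p] mult_left_mono[OF J(3)[of p] w0[of p]]
      by (auto simp: norm_mult)
  qed
  finally have "norm ((\<Sum>p\<in>A. of_real (w p) * J p) - of_real ((T - \<tau>) * diag_coeff b c n))
      \<le> (\<Sum>p\<in>A. if q p = n then 0 else w p * (2 / \<bar>ln (real (q p)) - ln (real n)\<bar>))" .
  with int show ?thesis
    unfolding zeta_trunc_product[OF n(1)] A_def q_def w_def case_prod_unfold by blast
qed

text \<open>Summing over n first, with q = m^b k^c fixed, brings in the bound uniform in q; the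
  weights then sum to at most 12 in each variable, whatever M is. The constant is 12 * 12 * 2 *
  4.\<close>

lemma sum_off_diagonal_le:
  assumes bc: "b \<ge> 2" "c \<ge> 2" and N: "0 < N"
  shows "(\<Sum>n=1..N. \<Sum>(m,k)\<in>{1..<M}\<times>{1..<M}. if m^b * k^c = n then 0 else
         diag_weight b m * diag_weight c k * (2 / \<bar>ln (real (m^b * k^c)) - ln (real n)\<bar>))
       \<le> 1152 * real N * (1 + ln (2 * real N))"
proof -
  let ?A = "{1..<M} \<times> {1..<M}"
  let ?L = "4 * real N * (1 + ln (2 * real N))"
  have L0: "0 \<le> ?L" using N by (intro mult_nonneg_nonneg add_nonneg_nonneg ln_ge_zero) auto
  have "(\<Sum>n=1..N. \<Sum>(m,k)\<in>?A. if m^b * k^c = n then 0 else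
         diag_weight b m * diag_weight c k * (2 / \<bar>ln (real (m^b * k^c)) - ln (real n)\<bar>))
     = (\<Sum>(m,k)\<in>?A. \<Sum>n=1..N. if m^b * k^c = n then 0 else
         diag_weight b m * diag_weight c k * (2 / \<bar>ln (real (m^b * k^c)) - ln (real n)\<bar>))"
    unfolding case_prod_unfold by (rule sum.swap)
  also have "\<dots> \<le> (\<Sum>(m,k)\<in>?A. diag_weight b m * diag_weight c k * (2 * ?L))"
  proof (intro sum_mono, clarify)
    fix m k assume mk: "m \<in> {1..<M}" "k \<in> {1..<M}"
    define q where "q = m^b * k^c"
    have q: "0 < q" using mk by (auto simp: q_def)
    let ?w = "diag_weight b m * diag_weight c k"
    have "(\<Sum>n=1..N. if q = n then 0 else ?w * (2 / \<bar>ln (real q) - ln (real n)\<bar>)) 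
       = (\<Sum>n\<in>{1..N} - {q}. ?w * (2 / \<bar>ln (real q) - ln (real n)\<bar>))"
      by (rule sum.mono_neutral_cong_right) auto
    also have "\<dots> = ?w * (2 * (\<Sum>n\<in>{1..N} - {q}. 1 / \<bar>ln (real q) - ln (real n)\<bar>))"
      by (simp add: sum_distrib_left)
    also have "\<dots> \<le> ?w * (2 * ?L)"
      using sum_inverse_ln_diff_le[OF q N] by (intro mult_left_mono mult_nonneg_nonneg diag_weight_nonneg) auto
    finally show "(\<Sum>n=1..N. if m^b * k^c = n then 0 else
         ?w * (2 / \<bar>ln (real (m^b * k^c)) - ln (real n)\<bar>)) \<le> ?w * (2 * ?L)"
      unfolding q_def .
  qed
  also have "\<dots> = (\<Sum>m\<in>{1..<M}. diag_weight b m) * (\<Sum>k\<in>{1..<M}. diag_weight c k) * (2 * ?L)"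
    unfolding sum_product sum.cartesian_product by (simp only: case_prod_unfold sum_distrib_right)
  also have "\<dots> \<le> 12 * 12 * (2 * ?L)"
  proof (rule mult_right_mono)
    show "(\<Sum>m\<in>{1..<M}. diag_weight b m) * (\<Sum>k\<in>{1..<M}. diag_weight c k) \<le> 12 * 12"
      by (intro mult_mono sum_diag_weight_le bc sum_nonneg diag_weight_nonneg) auto
  qed (use L0 in linarith)
  finally show ?thesis by simp
qed

text \<open>M tends to infinity with T and N fixed. The truncation error decays like M^(-1/2) and
  the off-diagonal bound is free of M, so the limit stands in for integrating an infinite double
  series.\<close>

theorem left_edge_integral:
  assumes bc: "b \<ge> 2" "c \<ge> 2" and N: "0 < N"
    and \<tau>: "\<And>n. n \<in> {1..N} \<Longrightarrow> 1 \<le> \<tau> n \<and> real n \<le> \<tau> n \<and> \<tau> n \<le> T"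
  shows "norm ((\<Sum>n=1..N. integral {\<tau> n..T} (\<lambda>t. shift_integrand b c n (Complex (-1/2) t)))
      - of_real (\<Sum>n=1..N. (T - \<tau> n) * diag_coeff b c n)) \<le> 1152 * real N * (1 + ln (2 * real N))"
    (is "norm ?D \<le> ?R")
proof (rule tendsto_lowerbound)
  let ?E = "real N * (T * (12 * (trunc_error b T + trunc_error c T)))"
  have "(\<lambda>M. ?E * real M powr (-(1/2)) + ?R) \<longlonglongrightarrow> 0 + ?R"
    by (intro tendsto_add tendsto_const tendsto_mult_powr_neg) simp
  then show "(\<lambda>M. ?E * real M powr (-1/2) + ?R) \<longlonglongrightarrow> ?R" by simp
  show "\<forall>\<^sub>F M in sequentially. norm ?D \<le> ?E * real M powr (-1/2) + ?R"
    using eventually_gt_at_top[of N]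
  proof eventually_elim
    case (elim M)
    let ?g = "\<lambda>n t. shift_integrand b c n (Complex (-1/2) t)"
    let ?P = "\<lambda>n t. cis (- t * ln (real n)) * (zeta_trunc b M t * zeta_trunc c M t)"
    let ?e = "12 * (trunc_error b T + trunc_error c T) * real M powr (-1/2)"
    let ?O = "\<lambda>n. \<Sum>(m,k)\<in>{1..<M}\<times>{1..<M}. if m^b * k^c = n then 0 else
         diag_weight b m * diag_weight c k * (2 / \<bar>ln (real (m^b * k^c)) - ln (real n)\<bar>)"
    have "norm (integral {\<tau> n..T} (?g n) - of_real ((T - \<tau> n) * diag_coeff b c n)) \<le> T * ?e + ?O n"
      if n: "n \<in> {1..N}" for n
    proof -
      have n0: "0 < n" "n < M" "0 < M" using n elim by auto
      have t: "1 \<le> \<tau> n" "real n \<le> \<tau> n" "\<tau> n \<le> T" using \<tau>[OF n] by auto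
      obtain I where I: "(?P n has_integral I) {\<tau> n..T}" "norm (I - of_real ((T - \<tau> n) * diag_coeff b c n)) \<le> ?O n"
        using trunc_integral[OF n0(1,2) _ _ t(3), of b c] bc by auto
      have g: "?g n integrable_on {\<tau> n..T}" using shift_integral_bound(2)[OF bc t n0(1)] .
      have "norm (integral {\<tau> n..T} (\<lambda>t. ?g n t - ?P n t)) \<le> ?e * measure lborel {\<tau> n..T}"
      proof (rule has_integral_bound_real[where S = "{}"])
        have e0: "norm (?g n (\<tau> n) - ?P n (\<tau> n)) \<le> ?e"
          using t n0 by (intro shift_integrand_trunc_error bc) auto
        show "0 \<le> ?e" by (rule order_trans[OF norm_ge_zero e0])
        show "((\<lambda>t. ?g n t - ?P n t) has_integral integral {\<tau> n..T} (\<lambda>t. ?g n t - ?P n t)) {\<tau> n..T}"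
          using g I(1) by (intro integrable_integral integrable_diff) (auto simp: integrable_on_def)
        show "norm (?g n x - ?P n x) \<le> ?e" if "x \<in> {\<tau> n..T} - {}" for x
          using t n0 that by (intro shift_integrand_trunc_error bc) auto
      qed auto
      also have "\<dots> \<le> ?e * T"
      proof (rule mult_left_mono)
        show "0 \<le> ?e" using order_trans[OF norm_ge_zero shift_integrand_trunc_error[OF bc t(1,3) n0(3,1)]] .
      qed (use t in auto)
      finally have "norm (integral {\<tau> n..T} (?g n) - I) \<le> T * ?e"
        using integral_diff[OF g, of "?P n"] I(1) integral_unique[OF I(1)] by (auto simp: integrable_on_def mult.commute)
      then show ?thesis
        using I(2) norm_triangle_ineq[of "integral {\<tau> n..T} (?g n) - I" "I - of_real ((T - \<tau> n) * diag_coeff b c n)"]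
        by simp
    qed
    then have "norm (\<Sum>n=1..N. integral {\<tau> n..T} (?g n) - of_real ((T - \<tau> n) * diag_coeff b c n))
        \<le> (\<Sum>n=1..N. T * ?e + ?O n)"
      by (intro sum_norm_le) auto
    also have "(\<Sum>n=1..N. integral {\<tau> n..T} (?g n) - of_real ((T - \<tau> n) * diag_coeff b c n)) = ?D"
      by (simp add: sum_subtractf)
    also have "(\<Sum>n=1..N. T * ?e + ?O n) = ?E * real M powr (-1/2) + (\<Sum>n=1..N. ?O n)"
      by (simp add: sum.distrib)
    also have "\<dots> \<le> ?E * real M powr (-1/2) + ?R"
      by (intro add_left_mono sum_off_diagonal_le bc N)
    finally show ?case .
  qed
qed simp

section \<open>The hyperbola method\<close>

definition zeta_real :: "real \<Rightarrow> real" where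
  "zeta_real \<rho> = Re (zeta_cont (of_real \<rho>))"

lemma zeta_cont_of_real:
  assumes "\<rho> > 0"
  shows "zeta_cont (of_real \<rho>) = of_real (zeta_real \<rho>)"
proof -
  have "zeta_approx N (of_real \<rho>) \<in> \<real>" for N
  proof -
    have "of_nat n powr complex_of_real x = of_real (real n powr x)" for n x
      using powr_of_real[of "real n" x] by simp
    then have "of_nat n powr (- complex_of_real \<rho>) \<in> \<real>" "of_nat n powr (1 - complex_of_real \<rho>) \<in> \<real>" for n
      by (metis Reals_of_real of_real_minus, metis Reals_of_real of_real_1 of_real_diff)
    then show ?thesis unfolding zeta_approx_def by (intro Reals_add Reals_mult Reals_diff sum_in_Reals) auto
  qed
  then have "zeta_reg (of_real \<rho>) \<in> \<real>"
    using zeta_approx_tendsto[of "of_real \<rho>"] assms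
    by (intro Lim_in_closed_set[OF closed_complex_Reals]) auto
  then have "zeta_cont (of_real \<rho>) \<in> \<real>" unfolding zeta_cont_def by (intro Reals_divide Reals_diff) auto
  then show ?thesis by (simp add: zeta_real_def)
qed

definition powr_sum :: "real \<Rightarrow> real \<Rightarrow> real" where
  "powr_sum \<rho> x = (\<Sum>n=1..nat \<lfloor>x\<rfloor>. real n powr (-\<rho>))"

lemma powr_sum_asymptotics:
  assumes \<rho>: "\<rho> > 0" "\<rho> \<noteq> 1" and x: "x \<ge> 1"
  shows "\<bar>powr_sum \<rho> x - (zeta_real \<rho> + x powr (1-\<rho>) / (1-\<rho>))\<bar> \<le> (2 powr (\<rho>+1) + 1) * x powr (-\<rho>)"
proof -
  define N where "N = Suc (nat \<lfloor>x\<rfloor>)"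
  let ?s = "complex_of_real \<rho>"
  have N: "x \<le> real N" "real N \<le> x + 1" "0 < N"
    unfolding N_def using x floor_correct[of x] by linarith+
  have pw: "of_nat n powr complex_of_real y = of_real (real n powr y)" for n y
    using powr_of_real[of "real n" y] by simp
  have s1: "(\<Sum>n\<in>{1..<N}. of_nat n powr (-?s)) = of_real (powr_sum \<rho> x)"
    unfolding powr_sum_def N_def using pw[of _ "-\<rho>"] by (simp add: atLeastLessThanSuc_atLeastAtMost)
  have s2: "of_nat N powr (1-?s) / (?s-1) = of_real (real N powr (1-\<rho>) / (\<rho>-1))"
    using pw[of N "1-\<rho>"] by simp
  have 1: "norm (zeta_cont ?s - (of_real (powr_sum \<rho> x) + of_real (real N powr (1-\<rho>) / (\<rho>-1))))
     \<le> norm ?s * (2 powr (\<rho>+1) / \<rho>) * real N powr (-\<rho>)"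
    using zeta_cont_diff_le[of ?s N] \<rho> N unfolding s1 s2 by simp
  have "\<bar>zeta_real \<rho> - (powr_sum \<rho> x + real N powr (1-\<rho>) / (\<rho>-1))\<bar> \<le> norm ?s * (2 powr (\<rho>+1) / \<rho>) * real N powr (-\<rho>)"
    using 1 unfolding zeta_cont_of_real[OF \<rho>(1)] of_real_add[symmetric] of_real_diff[symmetric] norm_of_real .
  also have "norm ?s * (2 powr (\<rho>+1) / \<rho>) = 2 powr (\<rho>+1)" using \<rho> by simp
  also have "2 powr (\<rho>+1) * real N powr (-\<rho>) \<le> 2 powr (\<rho>+1) * x powr (-\<rho>)"
    using N x \<rho> by (intro mult_left_mono powr_mono2') auto
  finally have A: "\<bar>zeta_real \<rho> - (powr_sum \<rho> x + real N powr (1-\<rho>) / (\<rho>-1))\<bar> \<le> 2 powr (\<rho>+1) * x powr (-\<rho>)" .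
  \<comment> \<open>Replacing N by x in the tail term costs at most x^(-rho), since 0 <= N - x <= 1;
    this is the summand 1 in the constant.\<close>
  have B: "\<bar>real N powr (1-\<rho>) / (\<rho>-1) - x powr (1-\<rho>) / (\<rho>-1)\<bar> \<le> x powr (-\<rho>)"
  proof -
    have "norm (of_real (real N) powr (-(?s-1)) - of_real x powr (-(?s-1))) \<le>
       norm (?s-1) * x powr (- Re (?s-1) - 1) * (real N - x)"
      using x N \<rho> by (intro norm_powr_minus_diff_le) auto
    also have "\<dots> \<le> norm (?s-1) * x powr (- Re (?s-1) - 1) * 1"
      using N by (intro mult_left_mono) auto
    also have "of_real (real N) powr (-(?s-1)) - of_real x powr (-(?s-1)) = of_real (real N powr (1-\<rho>) - x powr (1-\<rho>))"
      using powr_of_real[of "real N" "1-\<rho>"] powr_of_real[of x "1-\<rho>"] x by simp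
    also have "norm (?s-1) = \<bar>\<rho>-1\<bar>" by (metis norm_of_real of_real_1 of_real_diff)
    finally have "\<bar>real N powr (1-\<rho>) - x powr (1-\<rho>)\<bar> \<le> \<bar>\<rho>-1\<bar> * x powr (-\<rho>)"
      unfolding norm_of_real by simp
    then have "\<bar>real N powr (1-\<rho>) - x powr (1-\<rho>)\<bar> / \<bar>\<rho>-1\<bar> \<le> x powr (-\<rho>)"
      using \<rho> by (simp add: divide_le_eq mult.commute)
    then show ?thesis by (simp only: abs_divide diff_divide_distrib[symmetric])
  qed
  have "x powr (1-\<rho>) / (1-\<rho>) = - (x powr (1-\<rho>) / (\<rho>-1))"
    by (metis minus_diff_eq divide_minus_right)
  with A B show ?thesis by (simp add: ring_distribs)
qed

text \<open>One 1/x comes from the Euler-Mascheroni bounds for \<open>harm n\<close> against ln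
  (n+1), the other from comparing ln (n+1) with ln x.\<close>

lemma powr_sum_one_asymptotics:
  assumes x: "x \<ge> 1"
  shows "\<bar>powr_sum 1 x - (ln x + euler_mascheroni)\<bar> \<le> 2 / x"
proof -
  define n where "n = nat \<lfloor>x\<rfloor>"
  have n: "1 \<le> n" "real n \<le> x" "x \<le> real n + 1"
    unfolding n_def using x floor_correct[of x] by linarith+
  have "powr_sum 1 x = harm n"
    unfolding powr_sum_def n_def[symmetric] harm_def by (intro sum.cong) (auto simp: powr_minus)
  moreover have "\<bar>harm n - ln (real (Suc n)) - euler_mascheroni\<bar> \<le> 1 / x"
  proof -
    have "\<bar>harm n - ln (real (Suc n)) - euler_mascheroni\<bar> \<le> inverse (2 * real n)"
      using euler_mascheroni_bounds[OF n(1)] n(1) by (auto simp: abs_le_iff field_simps)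
    also have "\<dots> \<le> 1 / x" using n x by (simp add: field_simps)
    finally show ?thesis .
  qed
  moreover have "\<bar>ln (real (Suc n)) - ln x\<bar> \<le> 1 / x"
  proof -
    have "ln (real (Suc n)) - ln x = ln (real (Suc n) / x)" using x by (simp add: ln_div)
    also have "\<dots> \<le> real (Suc n) / x - 1" using x by (intro ln_le_minus_one) auto
    also have "\<dots> \<le> 1 / x" using n x by (simp add: field_simps)
    finally have "ln (real (Suc n)) - ln x \<le> 1 / x" .
    moreover have "ln x \<le> ln (real (Suc n))" using n x by (subst ln_le_cancel_iff) auto
    ultimately show ?thesis by simp
  qed
  ultimately show ?thesis by linarith
qed

definition diag_sum :: "nat \<Rightarrow> nat \<Rightarrow> real \<Rightarrow> real" where
  "diag_sum b c X = (\<Sum>n=1..nat \<lfloor>X\<rfloor>. diag_coeff b c n)"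

lemma diag_sum_eq:
  assumes bc: "0 < b" "0 < c" and X: "X \<ge> 1" 
  shows "diag_sum b c X = (\<Sum>(m,k)\<in>{(m,k). 1 \<le> m \<and> 1 \<le> k \<and> real m ^ b * real k ^ c \<le> X}.
      diag_weight b m * diag_weight c k)"
    and "finite {(m::nat,k::nat). 1 \<le> m \<and> 1 \<le> k \<and> real m ^ b * real k ^ c \<le> X}"
proof -
  define M where "M = Suc (nat \<lfloor>X\<rfloor>)"
  define B where "B = {1..<M} \<times> {1..<M}"
  define q :: "nat \<times> nat \<Rightarrow> nat" where "q = (\<lambda>(m,k). m^b * k^c)"
  define w where "w = (\<lambda>(m,k). diag_weight b m * diag_weight c k)"
  have le_iff: "real j \<le> X \<longleftrightarrow> j \<le> nat \<lfloor>X\<rfloor>" for j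
    using X by (simp add: le_nat_iff le_floor_iff)
  have set_eq: "{(m,k). 1 \<le> m \<and> 1 \<le> k \<and> real m ^ b * real k ^ c \<le> X} = {p\<in>B. q p \<in> {1..nat \<lfloor>X\<rfloor>}}"
  proof (rule set_eqI)
    fix p :: "nat \<times> nat"
    obtain m k where p: "p = (m,k)" by (cases p)
    have eq: "real m ^ b * real k ^ c \<le> X \<longleftrightarrow> m^b * k^c \<le> nat \<lfloor>X\<rfloor>"
      using le_iff[of "m^b * k^c"] by simp
    show "p \<in> {(m,k). 1 \<le> m \<and> 1 \<le> k \<and> real m ^ b * real k ^ c \<le> X} \<longleftrightarrow> p \<in> {p\<in>B. q p \<in> {1..nat \<lfloor>X\<rfloor>}}"
    proof (cases "1 \<le> m \<and> 1 \<le> k \<and> m^b * k^c \<le> nat \<lfloor>X\<rfloor>")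
      case True
      then have "m \<le> nat \<lfloor>X\<rfloor>" "k \<le> nat \<lfloor>X\<rfloor>"
        using power_mult_eq_bounds[OF bc, of m k "m^b * k^c"] by auto
      with True eq show ?thesis by (simp add: p B_def q_def M_def)
    next
      case False
      with eq show ?thesis by (auto simp: p B_def q_def)
    qed
  qed
  show "finite {(m::nat,k::nat). 1 \<le> m \<and> 1 \<le> k \<and> real m ^ b * real k ^ c \<le> X}"
    unfolding set_eq by (simp add: B_def)
  have "diag_sum b c X = (\<Sum>n=1..nat \<lfloor>X\<rfloor>. \<Sum>p\<in>{p\<in>{p\<in>B. q p \<in> {1..nat \<lfloor>X\<rfloor>}}. q p = n}. w p)"
    unfolding diag_sum_def
  proof (intro sum.cong refl)
    fix n assume n: "n \<in> {1..nat \<lfloor>X\<rfloor>}"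
    have "diag_coeff b c n = (\<Sum>p\<in>{p\<in>B. q p = n}. w p)"
      using n by (subst diag_coeff_eq[OF bc, of n M]) (auto simp: M_def B_def q_def w_def intro!: sum.cong)
    also have "{p\<in>B. q p = n} = {p\<in>{p\<in>B. q p \<in> {1..nat \<lfloor>X\<rfloor>}}. q p = n}" using n by auto
    finally show "diag_coeff b c n = (\<Sum>p\<in>{p\<in>{p\<in>B. q p \<in> {1..nat \<lfloor>X\<rfloor>}}. q p = n}. w p)" .
  qed
  also have "\<dots> = (\<Sum>p\<in>{p\<in>B. q p \<in> {1..nat \<lfloor>X\<rfloor>}}. w p)"
    by (rule sum.group) (auto simp: B_def)
  finally show "diag_sum b c X = (\<Sum>(m,k)\<in>{(m,k). 1 \<le> m \<and> 1 \<le> k \<and> real m ^ b * real k ^ c \<le> X}.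
      diag_weight b m * diag_weight c k)"
    unfolding set_eq w_def .
qed

lemma power_le_iff_le_powr:
  assumes "0 < c" "Y > 0"
  shows "real k ^ c \<le> Y \<longleftrightarrow> k \<le> nat \<lfloor>Y powr (1 / real c)\<rfloor>"
proof -
  have "real k ^ c \<le> Y \<longleftrightarrow> real k \<le> Y powr (1 / real c)"
  proof
    assume "real k ^ c \<le> Y"
    then have "(real k ^ c) powr (1 / real c) \<le> Y powr (1 / real c)" by (intro powr_mono2) auto
    moreover have "(real k ^ c) powr (1 / real c) = real k"
    proof (cases "k = 0")
      case False
      then show ?thesis using assms by (simp add: powr_realpow[symmetric] powr_powr)
    qed (use assms in auto)
    ultimately show "real k \<le> Y powr (1 / real c)" by simp
  next
    assume "real k \<le> Y powr (1 / real c)"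
    then have "real k ^ c \<le> (Y powr (1 / real c)) ^ c" by (intro power_mono) auto
    also have "\<dots> = Y" using assms by (simp add: powr_realpow[symmetric] powr_powr)
    finally show "real k ^ c \<le> Y" .
  qed
  then show ?thesis using assms by (simp add: le_nat_iff le_floor_iff)
qed

text \<open>The part m <= X^(1/(b+c)) of the region m^b k^c <= X, with the sum over k carried out
  inside.\<close>

definition hyperbola_part :: "nat \<Rightarrow> nat \<Rightarrow> real \<Rightarrow> real" where
  "hyperbola_part b c X = (\<Sum>m=1..nat \<lfloor>X powr (1 / (real b + real c))\<rfloor>.
     diag_weight b m * powr_sum ((1 + real c) / 2) ((X / real m ^ b) powr (1 / real c)))"

text \<open>Since P^b P^c = X, no point of the region has both coordinates above P, and the square
  of side P lies inside it. The two parts thus cover the region and overlap exactly in that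
  square.\<close>

lemma hyperbola_identity:
  assumes bc: "0 < b" "0 < c" and X: "X \<ge> 1"
  defines "P \<equiv> X powr (1 / (real b + real c))"
  shows "diag_sum b c X = hyperbola_part b c X + hyperbola_part c b X - powr_sum ((1 + real b) / 2) P * powr_sum ((1 + real c) / 2) P"
proof -
  define r where "r = nat \<lfloor>P\<rfloor>"
  have P1: "P \<ge> 1" unfolding P_def using X by (intro ge_one_powr_ge_zero) auto
  have PX: "P ^ b * P ^ c = X"
  proof -
    have "P ^ (b + c) = X" unfolding P_def using X bc by (simp add: powr_realpow[symmetric] powr_powr)
    then show ?thesis by (simp add: power_add)
  qed
  have r: "m \<le> r \<longleftrightarrow> real m \<le> P" for m using P1 by (simp add: r_def le_nat_iff le_floor_iff)
  let ?w = "\<lambda>(m,k). diag_weight b m * diag_weight c k"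
  let ?H = "{(m::nat,k::nat). 1 \<le> m \<and> 1 \<le> k \<and> real m ^ b * real k ^ c \<le> X}"
  let ?H1 = "SIGMA m:{1..r}. {1..nat \<lfloor>(X / real m ^ b) powr (1 / real c)\<rfloor>}"
  let ?H2 = "SIGMA k:{1..r}. {1..nat \<lfloor>(X / real k ^ c) powr (1 / real b)\<rfloor>}"
  have m1: "k \<le> nat \<lfloor>(X / real m ^ b) powr (1 / real c)\<rfloor> \<longleftrightarrow> real m ^ b * real k ^ c \<le> X"
    if "1 \<le> m" "0 < c" for m k b c
  proof -
    have "real m ^ b > 0" using that by simp
    then show ?thesis
      using power_le_iff_le_powr[of c "X / real m ^ b" k] that X by (simp add: field_simps)
  qed
  have H1: "?H1 = {p\<in>?H. fst p \<le> r}" using m1[of _ c _ b] bc by auto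
  have H2: "(\<lambda>(k,m). (m,k)) ` ?H2 = {p\<in>?H. snd p \<le> r}"
    using m1[of _ b _ c] bc by (auto simp: image_iff mult.commute)
  have cov: "?H = {p\<in>?H. fst p \<le> r} \<union> {p\<in>?H. snd p \<le> r}"
  proof -
    have *: "m \<le> r \<or> k \<le> r" if "real m ^ b * real k ^ c \<le> X" for m k
    proof (rule ccontr)
      assume "\<not> (m \<le> r \<or> k \<le> r)"
      then have "P < real m" "P < real k" using r by auto
      then have "P ^ b * P ^ c < real m ^ b * real k ^ c"
        using P1 bc by (intro mult_strict_mono power_strict_mono) auto
      with that PX show False by simp
    qed
    have "fst p \<le> r \<or> snd p \<le> r" if "p \<in> ?H" for p
      using that *[of "fst p" "snd p"] by (simp add: case_prod_unfold)
    then show ?thesis by blast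
  qed
  have int: "{p\<in>?H. fst p \<le> r} \<inter> {p\<in>?H. snd p \<le> r} = {1..r} \<times> {1..r}"
  proof -
    have "real m ^ b * real k ^ c \<le> X" if "m \<le> r" "k \<le> r" for m k
    proof -
      have "real m ^ b * real k ^ c \<le> P ^ b * P ^ c"
        using that r P1 by (intro mult_mono power_mono) auto
      with PX show ?thesis by simp
    qed
    then show ?thesis by auto
  qed
  have fin: "finite ?H" by (rule diag_sum_eq(2)[OF bc X])
  have "diag_sum b c X = sum ?w ?H" by (rule diag_sum_eq(1)[OF bc X])
  also have "\<dots> = sum ?w {p\<in>?H. fst p \<le> r} + sum ?w {p\<in>?H. snd p \<le> r} - sum ?w ({1..r} \<times> {1..r})"
  proof -
    have f: "finite {p\<in>?H. fst p \<le> r}" "finite {p\<in>?H. snd p \<le> r}"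
      by (rule finite_subset[OF _ fin], blast)+
    from sum_Un[OF f, of ?w] show ?thesis unfolding cov[symmetric] int .
  qed
  also have "sum ?w {p\<in>?H. fst p \<le> r} = hyperbola_part b c X"
    unfolding H1[symmetric] hyperbola_part_def powr_sum_def P_def[symmetric] r_def[symmetric]
    by (subst sum.Sigma[symmetric]) (auto simp: sum_distrib_left diag_weight_def)
  also have "sum ?w {p\<in>?H. snd p \<le> r} = hyperbola_part c b X"
  proof -
    have "sum ?w {p\<in>?H. snd p \<le> r} = sum (?w \<circ> (\<lambda>(k,m). (m,k))) ?H2"
      unfolding H2[symmetric] by (rule sum.reindex) (auto simp: inj_on_def)
    also have "\<dots> = (\<Sum>k=1..r. \<Sum>m=1..nat \<lfloor>(X / real k ^ c) powr (1 / real b)\<rfloor>. diag_weight b m * diag_weight c k)"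
      by (subst sum.Sigma) (auto simp: case_prod_unfold intro!: sum.cong)
    also have "\<dots> = hyperbola_part c b X"
      unfolding hyperbola_part_def powr_sum_def add.commute[of "real c"] P_def[symmetric] r_def[symmetric]
      by (auto simp: sum_distrib_left diag_weight_def mult.commute intro!: sum.cong)
    finally show ?thesis .
  qed
  also have "sum ?w ({1..r} \<times> {1..r}) = powr_sum ((1 + real b) / 2) P * powr_sum ((1 + real c) / 2) P"
    unfolding powr_sum_def r_def[symmetric] sum_product sum.cartesian_product diag_weight_def ..
  finally show ?thesis .
qed

text \<open>The inner sum is replaced by \<open>powr_sum_asymptotics\<close>. In its tail term the
  exponents combine: m^(-(1+b)/2) (X/m^b)^((1-kappa)/c) = X^(1/(2c)-1/2) m^(-rho) with rho = b/(2c)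
  + 1/2, which gives a second power sum. The errors X^(-kappa/c) m^(b/(2c)-1/2) add up to
  O(X^(-1/2)) because P^(b/(2c)+1/2) = X^(1/(2c)).\<close>

lemma hyperbola_part_asymptotics:
  assumes bc: "2 \<le> b" "2 \<le> c" and X: "X \<ge> 1"
  defines "P \<equiv> X powr (1 / (real b + real c))" and "\<kappa> \<equiv> (1 + real c) / 2"
  shows "\<bar>hyperbola_part b c X - (zeta_real \<kappa> * powr_sum ((1 + real b) / 2) P
      + X powr (1 / (2 * real c) - 1/2) / (1 - \<kappa>) * powr_sum (real b / (2 * real c) + 1/2) P)\<bar>
      \<le> 2 * (2 powr (\<kappa>+1) + 1) * X powr (-1/2)"
proof -
  define r where "r = nat \<lfloor>P\<rfloor>"
  define \<rho> where "\<rho> = real b / (2 * real c) + 1/2"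
  define C where "C = 2 powr (\<kappa>+1) + 1"
  have C: "C \<ge> 0" by (simp add: C_def)
  have c0: "real c > 0" "real b > 0" using bc by auto
  have P1: "P \<ge> 1" unfolding P_def using X by (intro ge_one_powr_ge_zero) auto
  have Pr: "real m \<le> P" if "m \<le> r" for m using that P1 by (simp add: r_def le_nat_iff le_floor_iff)
  have \<kappa>: "\<kappa> > 0" "\<kappa> \<noteq> 1" using bc by (auto simp: \<kappa>_def)
  have PX: "P ^ b * P ^ c = X"
  proof -
    have "P ^ (b + c) = X" unfolding P_def using X bc by (simp add: powr_realpow[symmetric] powr_powr)
    then show ?thesis by (simp add: power_add)
  qed
  let ?y = "\<lambda>m. (X / real m ^ b) powr (1 / real c)"
  have y1: "?y m \<ge> 1" if m: "1 \<le> m" "m \<le> r" for m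
  proof -
    have "real m ^ b * 1 \<le> P ^ b * P ^ c" using Pr[OF m(2)] P1 by (intro mult_mono power_mono) auto
    then have "X / real m ^ b \<ge> 1" using PX m by simp
    then show ?thesis by (intro ge_one_powr_ge_zero) auto
  qed
  have ypow: "diag_weight b m * ?y m powr z = X powr (z / real c) * real m powr (-((1 + real b)/2) - real b * z / real c)"
    if m: "1 \<le> m" for m z
  proof -
    have "?y m powr z = X powr (z / real c) / real m powr (real b * z / real c)"
      using m X by (simp add: powr_powr powr_divide powr_realpow[symmetric] powr_powr)
    then show ?thesis unfolding diag_weight_def by (simp add: powr_diff)
  qed
  define D where "D = hyperbola_part b c X - (zeta_real \<kappa> * powr_sum ((1 + real b) / 2) P
      + X powr (1 / (2 * real c) - 1/2) / (1 - \<kappa>) * powr_sum \<rho> P)"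
  define S where "S = (\<Sum>m=1..r. diag_weight b m * (powr_sum \<kappa> (?y m) - (zeta_real \<kappa> + ?y m powr (1-\<kappa>) / (1-\<kappa>))))"
  have "hyperbola_part b c X - (zeta_real \<kappa> * powr_sum ((1 + real b) / 2) P
      + X powr (1 / (2 * real c) - 1/2) / (1 - \<kappa>) * powr_sum \<rho> P)
     = (\<Sum>m=1..r. diag_weight b m * (powr_sum \<kappa> (?y m) - (zeta_real \<kappa> + ?y m powr (1-\<kappa>) / (1-\<kappa>))))"
  proof -
    have e1: "powr_sum ((1 + real b) / 2) P = (\<Sum>m=1..r. diag_weight b m)"
      by (simp add: powr_sum_def r_def diag_weight_def)
    have "diag_weight b m * ?y m powr (1-\<kappa>) = X powr (1 / (2 * real c) - 1/2) * real m powr (-\<rho>)"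
      if "m \<in> {1..r}" for m
    proof -
      have "(1-\<kappa>) / real c = 1 / (2 * real c) - 1/2" using c0 by (simp add: \<kappa>_def field_simps)
      moreover have "-((1 + real b)/2) - real b * (1-\<kappa>) / real c = -\<rho>"
        using c0 by (simp add: \<kappa>_def \<rho>_def field_simps)
      ultimately show ?thesis using ypow[of m "1-\<kappa>"] that by simp
    qed
    then have "(\<Sum>m=1..r. diag_weight b m * ?y m powr (1-\<kappa>)) = X powr (1 / (2 * real c) - 1/2) * powr_sum \<rho> P"
      by (simp add: powr_sum_def r_def sum_distrib_left)
    then have e2: "X powr (1 / (2 * real c) - 1/2) / (1 - \<kappa>) * powr_sum \<rho> P 
        = (\<Sum>m=1..r. diag_weight b m * (?y m powr (1-\<kappa>) / (1-\<kappa>)))"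
      by (simp add: sum_divide_distrib[symmetric])
    have "(\<Sum>m=1..r. diag_weight b m * (powr_sum \<kappa> (?y m) - (zeta_real \<kappa> + ?y m powr (1-\<kappa>) / (1-\<kappa>))))
       = (\<Sum>m=1..r. diag_weight b m * powr_sum \<kappa> (?y m)) - 
         (zeta_real \<kappa> * (\<Sum>m=1..r. diag_weight b m) + (\<Sum>m=1..r. diag_weight b m * (?y m powr (1-\<kappa>) / (1-\<kappa>))))"
      by (simp only: right_diff_distrib distrib_left sum_subtractf sum.distrib sum_distrib_left mult.commute[of _ "zeta_real \<kappa>"])
    then show ?thesis
      unfolding e1 e2 hyperbola_part_def P_def[symmetric] r_def[symmetric] \<kappa>_def[symmetric] by simp
  qed
  then have DS: "D = S" unfolding D_def S_def .
  have "\<bar>S\<bar> \<le> (\<Sum>m=1..r. C * (X powr (-\<kappa> / real c) * (P powr (real b / (2 * real c)) * (1 / sqrt (real m)))))"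
    unfolding S_def
  proof (rule order_trans[OF sum_abs], rule sum_mono)
    fix m assume m: "m \<in> {1..r}"
    have "\<bar>diag_weight b m * (powr_sum \<kappa> (?y m) - (zeta_real \<kappa> + ?y m powr (1-\<kappa>) / (1-\<kappa>)))\<bar>
       \<le> diag_weight b m * (C * ?y m powr (-\<kappa>))"
      unfolding abs_mult C_def using powr_sum_asymptotics[OF \<kappa> y1] m diag_weight_nonneg[of b m]
      by (auto intro!: mult_left_mono)
    also have "\<dots> = C * (X powr (-\<kappa> / real c) * real m powr (real b / (2 * real c) - 1/2))"
    proof -
      have "-((1 + real b)/2) - real b * (-\<kappa>) / real c = real b / (2 * real c) - 1/2"
        using c0 by (simp add: \<kappa>_def field_simps)
      then show ?thesis using ypow[of m "-\<kappa>"] m by simp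
    qed
    \<comment> \<open>Only the increasing factor m^(b/(2c)) is replaced by its value at P; the
      factor 1/sqrt m is kept for the summation, so b < c and b > c need no separate
      treatment.\<close>
    also have "real m powr (real b / (2 * real c) - 1/2) = real m powr (real b / (2 * real c)) * (1 / sqrt (real m))"
      by (simp add: powr_diff powr_half_sqrt)
    also have "C * (X powr (-\<kappa> / real c) * \<dots>) \<le> C * (X powr (-\<kappa> / real c) * (P powr (real b / (2 * real c)) * (1 / sqrt (real m))))"
      using C Pr[of m] m by (intro mult_left_mono mult_right_mono powr_mono2) auto
    finally show "\<bar>diag_weight b m * (powr_sum \<kappa> (?y m) - (zeta_real \<kappa> + ?y m powr (1-\<kappa>) / (1-\<kappa>)))\<bar>
      \<le> C * (X powr (-\<kappa> / real c) * (P powr (real b / (2 * real c)) * (1 / sqrt (real m))))" .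
  qed
  also have "\<dots> = C * (X powr (-\<kappa> / real c) * (P powr (real b / (2 * real c)) * (\<Sum>m=1..r. 1 / sqrt (real m))))"
    unfolding sum_distrib_left[symmetric] ..
  also have "\<dots> \<le> C * (X powr (-\<kappa> / real c) * (P powr (real b / (2 * real c)) * (2 * sqrt P)))"
  proof -
    have "(\<Sum>m=1..r. 1 / sqrt (real m)) \<le> 2 * sqrt (real r)" by (rule sum_inverse_sqrt_le)
    also have "\<dots> \<le> 2 * sqrt P" using Pr[of r] by simp
    finally show ?thesis using C by (intro mult_left_mono) auto
  qed
  also have "\<dots> = 2 * C * (X powr (-\<kappa> / real c) * (P powr (real b / (2 * real c)) * P powr (1/2)))"
    using P1 by (simp add: powr_half_sqrt)
  also have "P powr (real b / (2 * real c)) * P powr (1/2) = X powr (1 / (2 * real c))"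
  proof -
    have "real b / (2 * real c) + 1/2 = 1 / (2 * real c) * (real b + real c)"
      using c0 by (simp add: field_simps)
    then have "1 / (real b + real c) * (real b / (2 * real c) + 1/2) = 1 / (2 * real c)"
      using c0 by simp
    then show ?thesis unfolding P_def powr_powr powr_add[symmetric] distrib_left[symmetric] by (simp only:)
  qed
  also have "X powr (-\<kappa> / real c) * X powr (1 / (2 * real c)) = X powr (-1/2)"
  proof -
    have "-\<kappa> / real c + 1 / (2 * real c) = -1/2" using c0 by (simp add: \<kappa>_def field_simps)
    then show ?thesis by (simp only: powr_add[symmetric])
  qed
  finally show ?thesis using DS by (simp add: D_def \<rho>_def C_def)
qed

lemma abs_sum3_le:
  fixes x y z :: real
  assumes "\<bar>x\<bar> \<le> a" "\<bar>y\<bar> \<le> b" "\<bar>z\<bar> \<le> c"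
  shows "\<bar>x + y + z\<bar> \<le> a + b + c"
  using assms by linarith

text \<open>Write the two power sums at P as a = zeta(beta) + u + e and k = zeta(kappa) + v + f,
  with tail terms u, v and errors e, f. Then zeta(beta) k + zeta(kappa) a - a k = zeta(beta)
  zeta(kappa) - (u+e)(v+f). The product uv is the explicit term of order X^(1/(b+c)-1/2); the other
  three are O(P^(1-beta-kappa)) = O(X^(-1/2)), since beta + kappa - 1 = (b+c)/2.\<close>

lemma diag_sum_expansion:
  assumes bc: "2 \<le> b" "2 \<le> c"
  defines "\<beta> \<equiv> (1 + real b) / 2" and "\<kappa> \<equiv> (1 + real c) / 2"
  shows "\<exists>C\<ge>0. \<forall>X\<ge>1. \<bar>diag_sum b c X - (zeta_real \<beta> * zeta_real \<kappa>
      - X powr (1 / (real b + real c)) * X powr (-1/2) / ((1-\<beta>) * (1-\<kappa>))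
      + X powr (1 / (2 * real c) - 1/2) / (1-\<kappa>) * powr_sum (real b / (2 * real c) + 1/2) (X powr (1 / (real b + real c)))
      + X powr (1 / (2 * real b) - 1/2) / (1-\<beta>) * powr_sum (real c / (2 * real b) + 1/2) (X powr (1 / (real b + real c))))\<bar>
      \<le> C * X powr (-1/2)"
proof -
  define C1 C2 where "C1 = 2 * (2 powr (\<kappa>+1) + 1)" "C2 = 2 * (2 powr (\<beta>+1) + 1)"
  define C3 C4 where "C3 = 2 powr (\<beta>+1) + (1::real)" "C4 = 2 powr (\<kappa>+1) + (1::real)"
  define C where "C = C1 + C2 + (2 * C4 + C3 * 2 + C3 * C4)"
  have \<beta>: "\<beta> > 0" "\<beta> \<noteq> 1" "\<beta> \<ge> 3/2" and \<kappa>: "\<kappa> > 0" "\<kappa> \<noteq> 1" "\<kappa> \<ge> 3/2"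
    using bc by (auto simp: \<beta>_def \<kappa>_def)
  have pos: "C1 \<ge> 0" "C2 \<ge> 0" "C3 \<ge> 0" "C4 \<ge> 0" by (auto simp: C1_C2_def C3_C4_def)
  show ?thesis
  proof (intro exI[of _ C] conjI allI impI)
    show "C \<ge> 0" using pos by (simp add: C_def)
    fix X :: real assume X: "X \<ge> 1"
    define P where "P = X powr (1 / (real b + real c))"
    define Q where "Q = X powr (-1/2)"
    define U where "U = X powr (1 / (2 * real c) - 1/2) / (1-\<kappa>) * powr_sum (real b / (2 * real c) + 1/2) P"
    define V where "V = X powr (1 / (2 * real b) - 1/2) / (1-\<beta>) * powr_sum (real c / (2 * real b) + 1/2) P"
    define a k where "a = powr_sum \<beta> P" "k = powr_sum \<kappa> P"
    define u v where "u = P powr (1-\<beta>) / (1-\<beta>)" "v = P powr (1-\<kappa>) / (1-\<kappa>)"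
    define e f where "e = a - (zeta_real \<beta> + u)" "f = k - (zeta_real \<kappa> + v)"
    have P1: "P \<ge> 1" unfolding P_def using X by (intro ge_one_powr_ge_zero) auto
    have s: "\<beta> + \<kappa> - 1 = (real b + real c) / 2" by (simp add: \<beta>_def \<kappa>_def field_simps)
    have PQ: "P powr (1 - \<beta> - \<kappa>) = Q"
    proof -
      have "1 - \<beta> - \<kappa> = - ((real b + real c) / 2)" using s by linarith
      moreover have "real b + real c \<noteq> 0" using bc by simp
      ultimately show ?thesis unfolding P_def Q_def by (simp add: powr_powr)
    qed
    have 1: "\<bar>hyperbola_part b c X - (zeta_real \<kappa> * a + U)\<bar> \<le> C1 * Q"
      using hyperbola_part_asymptotics[OF bc X] unfolding a_k_def U_def P_def Q_def C1_C2_def \<beta>_def \<kappa>_def .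
    have 2: "\<bar>hyperbola_part c b X - (zeta_real \<beta> * k + V)\<bar> \<le> C2 * Q"
      using hyperbola_part_asymptotics[OF bc(2,1) X]
      unfolding a_k_def V_def P_def Q_def C1_C2_def \<beta>_def \<kappa>_def add.commute[of "real c" "real b"] .
    have 3: "diag_sum b c X = hyperbola_part b c X + hyperbola_part c b X - a * k"
      using hyperbola_identity[of b c X] bc X unfolding a_k_def P_def \<beta>_def \<kappa>_def by simp
    have e: "\<bar>e\<bar> \<le> C3 * P powr (-\<beta>)" unfolding e_f_def u_v_def a_k_def C3_C4_def by (rule powr_sum_asymptotics[OF \<beta>(1,2) P1])
    have f: "\<bar>f\<bar> \<le> C4 * P powr (-\<kappa>)" unfolding e_f_def u_v_def a_k_def C3_C4_def by (rule powr_sum_asymptotics[OF \<kappa>(1,2) P1])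
    have half: "\<bar>x powr y / (1 - z)\<bar> \<le> 2 * x powr y" if "z \<ge> 3/2" for x y z :: real
    proof -
      have "\<bar>x powr y / (1 - z)\<bar> = x powr y / (z - 1)" using that by (simp add: abs_divide)
      also have "\<dots> \<le> x powr y / (1/2)" using that by (intro divide_left_mono) auto
      finally show ?thesis by simp
    qed
    have u: "\<bar>u\<bar> \<le> 2 * P powr (1-\<beta>)" and v: "\<bar>v\<bar> \<le> 2 * P powr (1-\<kappa>)"
      unfolding u_v_def by (intro half \<beta> \<kappa>)+
    have uf: "\<bar>u * f\<bar> \<le> 2 * C4 * Q"
    proof -
      have "\<bar>u * f\<bar> \<le> (2 * P powr (1-\<beta>)) * (C4 * P powr (-\<kappa>))"
        unfolding abs_mult using u f pos by (intro mult_mono) auto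
      also have "\<dots> = 2 * C4 * (P powr (1-\<beta>) * P powr (-\<kappa>))" by simp
      also have "P powr (1-\<beta>) * P powr (-\<kappa>) = Q" unfolding PQ[symmetric] by (simp add: powr_add[symmetric])
      finally show ?thesis .
    qed
    have ev: "\<bar>e * v\<bar> \<le> C3 * 2 * Q"
    proof -
      have "\<bar>e * v\<bar> \<le> (C3 * P powr (-\<beta>)) * (2 * P powr (1-\<kappa>))"
        unfolding abs_mult using v e pos by (intro mult_mono) auto
      also have "\<dots> = C3 * 2 * (P powr (-\<beta>) * P powr (1-\<kappa>))" by simp
      also have "P powr (-\<beta>) * P powr (1-\<kappa>) = Q" unfolding PQ[symmetric] by (simp add: powr_add[symmetric] algebra_simps)
      finally show ?thesis .
    qed
    have ef: "\<bar>e * f\<bar> \<le> C3 * C4 * Q"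
    proof -
      have "\<bar>e * f\<bar> \<le> (C3 * P powr (-\<beta>)) * (C4 * P powr (-\<kappa>))"
        unfolding abs_mult using f e pos by (intro mult_mono) auto
      also have "\<dots> = C3 * C4 * (P powr (-\<beta>) * P powr (-\<kappa>))" by simp
      also have "P powr (-\<beta>) * P powr (-\<kappa>) \<le> Q"
        unfolding PQ[symmetric] powr_add[symmetric] using P1 by (intro powr_mono) auto
      finally show ?thesis using pos by (simp add: mult_left_mono)
    qed
    have uv: "P * Q / ((1-\<beta>) * (1-\<kappa>)) = u * v"
    proof -
      have "P * Q = P powr 1 * P powr (1 - \<beta> - \<kappa>)" using P1 PQ by simp
      also have "\<dots> = P powr ((1-\<beta>) + (1-\<kappa>))" unfolding powr_add[symmetric] by (simp add: algebra_simps)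
      also have "\<dots> = P powr (1-\<beta>) * P powr (1-\<kappa>)" by (rule powr_add)
      finally show ?thesis by (simp add: u_v_def)
    qed
    have "diag_sum b c X - (zeta_real \<beta> * zeta_real \<kappa> - P * Q / ((1-\<beta>) * (1-\<kappa>)) + U + V)
       = (hyperbola_part b c X - (zeta_real \<kappa> * a + U)) + (hyperbola_part c b X - (zeta_real \<beta> * k + V)) - (u * f + e * v + e * f)"
      unfolding 3 uv e_f_def by (simp add: algebra_simps)
    then have "\<bar>diag_sum b c X - (zeta_real \<beta> * zeta_real \<kappa> - P * Q / ((1-\<beta>) * (1-\<kappa>)) + U + V)\<bar>
       \<le> C1 * Q + C2 * Q + (2 * C4 * Q + C3 * 2 * Q + C3 * C4 * Q)"
      using 1 2 abs_sum3_le[OF uf ev ef] by linarith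
    also have "\<dots> = C * Q" by (simp add: C_def algebra_simps)
    finally show "\<bar>diag_sum b c X - (zeta_real \<beta> * zeta_real \<kappa>
      - X powr (1 / (real b + real c)) * X powr (-1/2) / ((1-\<beta>) * (1-\<kappa>))
      + X powr (1 / (2 * real c) - 1/2) / (1-\<kappa>) * powr_sum (real b / (2 * real c) + 1/2) (X powr (1 / (real b + real c)))
      + X powr (1 / (2 * real b) - 1/2) / (1-\<beta>) * powr_sum (real c / (2 * real b) + 1/2) (X powr (1 / (real b + real c))))\<bar>
      \<le> C * X powr (-1/2)"
      unfolding U_def V_def P_def Q_def .
  qed
qed

text \<open>Here rho = 1 would mean b = c, which is why that case is treated separately. As P^rho =
  X^(1/(2c)), the tail term is again a multiple of P X^(-1/2), and the error is O(X^(-1/2)).\<close>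

lemma weighted_powr_sum_asymptotics:
  assumes bc: "2 \<le> b" "2 \<le> c" "b \<noteq> c" and X: "X \<ge> 1"
  defines "\<kappa> \<equiv> (1 + real c) / 2" and "\<rho> \<equiv> real b / (2 * real c) + 1/2"
    and "P \<equiv> X powr (1 / (real b + real c))"
  shows "\<bar>X powr (1 / (2 * real c) - 1/2) / (1-\<kappa>) * powr_sum \<rho> P
      - (X powr (1 / (2 * real c) - 1/2) / (1-\<kappa>) * zeta_real \<rho> + P * X powr (-1/2) / ((1-\<kappa>) * (1-\<rho>)))\<bar>
      \<le> 2 * (2 powr (\<rho>+1) + 1) * X powr (-1/2)"
proof -
  define Y where "Y = X powr (1 / (2 * real c) - 1/2)"
  have c0: "real c > 0" "real b > 0" "real b + real c > 0" using bc by auto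
  have P1: "P \<ge> 1" unfolding P_def using X by (intro ge_one_powr_ge_zero) auto
  have \<rho>: "\<rho> > 0" "\<rho> \<noteq> 1"
    using bc by (auto simp: \<rho>_def add_pos_pos field_simps)
  have \<kappa>: "\<kappa> \<ge> 3/2" using bc by (simp add: \<kappa>_def)
  have "\<rho> = 1 / (2 * real c) * (real b + real c)" using c0 by (simp add: \<rho>_def field_simps)
  then have r: "\<rho> / (real b + real c) = 1 / (2 * real c)" using c0 by simp
  have Y\<rho>: "Y * P powr (-\<rho>) = X powr (-1/2)"
  proof -
    have "P powr (-\<rho>) = X powr (-(1 / (2 * real c)))" unfolding P_def powr_powr using r by simp
    then show ?thesis unfolding Y_def by (simp add: powr_add[symmetric])
  qed
  have Y1: "Y * P powr (1-\<rho>) = P * X powr (-1/2)"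
  proof -
    have "P powr (1-\<rho>) = P * P powr (-\<rho>)" using P1 powr_add[of P 1 "-\<rho>"] by simp
    then show ?thesis using Y\<rho> by (metis mult.left_commute)
  qed
  define e where "e = powr_sum \<rho> P - (zeta_real \<rho> + P powr (1-\<rho>) / (1-\<rho>))"
  have e: "\<bar>e\<bar> \<le> (2 powr (\<rho>+1) + 1) * P powr (-\<rho>)" unfolding e_def by (rule powr_sum_asymptotics[OF \<rho> P1])
  have "Y / (1-\<kappa>) * powr_sum \<rho> P - (Y / (1-\<kappa>) * zeta_real \<rho> + (Y * P powr (1-\<rho>)) / ((1-\<kappa>) * (1-\<rho>))) = Y / (1-\<kappa>) * e"
    unfolding e_def by (simp add: right_diff_distrib distrib_left)
  moreover have "\<bar>Y / (1-\<kappa>) * e\<bar> \<le> 2 * Y * ((2 powr (\<rho>+1) + 1) * P powr (-\<rho>))"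
    unfolding abs_mult
  proof (intro mult_mono e)
    have "\<bar>Y / (1-\<kappa>)\<bar> = Y / (\<kappa> - 1)" using \<kappa> by (simp add: abs_divide Y_def)
    also have "\<dots> \<le> Y / (1/2)" using \<kappa> by (intro divide_left_mono) (auto simp: Y_def)
    finally show "\<bar>Y / (1-\<kappa>)\<bar> \<le> 2 * Y" by simp
  qed (auto simp: Y_def)
  moreover have "2 * Y * ((2 powr (\<rho>+1) + 1) * P powr (-\<rho>)) = 2 * (2 powr (\<rho>+1) + 1) * X powr (-1/2)"
    unfolding Y\<rho>[symmetric] by simp
  ultimately show ?thesis unfolding Y1 Y_def[symmetric] by simp
qed

lemma combine_expansions:
  fixes A :: real
  assumes "\<bar>A - (z - p + u + v)\<bar> \<le> x" "\<bar>u - (k + q)\<bar> \<le> y" "\<bar>v - (l + r)\<bar> \<le> w"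
    "- p + q + r = 0" "k = - k'" "l = - l'"
  shows "\<bar>A - (z - k' - l')\<bar> \<le> x + y + w"
  using assms by linarith

lemma diag_sum_asymptotics_neq:
  assumes bc: "2 \<le> b" "2 \<le> c" "b \<noteq> c"
  shows "\<exists>C\<ge>0. \<forall>X\<ge>1. \<bar>diag_sum b c X - (zeta_real ((1 + real b) / 2) * zeta_real ((1 + real c) / 2)
      - 2 / (real c - 1) * zeta_real (real b / (2 * real c) + 1/2) * X powr (1 / (2 * real c) - 1/2)
      - 2 / (real b - 1) * zeta_real (real c / (2 * real b) + 1/2) * X powr (1 / (2 * real b) - 1/2))\<bar>
      \<le> C * X powr (-1/2)"
proof -
  define \<beta> \<kappa> where "\<beta> = (1 + real b) / 2" "\<kappa> = (1 + real c) / 2"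
  define \<rho> \<rho>' where "\<rho> = real b / (2 * real c) + 1/2" "\<rho>' = real c / (2 * real b) + 1/2"
  obtain C0 where C0: "C0 \<ge> 0" "\<And>X. X \<ge> 1 \<Longrightarrow> \<bar>diag_sum b c X - (zeta_real \<beta> * zeta_real \<kappa>
      - X powr (1 / (real b + real c)) * X powr (-1/2) / ((1-\<beta>) * (1-\<kappa>))
      + X powr (1 / (2 * real c) - 1/2) / (1-\<kappa>) * powr_sum \<rho> (X powr (1 / (real b + real c)))
      + X powr (1 / (2 * real b) - 1/2) / (1-\<beta>) * powr_sum \<rho>' (X powr (1 / (real b + real c))))\<bar>
      \<le> C0 * X powr (-1/2)"
    using diag_sum_expansion[OF bc(1,2)] unfolding \<beta>_\<kappa>_def \<rho>_\<rho>'_def by blast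
  define C where "C = C0 + 2 * (2 powr (\<rho>+1) + 1) + 2 * (2 powr (\<rho>'+1) + 1)"
  show ?thesis
  proof (intro exI[of _ C] conjI allI impI)
    show "C \<ge> 0" using C0(1) by (simp add: C_def)
    fix X :: real assume X: "X \<ge> 1"
    define P where "P = X powr (1 / (real b + real c))"
    define Q where "Q = X powr (-1/2)"
    define Y Z where "Y = X powr (1 / (2 * real c) - 1/2)" "Z = X powr (1 / (2 * real b) - 1/2)"
    have 0: "\<bar>diag_sum b c X - (zeta_real \<beta> * zeta_real \<kappa> - P * Q / ((1-\<beta>) * (1-\<kappa>))
         + Y / (1-\<kappa>) * powr_sum \<rho> P + Z / (1-\<beta>) * powr_sum \<rho>' P)\<bar> \<le> C0 * Q"
      using C0(2)[OF X] unfolding P_def Q_def Y_Z_def .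
    have 1: "\<bar>Y / (1-\<kappa>) * powr_sum \<rho> P - (Y / (1-\<kappa>) * zeta_real \<rho> + P * Q / ((1-\<kappa>) * (1-\<rho>)))\<bar>
        \<le> 2 * (2 powr (\<rho>+1) + 1) * Q"
      using weighted_powr_sum_asymptotics[OF bc X] unfolding \<beta>_\<kappa>_def \<rho>_\<rho>'_def P_def Q_def Y_Z_def .
    have 2: "\<bar>Z / (1-\<beta>) * powr_sum \<rho>' P - (Z / (1-\<beta>) * zeta_real \<rho>' + P * Q / ((1-\<beta>) * (1-\<rho>')))\<bar>
        \<le> 2 * (2 powr (\<rho>'+1) + 1) * Q"
      using weighted_powr_sum_asymptotics[OF bc(2,1) bc(3)[symmetric] X]
      unfolding \<beta>_\<kappa>_def \<rho>_\<rho>'_def P_def Q_def Y_Z_def add.commute[of "real c" "real b"] .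
    \<comment> \<open>The three terms of order P X^(-1/2) come from the place where the hyperbola is
      cut and must cancel. With x = b and y = c this is the identity -1/((x-1)(y-1)) +
      y/((y-1)(x-y)) - x/((x-1)(x-y)) = 0.\<close>
    have zero: "- (P * Q / ((1-\<beta>) * (1-\<kappa>))) + P * Q / ((1-\<kappa>) * (1-\<rho>)) + P * Q / ((1-\<beta>) * (1-\<rho>')) = 0"
    proof -
      define x y where "x = real b" "y = real c"
      have xy: "x > 1" "y > 1" "x \<noteq> y" using bc by (auto simp: x_y_def)
      have "1 / ((1-\<beta>) * (1-\<kappa>)) = 4 / ((x-1) * (y-1))"
        using xy by (simp add: \<beta>_\<kappa>_def x_y_def[symmetric] divide_simps) (simp add: algebra_simps)
      moreover have "1 / ((1-\<kappa>) * (1-\<rho>)) = 4 * y / ((y-1) * (x-y))"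
        using xy by (simp add: \<beta>_\<kappa>_def \<rho>_\<rho>'_def x_y_def[symmetric] divide_simps) (simp add: algebra_simps)
      moreover have "1 / ((1-\<beta>) * (1-\<rho>')) = - (4 * x / ((x-1) * (x-y)))"
        using xy by (simp add: \<beta>_\<kappa>_def \<rho>_\<rho>'_def x_y_def[symmetric] divide_simps) (simp add: algebra_simps)
      moreover have "- (4 / ((x-1) * (y-1))) + 4 * y / ((y-1) * (x-y)) + - (4 * x / ((x-1) * (x-y))) = 0"
        using xy by (simp add: divide_simps) (simp add: algebra_simps)
      ultimately have "P * Q * (- (1 / ((1-\<beta>) * (1-\<kappa>))) + 1 / ((1-\<kappa>) * (1-\<rho>)) + 1 / ((1-\<beta>) * (1-\<rho>'))) = 0"
        by simp
      then show ?thesis by (simp add: distrib_left right_diff_distrib)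
    qed
    have k: "1 / (1-\<kappa>) = - (2 / (real c - 1))" and b: "1 / (1-\<beta>) = - (2 / (real b - 1))"
      using bc by (auto simp: \<beta>_\<kappa>_def divide_simps)
    have K: "Y / (1-\<kappa>) * zeta_real \<rho> = - (2 / (real c - 1) * zeta_real \<rho> * Y)"
      using arg_cong[OF k, of "\<lambda>x. Y * x * zeta_real \<rho>"] by simp
    have B: "Z / (1-\<beta>) * zeta_real \<rho>' = - (2 / (real b - 1) * zeta_real \<rho>' * Z)"
      using arg_cong[OF b, of "\<lambda>x. Z * x * zeta_real \<rho>'"] by simp
    have "\<bar>diag_sum b c X - (zeta_real \<beta> * zeta_real \<kappa> - 2 / (real c - 1) * zeta_real \<rho> * Y
        - 2 / (real b - 1) * zeta_real \<rho>' * Z)\<bar>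
       \<le> C0 * Q + 2 * (2 powr (\<rho>+1) + 1) * Q + 2 * (2 powr (\<rho>'+1) + 1) * Q"
      by (rule combine_expansions[OF 0 1 2 zero K B])
    also have "\<dots> = C * Q" by (simp add: C_def algebra_simps)
    finally show "\<bar>diag_sum b c X - (zeta_real ((1 + real b) / 2) * zeta_real ((1 + real c) / 2)
      - 2 / (real c - 1) * zeta_real (real b / (2 * real c) + 1/2) * X powr (1 / (2 * real c) - 1/2)
      - 2 / (real b - 1) * zeta_real (real c / (2 * real b) + 1/2) * X powr (1 / (2 * real b) - 1/2))\<bar>
      \<le> C * X powr (-1/2)"
      unfolding \<beta>_\<kappa>_def \<rho>_\<rho>'_def Q_def Y_Z_def .
  qed
qed

lemma double_expansion:
  fixes A :: real
  assumes "\<bar>A - (z - p + (- q + e) + (- q + e))\<bar> \<le> x" "\<bar>e\<bar> \<le> y"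
  shows "\<bar>A - (z - (p + 2 * q))\<bar> \<le> x + y + y"
  using assms by linarith

text \<open>Now rho = 1, and the harmonic sum up to P brings in ln P = (ln X)/(2b) and Euler's
  constant. Since P = X^(1/(2b)), the term P X^(-1/2)/(1-beta)^2 has the order of the secondary
  term; nothing cancels it, and it supplies 4/(b-1)^2 in \<open>E0\<close>.\<close>

lemma diag_sum_asymptotics_eq:
  assumes b: "2 \<le> b"
  shows "\<exists>C\<ge>0. \<forall>X\<ge>1. \<bar>diag_sum b b X - (zeta_real ((1 + real b) / 2) * zeta_real ((1 + real b) / 2)
      - X powr (1 / (2 * real b) - 1/2) * (E1 b * ln X + E0 b))\<bar> \<le> C * X powr (-1/2)"
proof -
  define \<beta> where "\<beta> = (1 + real b) / 2"
  obtain C0 where C0: "C0 \<ge> 0" "\<And>X. X \<ge> 1 \<Longrightarrow> \<bar>diag_sum b b X - (zeta_real \<beta> * zeta_real \<beta>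
      - X powr (1 / (real b + real b)) * X powr (-1/2) / ((1-\<beta>) * (1-\<beta>))
      + X powr (1 / (2 * real b) - 1/2) / (1-\<beta>) * powr_sum (real b / (2 * real b) + 1/2) (X powr (1 / (real b + real b)))
      + X powr (1 / (2 * real b) - 1/2) / (1-\<beta>) * powr_sum (real b / (2 * real b) + 1/2) (X powr (1 / (real b + real b))))\<bar>
      \<le> C0 * X powr (-1/2)"
    using diag_sum_expansion[OF b b] unfolding \<beta>_def by blast
  have b0: "real b > 1" using b by simp
  show ?thesis
  proof (intro exI[of _ "C0 + 8"] conjI allI impI)
    show "C0 + 8 \<ge> 0" using C0(1) by simp
    fix X :: real assume X: "X \<ge> 1"
    define P where "P = X powr (1 / (2 * real b))"
    define Q where "Q = X powr (-1/2)"
    define Y where "Y = X powr (1 / (2 * real b) - 1/2)"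
    have P1: "P \<ge> 1" unfolding P_def using X by (intro ge_one_powr_ge_zero) auto
    have PQ: "P * Q = Y" unfolding P_def Q_def Y_def by (simp add: powr_add[symmetric])
    have half: "real b / (2 * real b) + 1/2 = 1" using b0 by simp
    have 0: "\<bar>diag_sum b b X - (zeta_real \<beta> * zeta_real \<beta> - Y / ((1-\<beta>) * (1-\<beta>))
         + Y / (1-\<beta>) * powr_sum 1 P + Y / (1-\<beta>) * powr_sum 1 P)\<bar> \<le> C0 * Q"
      using C0(2)[OF X] unfolding half mult_2[symmetric] P_def[symmetric] Q_def[symmetric] Y_def[symmetric] PQ .
    define e where "e = powr_sum 1 P - (ln P + euler_mascheroni)"
    have e: "\<bar>e\<bar> \<le> 2 / P" unfolding e_def by (rule powr_sum_one_asymptotics[OF P1])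
    have inv: "1 / (1-\<beta>) = - (2 / (real b - 1))" using b0 by (simp add: \<beta>_def divide_simps)
    have Ye: "\<bar>Y / (1-\<beta>) * e\<bar> \<le> 4 * Q"
    proof -
      have "\<bar>Y / (1-\<beta>)\<bar> = Y / (\<beta> - 1)" using b0 by (simp add: \<beta>_def Y_def)
      also have "\<dots> \<le> Y / (1/2)" using b by (intro divide_left_mono) (auto simp: \<beta>_def Y_def)
      finally have "\<bar>Y / (1-\<beta>)\<bar> \<le> 2 * Y" by simp
      then have "\<bar>Y / (1-\<beta>) * e\<bar> \<le> 2 * Y * (2 / P)"
        unfolding abs_mult using e by (intro mult_mono) (auto simp: Y_def)
      also have "\<dots> = 4 * Q" using P1 unfolding PQ[symmetric] by simp
      finally show ?thesis .
    qed
    have lnP: "ln P = ln X / (2 * real b)" using X by (simp add: P_def ln_powr)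
    have "Y / ((1-\<beta>) * (1-\<beta>)) = Y * (1 / (1-\<beta>)) * (1 / (1-\<beta>))" by simp
    then have 1: "Y / ((1-\<beta>) * (1-\<beta>)) = Y * (4 / (real b - 1)^2)"
      unfolding inv by (simp add: power2_eq_square)
    have 2: "Y / (1-\<beta>) * powr_sum 1 P = - (Y * (2 / (real b - 1) * (ln X / (2 * real b) + euler_mascheroni))) + Y / (1-\<beta>) * e"
    proof -
      have "Y / (1-\<beta>) * powr_sum 1 P = Y * (1 / (1-\<beta>)) * (ln P + euler_mascheroni) + Y / (1-\<beta>) * e"
        unfolding e_def by (simp add: right_diff_distrib distrib_left add_divide_distrib)
      then show ?thesis unfolding inv lnP by simp
    qed
    have 3: "Y * (E1 b * ln X + E0 b) = Y * (4 / (real b - 1)^2) 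
        + 2 * (Y * (2 / (real b - 1) * (ln X / (2 * real b) + euler_mascheroni)))"
    proof -
      have "E1 b * ln X + E0 b = 4 / (real b - 1)^2 + 2 * (2 / (real b - 1) * (ln X / (2 * real b) + euler_mascheroni))"
        using b0 by (simp add: E1_def E0_def distrib_left)
      moreover have "Y * (x + 2 * y) = Y * x + 2 * (Y * y)" for x y by (simp add: distrib_left)
      ultimately show ?thesis by (simp only:)
    qed
    have "\<bar>diag_sum b b X - (zeta_real \<beta> * zeta_real \<beta> - Y * (E1 b * ln X + E0 b))\<bar> \<le> C0 * Q + 4 * Q + 4 * Q"
      using double_expansion[OF 0[unfolded 1 2] Ye] unfolding 3 .
    then show "\<bar>diag_sum b b X - (zeta_real ((1 + real b) / 2) * zeta_real ((1 + real b) / 2)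
      - X powr (1 / (2 * real b) - 1/2) * (E1 b * ln X + E0 b))\<bar> \<le> (C0 + 8) * X powr (-1/2)"
      unfolding Y_def Q_def \<beta>_def by (simp add: distrib_right)
  qed
qed

section \<open>Integration over the height\<close>

definition cutoff :: "real \<Rightarrow> real \<Rightarrow> real" where
  "cutoff \<theta> t = (t / (2 * pi)) powr \<theta>"

definition cutoff_time :: "real \<Rightarrow> nat \<Rightarrow> real" where
  "cutoff_time \<theta> n = 2 * pi * real n powr (1 / \<theta>)"

lemma le_cutoff_iff:
  assumes "0 < \<theta>" "0 \<le> t"
  shows "real n \<le> cutoff \<theta> t \<longleftrightarrow> cutoff_time \<theta> n \<le> t"
proof
  assume "real n \<le> cutoff \<theta> t"
  then have "real n powr (1/\<theta>) \<le> cutoff \<theta> t powr (1/\<theta>)" using assms by (intro powr_mono2) auto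
  also have "\<dots> = t / (2 * pi)" using assms by (simp add: cutoff_def powr_powr)
  finally show "cutoff_time \<theta> n \<le> t" by (simp add: cutoff_time_def field_simps)
next
  assume "cutoff_time \<theta> n \<le> t"
  then have "real n powr (1/\<theta>) \<le> t / (2 * pi)" by (simp add: cutoff_time_def field_simps)
  then have "(real n powr (1/\<theta>)) powr \<theta> \<le> cutoff \<theta> t"
    unfolding cutoff_def using assms by (intro powr_mono2) auto
  then show "real n \<le> cutoff \<theta> t" using assms by (simp add: powr_powr)
qed

lemma cutoff_set_eq: "{n. 1 \<le> n \<and> real n \<le> cutoff \<theta> t} = {1..nat \<lfloor>cutoff \<theta> t\<rfloor>}"
  by (auto simp: le_nat_iff le_floor_iff cutoff_def)

lemma cutoff_time_ge:
  assumes "0 < \<theta>" "\<theta> < 1" "1 \<le> n"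
  shows "1 \<le> cutoff_time \<theta> n" "real n \<le> cutoff_time \<theta> n"
proof -
  have "real n powr 1 \<le> real n powr (1/\<theta>)" using assms by (intro powr_mono) auto
  then have "1 * real n \<le> (2 * pi) * real n powr (1/\<theta>)"
    using pi_gt3 assms by (intro mult_mono) auto
  then show "real n \<le> cutoff_time \<theta> n" by (simp add: cutoff_time_def)
  then show "1 \<le> cutoff_time \<theta> n" using assms by linarith
qed

text \<open>The index n takes part exactly when t >= tau_n, so a sum whose range moves with t
  becomes a fixed finite sum of integrands cut off outside [tau_n, T].\<close>

lemma has_integral_cutoff_sum:
  fixes g :: "nat \<Rightarrow> real \<Rightarrow> 'a::banach"
  assumes \<theta>: "0 < \<theta>" and T: "0 \<le> T"
    and g: "\<And>n. n \<in> {1..nat \<lfloor>cutoff \<theta> T\<rfloor>} \<Longrightarrow> g n integrable_on {cutoff_time \<theta> n..T}"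
  shows "((\<lambda>t. \<Sum>n\<in>{n. 1 \<le> n \<and> real n \<le> cutoff \<theta> t}. g n t) has_integral
     (\<Sum>n=1..nat \<lfloor>cutoff \<theta> T\<rfloor>. integral {cutoff_time \<theta> n..T} (g n))) {0..T}"
proof -
  let ?N = "nat \<lfloor>cutoff \<theta> T\<rfloor>" and ?\<tau> = "cutoff_time \<theta>"
  have \<tau>0: "0 \<le> ?\<tau> n" for n by (simp add: cutoff_time_def)
  have "((\<lambda>t. \<Sum>n=1..?N. if t \<in> {?\<tau> n..T} then g n t else 0) has_integral
     (\<Sum>n=1..?N. integral {?\<tau> n..T} (g n))) {0..T}"
  proof (intro has_integral_sum)
    fix n assume n: "n \<in> {1..?N}"
    have sub: "{?\<tau> n..T} \<subseteq> {0..T}" using \<tau>0[of n] by auto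
    show "((\<lambda>t. if t \<in> {?\<tau> n..T} then g n t else 0) has_integral integral {?\<tau> n..T} (g n)) {0..T}"
      using g[OF n] unfolding has_integral_restrict[OF sub] by (rule integrable_integral)
  qed auto
  moreover have "(\<Sum>n\<in>{n. 1 \<le> n \<and> real n \<le> cutoff \<theta> t}. g n t) = (\<Sum>n=1..?N. if t \<in> {?\<tau> n..T} then g n t else 0)"
    if t: "t \<in> {0..T}" for t
  proof -
    have "{n. 1 \<le> n \<and> real n \<le> cutoff \<theta> t} \<subseteq> {1..?N}"
    proof -
      have "cutoff \<theta> t \<le> cutoff \<theta> T" unfolding cutoff_def using t \<theta> by (intro powr_mono2 divide_right_mono) auto
      then have "{n. 1 \<le> n \<and> real n \<le> cutoff \<theta> t} \<subseteq> {n. 1 \<le> n \<and> real n \<le> cutoff \<theta> T}" by auto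
      then show ?thesis unfolding cutoff_set_eq .
    qed
    then show ?thesis
      using t le_cutoff_iff[OF \<theta>, of t] by (intro sum.mono_neutral_cong_left) auto
  qed
  ultimately show ?thesis by (rule has_integral_cong[THEN iffD2, rotated -1])
qed

lemma M1_eq_shift:
  assumes \<theta>: "0 < \<theta>" "\<theta> < 1" and bc: "b \<ge> 2" "c \<ge> 2" and T: "0 \<le> T"
  shows "M1 \<theta> b c T = (\<Sum>n=1..nat \<lfloor>cutoff \<theta> T\<rfloor>. integral {cutoff_time \<theta> n..T} (\<lambda>t. shift_integrand b c n (Complex 0 t)))"
proof -
  have \<tau>: "cutoff_time \<theta> n \<le> T" if "n \<in> {1..nat \<lfloor>cutoff \<theta> T\<rfloor>}" for n
    using that le_cutoff_iff[OF \<theta>(1) T, of n] cutoff_set_eq[of \<theta> T] by blast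
  have "((\<lambda>t. \<Sum>n\<in>{n. 1 \<le> n \<and> real n \<le> cutoff \<theta> t}. shift_integrand b c n (Complex 0 t)) has_integral
     (\<Sum>n=1..nat \<lfloor>cutoff \<theta> T\<rfloor>. integral {cutoff_time \<theta> n..T} (\<lambda>t. shift_integrand b c n (Complex 0 t)))) {0..T}"
    using \<theta> T \<tau> cutoff_time_ge[OF \<theta>] 
    by (intro has_integral_cutoff_sum shift_integral_bound(1) bc) auto
  moreover have "(\<Sum>n\<in>{n. 1 \<le> n \<and> real n \<le> cutoff \<theta> t}. shift_integrand b c n (Complex 0 t)) =
     Dpoly \<theta> (1/2) t * riemann_zeta (1/2 - \<i> * of_real (real b * t)) * riemann_zeta (1/2 - \<i> * of_real (real c * t))" for t
  proof -
    have i: "Complex 0 t = \<i> * of_real t" by (simp add: complex_eq_iff)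
    have z: "riemann_zeta (1/2 - \<i> * of_real (real b * t)) = zeta_cont (1/2 - of_nat b * Complex 0 t)" for b
    proof -
      have "riemann_zeta (1/2 - \<i> * of_real (real b * t)) = zeta_cont (1/2 - \<i> * of_real (real b * t))"
        by (rule riemann_zeta_eq) (auto simp: complex_eq_iff)
      then show ?thesis by (simp add: i mult_ac)
    qed
    have "-1/2 - Complex 0 t = - (complex_of_real (1/2) + \<i> * of_real t)" by (simp add: i)
    then show ?thesis
      unfolding Dpoly_def cutoff_def[symmetric] z shift_integrand_def
      by (simp only: sum_distrib_right mult.assoc)
  qed
  ultimately show ?thesis
    unfolding M1_def by (simp add: integral_unique)
qed

lemma sum_sqrt_divide_le:
  assumes "T \<ge> 0"
  shows "(\<Sum>n=1..N. sqrt (T / real n)) \<le> 2 * sqrt T * sqrt (real N)"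
proof -
  have "(\<Sum>n=1..N. sqrt (T / real n)) = sqrt T * (\<Sum>n=1..N. 1 / sqrt (real n))"
    by (simp add: sum_distrib_left real_sqrt_divide)
  also have "\<dots> \<le> sqrt T * (2 * sqrt (real N))"
    using assms by (intro mult_left_mono sum_inverse_sqrt_le) auto
  finally show ?thesis by simp
qed

lemma cutoff_le_powr:
  assumes "0 < \<theta>" "0 \<le> t"
  shows "cutoff \<theta> t \<le> t powr \<theta>"
proof -
  have "t / (2 * pi) \<le> t / 1" using assms pi_gt3 by (intro divide_left_mono) auto
  then show ?thesis unfolding cutoff_def using assms by (intro powr_mono2) auto
qed

lemma M1_diagonal_bound:
  assumes \<theta>: "0 < \<theta>" "\<theta> < 1" and bc: "b \<ge> 2" "c \<ge> 2"
  shows "\<exists>C\<ge>0. \<forall>T\<ge>2 * pi. norm (M1 \<theta> b c T -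
      of_real (\<Sum>n=1..nat \<lfloor>cutoff \<theta> T\<rfloor>. (T - cutoff_time \<theta> n) * diag_coeff b c n))
      \<le> C * T powr (1/2 + \<theta>/2)"
proof -
  \<comment> \<open>\<open>\<delta>\<close> absorbs the logarithm of the oscillating terms: ln T is
    O(T^delta), and theta + delta = 1/2 + theta/2.\<close>
  define \<delta> where "\<delta> = (1 - \<theta>) / 2"
  have \<delta>: "\<delta> > 0" using \<theta> by (simp add: \<delta>_def)
  define A where "A = (514 * real b) * (514 * real c)"
  define C where "C = 2 * A + 1152 * (2 + 1/\<delta>)"
  have A0: "A \<ge> 0" by (simp add: A_def)
  show ?thesis
  proof (intro exI[of _ C] conjI allI impI)
    show "C \<ge> 0" using A0 \<delta> by (simp add: C_def)
    fix T :: real assume T: "2 * pi \<le> T"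
    have T1: "T \<ge> 1" using T pi_gt3 by simp
    let ?N = "nat \<lfloor>cutoff \<theta> T\<rfloor>" and ?\<tau> = "cutoff_time \<theta>"
    have \<tau>: "1 \<le> ?\<tau> n" "real n \<le> ?\<tau> n" "?\<tau> n \<le> T" "0 < n" if n: "n \<in> {1..?N}" for n
    proof -
      have "real n \<le> cutoff \<theta> T" using n cutoff_set_eq[of \<theta> T] by blast
      then show "?\<tau> n \<le> T" using le_cutoff_iff[OF \<theta>(1)] T1 by simp
      show "1 \<le> ?\<tau> n" "real n \<le> ?\<tau> n" "0 < n" using cutoff_time_ge[OF \<theta>] n by auto
    qed
    have N1: "0 < ?N"
    proof -
      have "1 \<le> cutoff \<theta> T" unfolding cutoff_def using T \<theta> by (intro ge_one_powr_ge_zero) auto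
      then show ?thesis by (simp add: le_floor_iff)
    qed
    have NT: "real ?N \<le> T powr \<theta>"
    proof -
      have "real ?N = of_int \<lfloor>cutoff \<theta> T\<rfloor>" by (simp add: cutoff_def)
      also have "\<dots> \<le> cutoff \<theta> T" by simp
      also have "\<dots> \<le> T powr \<theta>" using T1 by (intro cutoff_le_powr \<theta>) auto
      finally show ?thesis .
    qed
    let ?L = "\<Sum>n=1..?N. integral {?\<tau> n..T} (\<lambda>t. shift_integrand b c n (Complex (-1/2) t))"
    have 1: "norm (M1 \<theta> b c T - ?L) \<le> 2 * A * T powr (1/2 + \<theta>/2)"
    proof -
      have "M1 \<theta> b c T - ?L = (\<Sum>n=1..?N. integral {?\<tau> n..T} (\<lambda>t. shift_integrand b c n (Complex 0 t))
          - integral {?\<tau> n..T} (\<lambda>t. shift_integrand b c n (Complex (-1/2) t)))"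
        using M1_eq_shift[OF \<theta> bc, of T] T1 by (simp add: sum_subtractf)
      also have "norm \<dots> \<le> (\<Sum>n=1..?N. A * sqrt (T / real n))"
        unfolding A_def using \<tau> by (intro sum_norm_le shift_integral_bound(3) bc) auto
      also have "\<dots> = A * (\<Sum>n=1..?N. sqrt (T / real n))" by (simp add: sum_distrib_left)
      also have "\<dots> \<le> A * (2 * sqrt T * sqrt (real ?N))"
        using T1 A0 by (intro mult_left_mono sum_sqrt_divide_le) auto
      also have "\<dots> \<le> A * (2 * sqrt T * sqrt (T powr \<theta>))"
        using T1 A0 NT by (intro mult_left_mono) auto
      also have "sqrt (T powr \<theta>) = T powr (\<theta>/2)"
        using T1 by (simp add: powr_half_sqrt[symmetric] powr_powr)
      also have "sqrt T = T powr (1/2)" using T1 by (simp add: powr_half_sqrt)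
      also have "A * (2 * T powr (1/2) * T powr (\<theta>/2)) = 2 * A * T powr (1/2 + \<theta>/2)"
        by (simp add: powr_add)
      finally show ?thesis .
    qed
    have 2: "norm (?L - of_real (\<Sum>n=1..?N. (T - ?\<tau> n) * diag_coeff b c n)) \<le> 1152 * (2 + 1/\<delta>) * T powr (1/2 + \<theta>/2)"
    proof -
      have "norm (?L - of_real (\<Sum>n=1..?N. (T - ?\<tau> n) * diag_coeff b c n)) \<le> 1152 * real ?N * (1 + ln (2 * real ?N))"
        using \<tau> by (intro left_edge_integral bc N1) auto
      also have "\<dots> \<le> 1152 * T powr \<theta> * ((2 + 1/\<delta>) * T powr \<delta>)"
      proof (intro mult_mono)
        have TN: "real ?N \<le> T" 
        proof -
          have "T powr \<theta> \<le> T powr 1" using T1 \<theta> by (intro powr_mono) auto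
          then show ?thesis using NT T1 by simp
        qed
        have "ln (2 * real ?N) \<le> ln (2 * T)" using N1 TN T1 by (subst ln_le_cancel_iff) auto
        also have "\<dots> = ln 2 + ln T" using T1 by (simp add: ln_mult)
        also have "\<dots> \<le> 1 + T powr \<delta> / \<delta>"
          using ln_2_less_1 ln_powr_bound[OF T1 \<delta>] by (intro add_mono) auto
        finally have "1 + ln (2 * real ?N) \<le> 2 * 1 + T powr \<delta> / \<delta>" by simp
        also have "\<dots> \<le> 2 * T powr \<delta> + T powr \<delta> / \<delta>"
          using ge_one_powr_ge_zero[OF T1, of \<delta>] \<delta> by simp
        also have "\<dots> = (2 + 1/\<delta>) * T powr \<delta>" by (simp add: distrib_right)
        finally show "1 + ln (2 * real ?N) \<le> (2 + 1/\<delta>) * T powr \<delta>" .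
        have "real (Suc 0) \<le> real ?N" using N1 by (intro of_nat_mono Suc_leI)
        then have "1 \<le> 2 * real ?N" by linarith
        from ln_ge_zero[OF this] show "0 \<le> 1 + ln (2 * real ?N)" by linarith
      qed (use NT in auto)
      also have "\<dots> = 1152 * (2 + 1/\<delta>) * (T powr \<theta> * T powr \<delta>)" by simp
      also have "T powr \<theta> * T powr \<delta> = T powr (1/2 + \<theta>/2)"
        by (simp add: powr_add[symmetric] \<delta>_def field_simps)
      finally show ?thesis .
    qed
    have "norm (M1 \<theta> b c T - of_real (\<Sum>n=1..?N. (T - ?\<tau> n) * diag_coeff b c n)) \<le>
       2 * A * T powr (1/2 + \<theta>/2) + 1152 * (2 + 1/\<delta>) * T powr (1/2 + \<theta>/2)"
      using norm_triangle_ineq[of "M1 \<theta> b c T - ?L" "?L - of_real (\<Sum>n=1..?N. (T - ?\<tau> n) * diag_coeff b c n)"] 1 2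
      by simp
    then show "norm (M1 \<theta> b c T - of_real (\<Sum>n=1..?N. (T - ?\<tau> n) * diag_coeff b c n)) \<le> C * T powr (1/2 + \<theta>/2)"
      by (simp add: C_def distrib_right)
  qed
qed

text \<open>Each n is present from tau_n to T, so weighting its coefficient by T - tau_n amounts to
  integrating the summatory function.\<close>

lemma has_integral_diag_sum:
  assumes "0 < \<theta>" "0 \<le> T"
  shows "((\<lambda>t. diag_sum b c (cutoff \<theta> t)) has_integral
     (\<Sum>n=1..nat \<lfloor>cutoff \<theta> T\<rfloor>. (T - cutoff_time \<theta> n) * diag_coeff b c n)) {0..T}"
proof -
  have "((\<lambda>t. \<Sum>n\<in>{n. 1 \<le> n \<and> real n \<le> cutoff \<theta> t}. diag_coeff b c n) has_integral
     (\<Sum>n=1..nat \<lfloor>cutoff \<theta> T\<rfloor>. integral {cutoff_time \<theta> n..T} (\<lambda>t. diag_coeff b c n))) {0..T}"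
    using assms by (intro has_integral_cutoff_sum) auto
  moreover have "(\<Sum>n=1..nat \<lfloor>cutoff \<theta> T\<rfloor>. integral {cutoff_time \<theta> n..T} (\<lambda>t. diag_coeff b c n))
     = (\<Sum>n=1..nat \<lfloor>cutoff \<theta> T\<rfloor>. (T - cutoff_time \<theta> n) * diag_coeff b c n)"
  proof (intro sum.cong refl)
    fix n assume "n \<in> {1..nat \<lfloor>cutoff \<theta> T\<rfloor>}"
    then have "cutoff_time \<theta> n \<le> T"
      using le_cutoff_iff[OF assms, of n] cutoff_set_eq[of \<theta> T] by blast
    then show "integral {cutoff_time \<theta> n..T} (\<lambda>t. diag_coeff b c n) = (T - cutoff_time \<theta> n) * diag_coeff b c n"
      by simp
  qed
  ultimately show ?thesis unfolding cutoff_set_eq diag_sum_def by simp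
qed

lemma divide_powr_minus: "(x / y) powr (-a) = y powr a * x powr (-a)" for x y a :: real
proof -
  have "(x / y) powr (-a) = x powr (-a) / y powr (-a)" by (rule powr_divide)
  also have "\<dots> = x powr (-a) * y powr a" unfolding powr_minus[of y] by (simp only: divide_inverse inverse_inverse_eq)
  finally show ?thesis by (simp only: mult.commute)
qed

text \<open>The asymptotics of \<open>diag_sum\<close> require cutoff >= 1, that is t >= 2 pi.
  Nothing is lost below: at T = 2 pi the only index is n = 1, and tau_1 = 2 pi.\<close>

lemma diag_sum_integral:
  assumes \<theta>: "0 < \<theta>" and T: "T \<ge> 2 * pi"
  shows "((\<lambda>t. diag_sum b c (cutoff \<theta> t)) has_integral
     (\<Sum>n=1..nat \<lfloor>cutoff \<theta> T\<rfloor>. (T - cutoff_time \<theta> n) * diag_coeff b c n)) {2 * pi..T}"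
proof -
  define I where "I = (\<lambda>T. \<Sum>n=1..nat \<lfloor>cutoff \<theta> T\<rfloor>. (T - cutoff_time \<theta> n) * diag_coeff b c n)"
  let ?D = "\<lambda>t. diag_sum b c (cutoff \<theta> t)"
  have pi0: "0 \<le> 2 * pi" by simp
  have "cutoff \<theta> (2 * pi) = 1" by (simp add: cutoff_def)
  then have I0: "I (2 * pi) = 0" by (simp add: I_def cutoff_time_def)
  have i: "(?D has_integral I T) {0..T}"
    unfolding I_def by (rule has_integral_diag_sum[OF \<theta> order_trans[OF pi0 T]])
  have i0: "(?D has_integral I (2 * pi)) {0..2 * pi}"
    unfolding I_def by (rule has_integral_diag_sum[OF \<theta> pi0])
  have D: "?D integrable_on {2 * pi..T}"
    by (rule integrable_subinterval_real[OF has_integral_integrable[OF i]]) (use pi0 in simp)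
  have "integral {0..2 * pi} ?D + integral {2 * pi..T} ?D = integral {0..T} ?D"
    by (rule Henstock_Kurzweil_Integration.integral_combine[OF pi0 T has_integral_integrable[OF i]])
  then have "integral {2 * pi..T} ?D = I T"
    using integral_unique[OF i] integral_unique[OF i0] I0 by simp
  then show ?thesis using integrable_integral[OF D] by (simp add: I_def)
qed

lemma has_integral_powr_segment:
  fixes a B p T :: real
  assumes "0 < a" "a \<le> T" "p > 0"
  shows "((\<lambda>t. B * t powr (p - 1)) has_integral (B / p * T powr p - B / p * a powr p)) {a..T}"
proof (rule fundamental_theorem_of_calculus[OF assms(2)])
  fix t assume "t \<in> {a..T}"
  then have t0: "t > 0" using assms by simp
  have "((\<lambda>t. B / p * t powr p) has_real_derivative B / p * (p * t powr (p - 1))) (at t)"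
    by (rule DERIV_cmult[OF has_real_derivative_powr[OF t0]])
  then have "((\<lambda>t. B / p * t powr p) has_real_derivative B * t powr (p - 1)) (at t within {a..T})"
    using assms by (simp add: has_field_derivative_at_within)
  then show "((\<lambda>t. B / p * t powr p) has_vector_derivative B * t powr (p - 1)) (at t within {a..T})"
    by (simp only: has_real_derivative_iff_has_vector_derivative)
qed

text \<open>The pointwise error is C (2 pi)^(theta/2) t^(-theta/2). Its integral is at most this
  constant times T^p / p with p = 1 - theta/2 >= 1/2, hence the factor 2.\<close>

lemma diag_sum_integral_bound:
  fixes G G' :: "real \<Rightarrow> real"
  assumes \<theta>: "0 < \<theta>" "\<theta> < 1" and C: "C \<ge> 0"
    and der: "\<And>t. t \<ge> 2 * pi \<Longrightarrow> (G has_real_derivative G' t) (at t)"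
    and bd: "\<And>t. t \<ge> 2 * pi \<Longrightarrow> \<bar>diag_sum b c (cutoff \<theta> t) - G' t\<bar> \<le> C * cutoff \<theta> t powr (-1/2)"
    and T: "T \<ge> 2 * pi"
  shows "\<bar>(\<Sum>n=1..nat \<lfloor>cutoff \<theta> T\<rfloor>. (T - cutoff_time \<theta> n) * diag_coeff b c n) - (G T - G (2 * pi))\<bar>
     \<le> 2 * C * (2 * pi) powr (\<theta>/2) * T powr (1 - \<theta>/2)"
proof -
  define B where "B = C * (2 * pi) powr (\<theta>/2)"
  define p where "p = 1 - \<theta>/2"
  have p: "p \<ge> 1/2" using \<theta> by (simp add: p_def)
  have B0: "B \<ge> 0" using C by (simp add: B_def)
  have G: "(G' has_integral (G T - G (2 * pi))) {2 * pi..T}"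
  proof (rule fundamental_theorem_of_calculus[OF T])
    fix t assume "t \<in> {2 * pi..T}"
    then have "(G has_real_derivative G' t) (at t within {2 * pi..T})"
      by (intro has_field_derivative_at_within[OF der]) simp
    then show "(G has_vector_derivative G' t) (at t within {2 * pi..T})"
      by (simp only: has_real_derivative_iff_has_vector_derivative)
  qed
  have P: "((\<lambda>t. B * t powr (p - 1)) has_integral (B / p * T powr p - B / p * (2 * pi) powr p)) {2 * pi..T}"
    by (rule has_integral_powr_segment[OF _ T]) (use p in simp_all)
  have bound: "norm (diag_sum b c (cutoff \<theta> t) - G' t) \<le> B * t powr (p - 1)" if "t \<in> {2 * pi..T}" for t
  proof -
    have "norm (diag_sum b c (cutoff \<theta> t) - G' t) \<le> C * cutoff \<theta> t powr (-1/2)" using bd[of t] that by simp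
    also have "cutoff \<theta> t powr (-1/2) = (t / (2 * pi)) powr (-(\<theta>/2))" by (simp add: cutoff_def powr_powr)
    also have "\<dots> = (2 * pi) powr (\<theta>/2) * t powr (-(\<theta>/2))" by (rule divide_powr_minus)
    finally show ?thesis by (simp add: B_def p_def mult.assoc)
  qed
  have "norm ((\<Sum>n=1..nat \<lfloor>cutoff \<theta> T\<rfloor>. (T - cutoff_time \<theta> n) * diag_coeff b c n) - (G T - G (2 * pi)))
      \<le> B / p * T powr p - B / p * (2 * pi) powr p"
    using integral_norm_bound_integral[OF integrable_diff[OF has_integral_integrable has_integral_integrable]
        has_integral_integrable[OF P] bound, OF diag_sum_integral[OF \<theta>(1) T] G]
      integral_unique[OF has_integral_diff[OF diag_sum_integral[OF \<theta>(1) T, of b c] G]] integral_unique[OF P]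
    by simp
  also have "\<dots> \<le> B / p * T powr p" using B0 p by simp
  also have "\<dots> \<le> B / (1/2) * T powr p"
    using B0 p by (intro mult_right_mono divide_left_mono) auto
  finally show ?thesis by (simp add: B_def p_def)
qed

text \<open>Reduces both cases of the theorem to finding an antiderivative G of the main term of
  \<open>diag_sum\<close>. The constant G(2 pi) is absorbed because T^(1/2 + theta/2) >= 1.\<close>

theorem M1_asymptotics:
  fixes G G' :: "real \<Rightarrow> real"
  assumes \<theta>: "0 < \<theta>" "\<theta> < 1" and bc: "b \<ge> 2" "c \<ge> 2" and C: "C \<ge> 0"
    and der: "\<And>t. t \<ge> 2 * pi \<Longrightarrow> (G has_real_derivative G' t) (at t)"
    and bd: "\<And>t. t \<ge> 2 * pi \<Longrightarrow> \<bar>diag_sum b c (cutoff \<theta> t) - G' t\<bar> \<le> C * cutoff \<theta> t powr (-1/2)"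
  shows "(\<lambda>T. M1 \<theta> b c T - of_real (G T)) \<in> O[at_top](\<lambda>T. complex_of_real (err_term \<theta> T))"
proof -
  obtain A where A: "A \<ge> 0" "\<And>T. T \<ge> 2 * pi \<Longrightarrow> norm (M1 \<theta> b c T -
      of_real (\<Sum>n=1..nat \<lfloor>cutoff \<theta> T\<rfloor>. (T - cutoff_time \<theta> n) * diag_coeff b c n)) \<le> A * T powr (1/2 + \<theta>/2)"
    using M1_diagonal_bound[OF \<theta> bc] by blast
  define B where "B = 2 * C * (2 * pi) powr (\<theta>/2)"
  have B0: "B \<ge> 0" using C by (simp add: B_def)
  define K where "K = \<bar>G (2 * pi)\<bar> + A + B"
  have "\<forall>\<^sub>F T in at_top. norm (M1 \<theta> b c T - of_real (G T)) \<le> K * norm (complex_of_real (err_term \<theta> T))"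
    using eventually_ge_at_top[of "2 * pi"]
  proof eventually_elim
    case (elim T)
    have T3: "T \<ge> 3" using elim pi_gt3 by simp
    let ?I = "\<Sum>n=1..nat \<lfloor>cutoff \<theta> T\<rfloor>. (T - cutoff_time \<theta> n) * diag_coeff b c n"
    let ?a = "T powr (1/2 + \<theta>/2)" and ?b = "T powr (1 - \<theta>/2)"
    have "1 \<le> ln T" using T3 exp_le ln_ge_iff[of T 1] by simp
    then have "1 \<le> (ln T)^2" by simp
    then have b: "?b \<le> ?b * (ln T)^2" by (metis mult_left_mono mult.right_neutral powr_ge_zero)
    have err: "?a \<le> err_term \<theta> T" "?b \<le> err_term \<theta> T"
      using b unfolding err_term_def by (auto intro: add_increasing add_increasing2)
    have a1: "1 \<le> ?a" using T3 \<theta> by (intro ge_one_powr_ge_zero) auto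
    have "norm (M1 \<theta> b c T - of_real (G T)) \<le> norm (M1 \<theta> b c T - of_real ?I) + norm (complex_of_real (?I - G T))"
      using norm_triangle_ineq[of "M1 \<theta> b c T - of_real ?I" "complex_of_real (?I - G T)"] by simp
    also have "norm (M1 \<theta> b c T - of_real ?I) \<le> A * ?a" by (rule A(2)[OF elim])
    also have "norm (complex_of_real (?I - G T)) = \<bar>?I - G T\<bar>" by (rule norm_of_real)
    also have "\<bar>?I - G T\<bar> \<le> \<bar>G (2 * pi)\<bar> * 1 + B * ?b"
      using diag_sum_integral_bound[OF \<theta> C der bd elim] unfolding B_def by linarith
    also have "A * ?a + (\<bar>G (2 * pi)\<bar> * 1 + B * ?b) \<le> A * err_term \<theta> T + (\<bar>G (2 * pi)\<bar> * err_term \<theta> T + B * err_term \<theta> T)"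
      using err a1 A(1) B0 by (intro add_mono mult_left_mono) auto
    also have "\<dots> = K * err_term \<theta> T" by (simp add: K_def algebra_simps)
    also have "\<dots> = K * norm (complex_of_real (err_term \<theta> T))"
      using err a1 by (simp only: norm_of_real)
    finally show ?case by simp
  qed
  then show ?thesis by (rule bigoI)
qed

section \<open>Matching the constants of the theorem\<close>

lemma lam_pos:
  assumes "0 < \<theta>" "\<theta> < 1" "r > 0"
  shows "lam \<theta> * r + 1 > 0"
proof -
  have "lam \<theta> > 0" using assms by (simp add: lam_def field_simps)
  then show ?thesis using assms by (intro add_pos_pos mult_pos_pos) auto
qed

text \<open>Integrating t^(p-1) divides by p = 1 - theta (1/2 - 1/(2r)) = theta (lambda r + 1)/(2r);
  this turns the coefficient 2/(r-1) of the diagonal sum into the rational factor of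
  \<open>C1\<close>.\<close>

lemma power_integral_const:
  assumes "0 < \<theta>" "\<theta> < 1" "r > 1"
  shows "4 * r / (\<theta> * (r - 1) * (lam \<theta> * r + 1)) * (1 - \<theta> * (1/2 - 1 / (2 * r))) = 2 / (r - 1)"
proof -
  have p: "1 - \<theta> * (1/2 - 1 / (2 * r)) = \<theta> * (lam \<theta> * r + 1) / (2 * r)"
    using assms by (simp add: lam_def field_simps)
  have "lam \<theta> * r + 1 > 0" using assms by (intro lam_pos) auto
  then have L: "lam \<theta> * r + 1 \<noteq> 0" and R: "r - 1 \<noteq> 0" using assms by auto
  have "4 * r / (\<theta> * R * L) * (\<theta> * L / (2 * r)) = 2 / R" if "R \<noteq> 0" "L \<noteq> 0" for R L
    using that assms by (simp add: divide_simps)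
  from this[OF R L] show ?thesis unfolding p .
qed

lemma cutoff_powr_eq:
  assumes "0 < t" "r \<noteq> 0"
  shows "cutoff \<theta> t powr (1 / (2 * r) - 1/2) =
    (2 * pi) powr (\<theta> * (1/2 - 1 / (2 * r))) * t powr (1 - \<theta> * (1/2 - 1 / (2 * r)) - 1)"
proof -
  have "cutoff \<theta> t powr (1 / (2 * r) - 1/2) = (t / (2 * pi)) powr (-(\<theta> * (1/2 - 1 / (2 * r))))"
    unfolding cutoff_def powr_powr by (simp add: algebra_simps)
  also have "\<dots> = (2 * pi) powr (\<theta> * (1/2 - 1 / (2 * r))) * t powr (-(\<theta> * (1/2 - 1 / (2 * r))))"
    by (rule divide_powr_minus)
  finally show ?thesis by simp
qed

text \<open>With ln X = theta (ln T - ln 2 pi), the derivative of H_r(ln T) T^p is a constant times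
  T^(p-1) times (p H1) ln X + (p H0 + theta H1). These coefficients must be those of
  \<open>diag_sum_asymptotics_eq\<close>.\<close>

lemma H_coefficients:
  assumes "0 < \<theta>" "\<theta> < 1" "r \<ge> 2"
  defines "p \<equiv> 1 - \<theta> * (1/2 - 1 / (2 * real r))"
  shows "p * H1 \<theta> r = E1 r" "p * H0 \<theta> r + \<theta> * H1 \<theta> r = E0 r"
proof -
  define L where "L = lam \<theta> * real r + 1"
  define R where "R = real r - 1"
  have R: "R > 0" using assms by (simp add: R_def)
  have L: "L > 0" unfolding L_def using assms by (intro lam_pos) auto
  \<comment> \<open>The sum L + R = 2r/theta removes r from all expressions; in particular p =
    L/(L+R).\<close>
  have r: "real r = \<theta> * (L + R) / 2" using assms by (simp add: L_def R_def lam_def field_simps)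
  have p: "p = L / (L + R)"
  proof -
    have "p = \<theta> * L / (2 * real r)" using assms by (simp add: p_def L_def lam_def field_simps)
    also have "\<dots> = L / (L + R)" unfolding r using assms by simp
    finally show ?thesis .
  qed
  have LR: "L + R > 0" using L R by simp
  have h1: "H1 \<theta> r = 4 / (\<theta> * R * L)"
  proof -
    have "H1 \<theta> r = 2 / (real r * R) + 2 / (real r * L)" by (simp add: H1_def E1_def F1_def L_def R_def)
    also have "\<dots> = 2 * (L + R) / (real r * R * L)" using L R assms by (simp add: field_simps)
    also have "\<dots> = 4 / (\<theta> * R * L)"
    proof -
      have "2 * S / (\<theta> * S / 2 * R * L) = 4 / (\<theta> * R * L)" if "S > 0" for S
        using that L R assms(1) by (simp add: divide_simps)
      then show ?thesis unfolding r using LR by blast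
    qed
    finally show ?thesis .
  qed
  have e1: "E1 r = 4 / (\<theta> * (L + R) * R)"
  proof -
    have "E1 r = 2 / (real r * R)" by (simp add: E1_def R_def)
    also have "\<dots> = 4 / (\<theta> * (L + R) * R)" unfolding r using assms by simp
    finally show ?thesis .
  qed
  show "p * H1 \<theta> r = E1 r" unfolding p h1 e1 using L R LR assms by (simp add: divide_simps)
  have "H0 \<theta> r = 4 * euler_mascheroni * ((L + R) / (R * L)) + 4 * ((L + R) * (L - R) / (R^2 * L^2))"
  proof -
    have "H0 \<theta> r = 4 * euler_mascheroni * (1 / R + 1 / L) + 4 * (1 / R^2 - 1 / L^2)"
    proof -
      have "H0 \<theta> r = (4 * euler_mascheroni / R + 4 / R^2) + (4 * euler_mascheroni / L - 4 / L^2)"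
        unfolding H0_def E0_def F0_def L_def R_def ..
      then show ?thesis by (simp add: distrib_left right_diff_distrib)
    qed
    also have "1 / R + 1 / L = (L + R) / (R * L)" using L R by (simp add: field_simps)
    also have "1 / R^2 - 1 / L^2 = (L + R) * (L - R) / (R^2 * L^2)"
      using L R by (simp add: field_simps power2_eq_square)
    finally show ?thesis .
  qed
  then have "p * H0 \<theta> r + \<theta> * H1 \<theta> r = 4 * euler_mascheroni * (p * ((L + R) / (R * L)))
      + (4 * (p * ((L + R) * (L - R) / (R^2 * L^2))) + \<theta> * (4 / (\<theta> * R * L)))"
    unfolding h1 by (simp only: distrib_left mult_ac add.assoc)
  also have "p * ((L + R) / (R * L)) = 1 / R" unfolding p using L R LR by (simp add: divide_simps)
  also have "p * ((L + R) * (L - R) / (R^2 * L^2)) = (L - R) / (R^2 * L)"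
    unfolding p using L R LR by (simp add: divide_simps power2_eq_square)
  also have "4 * ((L - R) / (R^2 * L)) + \<theta> * (4 / (\<theta> * R * L)) = 4 / R^2"
    using L R assms by (simp add: divide_simps power2_eq_square)
  finally show "p * H0 \<theta> r + \<theta> * H1 \<theta> r = E0 r" by (simp add: E0_def R_def)
qed

lemma riemann_zeta_of_real:
  assumes "x > 0" "x \<noteq> 1"
  shows "riemann_zeta (of_real x) = of_real (zeta_real x)"
  using riemann_zeta_eq[of "of_real x"] zeta_cont_of_real[OF assms(1)] assms by simp

lemma M1_asymptotics_neq:
  assumes \<theta>: "0 < \<theta>" "\<theta> < 1" and bc: "1 < c" "c < b"
  shows "(\<lambda>T. M1 \<theta> b c T
              - (K1 b c * of_real T
                 - C1 \<theta> c b * of_real (T powr (1 - \<theta> * (1/2 - 1 / (2 * real c))))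
                 - C1 \<theta> b c * of_real (T powr (1 - \<theta> * (1/2 - 1 / (2 * real b))))))
           \<in> O[at_top](\<lambda>T. complex_of_real (err_term \<theta> T))"
proof -
  define z where "z = zeta_real ((1 + real b) / 2) * zeta_real ((1 + real c) / 2)"
  define q where "q = (\<lambda>r s. 4 * real r / (\<theta> * (real r - 1) * (lam \<theta> * real r + 1))
        * (2 * pi) powr (\<theta> * (1/2 - 1 / (2 * real r))) * zeta_real (real s / (2 * real r) + 1/2))"
  define p where "p = (\<lambda>r. 1 - \<theta> * (1/2 - 1 / (2 * real r)))"
  define G where "G = (\<lambda>T. z * T - q c b * T powr p c - q b c * T powr p b)"
  define G' where "G' = (\<lambda>T. z - q c b * (p c * T powr (p c - 1)) - q b c * (p b * T powr (p b - 1)))"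
  have bc': "2 \<le> b" "2 \<le> c" "b \<noteq> c" using bc by auto
  obtain C where C: "C \<ge> 0" "\<And>X. X \<ge> 1 \<Longrightarrow> \<bar>diag_sum b c X - (z
      - 2 / (real c - 1) * zeta_real (real b / (2 * real c) + 1/2) * X powr (1 / (2 * real c) - 1/2)
      - 2 / (real b - 1) * zeta_real (real c / (2 * real b) + 1/2) * X powr (1 / (2 * real b) - 1/2))\<bar>
      \<le> C * X powr (-1/2)"
    using diag_sum_asymptotics_neq[OF bc'] unfolding z_def by blast
  have "(\<lambda>T. M1 \<theta> b c T - of_real (G T)) \<in> O[at_top](\<lambda>T. complex_of_real (err_term \<theta> T))"
  proof (rule M1_asymptotics[OF \<theta> bc'(1,2) C(1)])
    fix t :: real assume t: "t \<ge> 2 * pi"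
    have t0: "t > 0" using t pi_gt3 by linarith
    show "(G has_real_derivative G' t) (at t)"
      unfolding G_def G'_def by (auto intro!: derivative_eq_intros simp: t0)
    have X1: "cutoff \<theta> t \<ge> 1" unfolding cutoff_def using t \<theta> by (intro ge_one_powr_ge_zero) auto
    have main: "2 / (real r - 1) * zeta_real (real s / (2 * real r) + 1/2) * cutoff \<theta> t powr (1 / (2 * real r) - 1/2)
       = q r s * (p r * t powr (p r - 1))" if "r \<ge> 2" for r s :: nat
    proof -
      have c: "4 * real r / (\<theta> * (real r - 1) * (lam \<theta> * real r + 1)) * p r = 2 / (real r - 1)"
        unfolding p_def using that by (intro power_integral_const \<theta>) simp
      have "cutoff \<theta> t powr (1 / (2 * real r) - 1/2) = (2 * pi) powr (\<theta> * (1/2 - 1 / (2 * real r))) * t powr (p r - 1)"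
        unfolding p_def using that t0 by (intro cutoff_powr_eq) auto
      then show ?thesis unfolding c[symmetric] q_def by (simp only: mult_ac)
    qed
    show "\<bar>diag_sum b c (cutoff \<theta> t) - G' t\<bar> \<le> C * cutoff \<theta> t powr (-1/2)"
      using C(2)[OF X1] unfolding G'_def main[OF bc'(1)] main[OF bc'(2)] .
  qed
  moreover have "of_real (G T) = K1 b c * of_real T
                 - C1 \<theta> c b * of_real (T powr (1 - \<theta> * (1/2 - 1 / (2 * real c))))
                 - C1 \<theta> b c * of_real (T powr (1 - \<theta> * (1/2 - 1 / (2 * real b))))" for T
  proof -
    have "K1 b c = of_real z"
      unfolding K1_def z_def using bc' by (simp add: riemann_zeta_of_real[symmetric])
    moreover have "C1 \<theta> r s = of_real (q r s)" if "r \<ge> 2" "s \<ge> 2" "r \<noteq> s" for r s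
    proof -
      have *: "real s / (2 * real r) + 1/2 > 0" "real s / (2 * real r) + 1/2 \<noteq> 1"
        using that by (auto simp: field_simps add_pos_pos)
      show ?thesis unfolding C1_def q_def riemann_zeta_of_real[OF *] by (simp only: of_real_mult)
    qed
    ultimately show ?thesis using bc' by (simp add: G_def p_def)
  qed
  ultimately show ?thesis by simp
qed

lemma M1_asymptotics_eq:
  assumes \<theta>: "0 < \<theta>" "\<theta> < 1" and b: "1 < b"
  shows "(\<lambda>T. M1 \<theta> b b T
              - (K1 b b * of_real T
                 - of_real (Hpoly \<theta> b (ln T) * T powr (1 - \<theta> * (1/2 - 1 / (2 * real b))))))
           \<in> O[at_top](\<lambda>T. complex_of_real (err_term \<theta> T))"
proof -
  define z where "z = zeta_real ((1 + real b) / 2) * zeta_real ((1 + real b) / 2)"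
  define p where "p = 1 - \<theta> * (1/2 - 1 / (2 * real b))"
  define W where "W = (2 * pi) powr (\<theta> * (1/2 - 1 / (2 * real b)))"
  define G where "G = (\<lambda>T. z * T - Hpoly \<theta> b (ln T) * T powr p)"
  define G' where "G' = (\<lambda>T. z - (W * (\<theta> * H1 \<theta> b * (1 / T)) * T powr p + Hpoly \<theta> b (ln T) * (p * T powr (p - 1))))"
  have b': "2 \<le> b" using b by simp
  obtain C where C: "C \<ge> 0" "\<And>X. X \<ge> 1 \<Longrightarrow> \<bar>diag_sum b b X - (z
      - X powr (1 / (2 * real b) - 1/2) * (E1 b * ln X + E0 b))\<bar> \<le> C * X powr (-1/2)"
    using diag_sum_asymptotics_eq[OF b'] unfolding z_def by blast
  have "(\<lambda>T. M1 \<theta> b b T - of_real (G T)) \<in> O[at_top](\<lambda>T. complex_of_real (err_term \<theta> T))"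
  proof (rule M1_asymptotics[OF \<theta> b' b' C(1)])
    fix t :: real assume t: "t \<ge> 2 * pi"
    have t0: "t > 0" using t pi_gt3 by linarith
    show "(G has_real_derivative G' t) (at t)"
      unfolding G_def G'_def Hpoly_def W_def[symmetric]
      by (auto intro!: derivative_eq_intros simp: t0 divide_inverse)
    have X1: "cutoff \<theta> t \<ge> 1" unfolding cutoff_def using t \<theta> by (intro ge_one_powr_ge_zero) auto
    have X: "cutoff \<theta> t powr (1 / (2 * real b) - 1/2) = W * t powr (p - 1)"
      unfolding p_def W_def using b t0 by (intro cutoff_powr_eq) auto
    have lnX: "ln (cutoff \<theta> t) = \<theta> * (ln t - ln (2 * pi))"
      using t0 by (simp add: cutoff_def ln_powr ln_div)
    have tp: "1 / t * t powr p = t powr (p - 1)" using t0 by (simp add: powr_diff)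
    have "W * (\<theta> * H1 \<theta> b * (1 / t)) * t powr p + Hpoly \<theta> b (ln t) * (p * t powr (p - 1))
        = W * t powr (p - 1) * (\<theta> * H1 \<theta> b) + Hpoly \<theta> b (ln t) * (p * t powr (p - 1))"
      unfolding tp[symmetric] by (simp only: mult_ac)
    \<comment> \<open>Collects the derivative as a polynomial in theta (ln t - ln (2 pi)), the
      logarithm of the cutoff.\<close>
    also have "\<dots> = W * t powr (p - 1) * (p * H1 \<theta> b * (\<theta> * (ln t - ln (2 * pi))) + (p * H0 \<theta> b + \<theta> * H1 \<theta> b))"
      unfolding Hpoly_def W_def[symmetric] by (simp add: algebra_simps)
    also have "p * H1 \<theta> b = E1 b" unfolding p_def by (rule H_coefficients(1)[OF \<theta> b'])
    also have "p * H0 \<theta> b + \<theta> * H1 \<theta> b = E0 b" unfolding p_def by (rule H_coefficients(2)[OF \<theta> b'])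
    finally have "G' t = z - W * t powr (p - 1) * (E1 b * (\<theta> * (ln t - ln (2 * pi))) + E0 b)"
      unfolding G'_def by simp
    then show "\<bar>diag_sum b b (cutoff \<theta> t) - G' t\<bar> \<le> C * cutoff \<theta> t powr (-1/2)"
      using C(2)[OF X1] unfolding X lnX by simp
  qed
  moreover have "K1 b b = of_real z"
    unfolding K1_def z_def using b by (simp add: riemann_zeta_of_real[symmetric])
  ultimately show ?thesis by (simp add: G_def p_def)
qed

theorem theorem1p3:
  fixes b c :: nat and \<theta> :: real
  assumes "0 < \<theta>" and "\<theta> < 1"
  shows "(1 < c \<and> c < b \<longrightarrow>
           (\<lambda>T. M1 \<theta> b c T
              - (K1 b c * of_real T
                 - C1 \<theta> c b * of_real (T powr (1 - \<theta> * (1/2 - 1 / (2 * real c))))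
                 - C1 \<theta> b c * of_real (T powr (1 - \<theta> * (1/2 - 1 / (2 * real b))))))
           \<in> O[at_top](\<lambda>T. complex_of_real (err_term \<theta> T)))
       \<and> (b = c \<and> 1 < b \<longrightarrow>
           (\<lambda>T. M1 \<theta> b b T
              - (K1 b b * of_real T
                 - of_real (Hpoly \<theta> b (ln T) * T powr (1 - \<theta> * (1/2 - 1 / (2 * real b))))))
           \<in> O[at_top](\<lambda>T. complex_of_real (err_term \<theta> T)))"
  using M1_asymptotics_neq[OF assms] M1_asymptotics_eq[OF assms] by blast

end
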